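(* Let $G=\mathrm{GL}_r$ over a non-archimedean local field $F$ with residue field of cardinality $v^{-1}$, let $q\in\mathbb C^\times$ with $q^2=v$, let $1\le k\le r-1$, and let $\mathbf z\in(\mathbb C^\times)^r$ satisfy $z_a/z_b\notin\{1,v,v^{-1}\}$ for all $a\neq b$. Then the following diagram commutes: $$\begin{array}{ccccc} I(\mathbf z)^J&\xrightarrow{\ \theta_{\mathbf z}\ }&U_r^{\mathrm{alt}}(\mathbf z)&\xrightarrow{\ \xi_{\mathbf z}\ }&V_r^{\mathrm{alt}}(\mathbf z)\\ {\scriptstyle\bar{\mathcal A}^{\mathbf z}_{s_k}}\big\downarrow&&{\scriptstyle R_{\mathrm{col}}(\mathbf z^{\alpha_k})_{k,k+1}}\big\downarrow&&\big\downarrow{\scriptstyle -q\,R_q(\mathbf z^{\alpha_k})_{k,k+1}}\\ I(s_k\mathbf z)^J&\xrightarrow{\theta_{s_k\mathbf z}}&U_r^{\mathrm{alt}}(s_k\mathbf z)&\xrightarrow{\xi_{s_k\mathbf z}}&V_r^{\mathrm{alt}}(s_k\mathbf z)\end{array}$$ That is, $\theta_{s_k\mathbf z}\circ\bar{\mathcal A}^{\mathbf z}_{s_k}=R_{\mathrm{col}}(\mathbf z^{\alpha_k})_{k,k+1}\circ\theta_{\mathbf z}$ on $I(\mathbf z)^J$ and $\xi_{s_k\mathbf z}\circ R_{\mathrm{col}}(\mathbf z^{\alpha_k})_{k,k+1}=-q\,R_q(\mathbf z^{\alpha_k})_{k,k+1}\circ\xi_{\mathbf z}$ on $U_r^{\mathrm{alt}}(\mathbf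 z)$.
   Context: **Principal series.** $F$ has ring of integers $\mathfrak o$, maximal ideal $\mathfrak p$, uniformizer $\varpi$. $B=TN$ is the upper triangular Borel subgroup of $\mathrm{GL}_r$, $N_-$ the lower unitriangular matrices, $W=S_r$ (permutation matrices), $s_k$ the simple reflection exchanging $k,k+1$, acting on $\mathbf z$ by exchanging $z_k,z_{k+1}$; $\mathbf z^{\alpha_k}=z_k/z_{k+1}$. $\tau_{\mathbf z}$ is the character of $B(F)$ trivial on $N(F)$ and $T(\mathfrak o)$ with $\tau_{\mathbf z}(\mathrm{diag}(\varpi^{\lambda_1},\dots,\varpi^{\lambda_r}))=\prod z_i^{\lambda_i}$; $\delta$ is the modular quasicharacter of $B(F)$ ($\delta(t)=|\det(\mathrm{Ad}(t)|_{\mathrm{Lie}\,N})|$ on $T(F)$). $I(\mathbf z)$ is the space of locally constant $f:\mathrm{GL}_r(F)\to\mathbb C$ with $f(bg)=\delta^{1/2}\tau_{\mathbf z}(b)f(g)$. $J$ is the Iwahori subgroup of matrices in $\mathrm{GL}_r(\mathfrak o)$ that are lower triangular mod $\mathfrak p$. $I(\mathbf z)^J$ has basis $\Phi_w^{\mathbf z}$ ($w\in W$), supported on $B(F)wJ$ with $\Phi_w^{\mathbf z}(bwj)=\delta^{1/2}\tau_{\mathbf z}(b)$, $j\in J$. The intertwining operator $\mathcal A_w^{\mathbf z}:I(\mathbf z)\to I(w\mathbf z)$ is $\mathcal A_w^{\mathbf z}\Phi(g)=\int_{N(F)\cap wN_-(F)w^{-1}}\Phi(w^{-1}ng)\,dn$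 (Haar measure giving the $\mathfrak o$-points volume 1; meromorphically continued in $\mathbf z$), and $\bar{\mathcal A}^{\mathbf z}_{s_k}=\frac{1-\mathbf z^{\alpha_k}}{1-v\mathbf z^{\alpha_k}}\mathcal A^{\mathbf z}_{s_k}$. **R-matrices.** $V_r(z)$ and $U_r(z)$ ($z\in\mathbb C^\times$) are $r$-dimensional vector spaces with bases $v_1(z),\dots,v_r(z)$, respectively $u_1(z),\dots,u_r(z)$ ($V_r(z)$ is the evaluation representation of a Drinfeld twist of the quantum affine algebra $U_q(\widehat{\mathfrak{gl}}(r))$). $e_{ij}$ denotes the matrix unit sending the $j$-th basis vector to the $i$-th, regarded as a map between these spaces for the appropriate parameters. $R_q(\mathbf z^{\alpha_k}):V_r(z_k)\otimes V_r(z_{k+1})\to V_r(z_{k+1})\otimes V_r(z_k)$ is, with $x=\mathbf z^{\alpha_k}$, $$R_q(x)=\tfrac1{1-q^2x}\Bigl[\sum_i(q-xq^{-1})e_{ii}\otimes e_{ii}+\sum_{i>j}\bigl(-q^{-1}(1-x)e_{ij}\otimes e_{ji}-q(1-x)e_{ji}\otimes e_{ij}\bigr)+\sum_{i>j}\bigl((q-q^{-1})e_{jj}\otimes e_{ii}+x(q-q^{-1})e_{ii}\otimes e_{jj}\bigr)\Bigr].$$ $R_{\mathrm{col}}(\mathbf z^{\alpha_k}):U_r(z_k)\otimes U_r(z_{k+1})\to U_r(z_{k+1})\otimes U_r(z_k)$ is the restriction to colored edges of the lattice model R-matrix, explicitly $$R_{\mathrm{col}}(x)=\sum_ie_{ii}\otimes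 e_{ii}+\sum_{i>j}\Bigl(\tfrac{1-x}{1-vx}e_{ij}\otimes e_{ji}+\tfrac{v(1-x)}{1-vx}e_{ji}\otimes e_{ij}+\tfrac{1-v}{1-vx}e_{jj}\otimes e_{ii}+\tfrac{(1-v)x}{1-vx}e_{ii}\otimes e_{jj}\Bigr).$$ Here $i>j$ refers to the usual order of integers. A subscript $k,k+1$ means acting on the $k$-th and $(k+1)$-st tensor factors and as the identity elsewhere (relabeling $\mathbf z$ to $s_k\mathbf z$). $V_r^{\mathrm{alt}}(\mathbf z)\subset V_r(z_1)\otimes\cdots\otimes V_r(z_r)$ is the span of $v_{\mathbf i}(\mathbf z)=v_{i_1}(z_1)\otimes\cdots\otimes v_{i_r}(z_r)$ with $\mathbf i=(i_1,\dots,i_r)$ a permutation of $\mathbf i_0=(1,2,\dots,r)$, and $U_r^{\mathrm{alt}}(\mathbf z)$ is defined likewise with $u_{\mathbf i}(\mathbf z)$. $w(\mathbf i_0)=(w^{-1}(1),\dots,w^{-1}(r))$. The isomorphisms are $\theta_{\mathbf z}(\Phi_w^{\mathbf z})=u_{w(\mathbf i_0)}(\mathbf z)$ and $\xi_{\mathbf z}(u_{w(\mathbf i_0)}(\mathbf z))=v_{w(\mathbf i_0)}(\mathbf z)$. *)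

theory Defs
  imports
    "HOL-Analysis.Analysis"
    "HOL-Library.Poly_Mapping"
    "Jordan_Normal_Form.Determinant"
begin

text \<open>
  Conventions.  All indices are zero-based: rows and columns of matrices, tensor factors, basis
  vectors of the \<open>r\<close>-dimensional spaces and the permutations in \<open>W\<close> all live on
  \<open>{..<r}\<close>.  The simple reflection with index \<open>k\<close> (where \<open>Suc k < r\<close>)
  exchanges \<open>k\<close> and \<open>Suc k\<close>.
\<close>

section \<open>Non-archimedean local fields\<close>

text \<open>
  The field is the type \<open>'a\<close>, with normalised valuation \<open>val\<close>; the value of
  \<open>val\<close> at \<open>0\<close> is irrelevant, \<open>0\<close> lies in every power of the maximal
  ideal by convention.
\<close>

definition p_power :: "('a::field \<Rightarrow> int) \<Rightarrow> int \<Rightarrow> 'a set" where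
  "p_power val n = {x. x = 0 \<or> n \<le> val x}"

abbreviation int_ring :: "('a::field \<Rightarrow> int) \<Rightarrow> 'a set" where
  "int_ring val \<equiv> p_power val 0"

definition residue_classes :: "('a::field \<Rightarrow> int) \<Rightarrow> 'a set set" where
  "residue_classes val =
     int_ring val // {(x, y). x \<in> int_ring val \<and> y \<in> int_ring val \<and> x - y \<in> p_power val 1}"

locale nonarch_local_field =
  fixes val :: "'a::field \<Rightarrow> int"
  assumes val_mult: "x \<noteq> 0 \<Longrightarrow> y \<noteq> 0 \<Longrightarrow> val (x * y) = val x + val y"
    and val_add: "x \<noteq> 0 \<Longrightarrow> y \<noteq> 0 \<Longrightarrow> x + y \<noteq> 0 \<Longrightarrow> min (val x) (val y) \<le> val (x + y)"
    and uniformizer: "\<exists>x. x \<noteq> 0 \<and> val x = 1"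
    and finite_residue_field: "finite (residue_classes val)"
    and complete:
      "(\<And>n. \<exists>M. \<forall>i\<ge>M. \<forall>j\<ge>M. X i - X j \<in> p_power val n) \<Longrightarrow>
       \<exists>L. \<forall>n. \<exists>M. \<forall>i\<ge>M. X (i::nat) - L \<in> p_power val n"

definition v_par :: "('a::field \<Rightarrow> int) \<Rightarrow> real" where
  "v_par val = 1 / real (card (residue_classes val))"

definition abs_F :: "('a::field \<Rightarrow> int) \<Rightarrow> 'a \<Rightarrow> real" where
  "abs_F val x = (if x = 0 then 0 else v_par val powi val x)"


section \<open>Subgroups of the general linear group\<close>

definition GL :: "nat \<Rightarrow> 'a::field mat set" where
  "GL r = {g \<in> carrier_mat r r. Determinant.det g \<noteq> 0}"

definition borel_B :: "nat \<Rightarrow> 'a::field mat set" where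
  "borel_B r = {g \<in> GL r. \<forall>i<r. \<forall>j<i. g $$ (i, j) = 0}"

definition unip_N :: "nat \<Rightarrow> 'a::field mat set" where
  "unip_N r = {g \<in> borel_B r. \<forall>i<r. g $$ (i, i) = 1}"

definition unip_N_minus :: "nat \<Rightarrow> 'a::field mat set" where
  "unip_N_minus r = {g \<in> GL r. (\<forall>j<r. \<forall>i<j. g $$ (i, j) = 0) \<and> (\<forall>i<r. g $$ (i, i) = 1)}"

definition integral_mats :: "('a::field \<Rightarrow> int) \<Rightarrow> nat \<Rightarrow> 'a mat set" where
  "integral_mats val r = {g \<in> carrier_mat r r. \<forall>i<r. \<forall>j<r. g $$ (i, j) \<in> int_ring val}"

definition GL_int :: "('a::field \<Rightarrow> int) \<Rightarrow> nat \<Rightarrow> 'a mat set" where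
  "GL_int val r = {g \<in> GL r. g \<in> integral_mats val r \<and> val (Determinant.det g) = 0}"

definition iwahori_J :: "('a::field \<Rightarrow> int) \<Rightarrow> nat \<Rightarrow> 'a mat set" where
  "iwahori_J val r = {g \<in> GL_int val r. \<forall>j<r. \<forall>i<j. g $$ (i, j) \<in> p_power val 1}"

definition weyl :: "nat \<Rightarrow> (nat \<Rightarrow> nat) set" where
  "weyl r = {w. w permutes {..<r}}"

abbreviation winv :: "(nat \<Rightarrow> nat) \<Rightarrow> nat \<Rightarrow> nat" where
  "winv w \<equiv> inv_into UNIV w"

text \<open>The matrix of \<open>w\<close> sends the \<open>j\<close>-th standard basis vector to the
  \<open>w j\<close>-th; thus \<open>perm_mat r\<close> is multiplicative.\<close>

definition perm_mat :: "nat \<Rightarrow> (nat \<Rightarrow> nat) \<Rightarrow> 'a::field mat" where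
  "perm_mat r w = Matrix.mat r r (\<lambda>(i, j). if i = w j then 1 else 0)"

definition simple_refl :: "nat \<Rightarrow> nat \<Rightarrow> nat" where
  "simple_refl k = Transposition.transpose k (Suc k)"

text \<open>The subgroup \<open>N(F) \<inter> w N_-(F) w\<inverse>\<close>.\<close>

definition N_w :: "nat \<Rightarrow> (nat \<Rightarrow> nat) \<Rightarrow> 'a::field mat set" where
  "N_w r w =
     unip_N r \<inter> {perm_mat r w * n * perm_mat r (winv w) | n. n \<in> unip_N_minus r}"

text \<open>The entrywise \<open>\<pp>\<^sup>n\<close>-neighbourhoods, a neighbourhood base of the topology
  of matrices over the field.\<close>

definition mat_near :: "('a::field \<Rightarrow> int) \<Rightarrow> nat \<Rightarrow> int \<Rightarrow> 'a mat \<Rightarrow> 'a mat \<Rightarrow> bool" where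
  "mat_near val r n g h \<longleftrightarrow> (\<forall>i<r. \<forall>j<r. h $$ (i, j) - g $$ (i, j) \<in> p_power val n)"

definition open_subsets :: "('a::field \<Rightarrow> int) \<Rightarrow> nat \<Rightarrow> 'a mat set \<Rightarrow> 'a mat set set" where
  "open_subsets val r H =
     {A. A \<subseteq> H \<and> (\<forall>g\<in>A. \<exists>n. \<forall>h\<in>H. mat_near val r n g h \<longrightarrow> h \<in> A)}"

definition is_haar_measure ::
    "('a::field \<Rightarrow> int) \<Rightarrow> nat \<Rightarrow> 'a mat set \<Rightarrow> 'a mat measure \<Rightarrow> bool" where
  "is_haar_measure val r H \<mu> \<longleftrightarrow>
     space \<mu> = H \<and> sets \<mu> = sigma_sets H (open_subsets val r H) \<and>
     (\<forall>h\<in>H. \<forall>A\<in>sets \<mu>. emeasure \<mu> ((\<lambda>x. h * x) ` A) = emeasure \<mu> A) \<and>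
     emeasure \<mu> (H \<inter> integral_mats val r) = 1"


section \<open>Principal series\<close>

text \<open>Spectral parameters: the torus \<open>(\<complex>\<^sup>\<times>)\<^sup>r\<close>, as extensional
  functions on \<open>{..<r}\<close>.\<close>

definition spec_torus :: "nat \<Rightarrow> (nat \<Rightarrow> complex) set" where
  "spec_torus r = {..<r} \<rightarrow>\<^sub>E - {0}"

definition weyl_act :: "(nat \<Rightarrow> nat) \<Rightarrow> (nat \<Rightarrow> complex) \<Rightarrow> nat \<Rightarrow> complex" where
  "weyl_act w z = (\<lambda>i. z (winv w i))"

definition z_alpha :: "(nat \<Rightarrow> complex) \<Rightarrow> nat \<Rightarrow> complex" where
  "z_alpha z k = z k / z (Suc k)"

text \<open>Both characters of \<open>B(F)\<close> depend only on the diagonal of \<open>b\<close>.  The torus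
  element \<open>diag(t)\<close> acts on the root vector \<open>E\<^sub>i\<^sub>j\<close> (\<open>i < j\<close>) of
  \<open>Lie N\<close> by \<open>t\<^sub>i / t\<^sub>j\<close>, whence the formula for the modular
  quasicharacter.\<close>

definition modular_delta :: "('a::field \<Rightarrow> int) \<Rightarrow> nat \<Rightarrow> 'a mat \<Rightarrow> real" where
  "modular_delta val r b = (\<Prod>j<r. \<Prod>i<j. abs_F val (b $$ (i, i) / b $$ (j, j)))"

definition tau :: "('a::field \<Rightarrow> int) \<Rightarrow> nat \<Rightarrow> (nat \<Rightarrow> complex) \<Rightarrow> 'a mat \<Rightarrow> complex" where
  "tau val r z b = (\<Prod>i<r. z i powi val (b $$ (i, i)))"

definition delta_half_tau ::
    "('a::field \<Rightarrow> int) \<Rightarrow> nat \<Rightarrow> (nat \<Rightarrow> complex) \<Rightarrow> 'a mat \<Rightarrow> complex" where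
  "delta_half_tau val r z b = complex_of_real (sqrt (modular_delta val r b)) * tau val r z b"

text \<open>Functions on \<open>GL\<^sub>r(F)\<close> are extended by zero to all matrices.\<close>

definition principal_series ::
    "('a::field \<Rightarrow> int) \<Rightarrow> nat \<Rightarrow> (nat \<Rightarrow> complex) \<Rightarrow> ('a mat \<Rightarrow> complex) set" where
  "principal_series val r z =
     {f. (\<forall>g. g \<notin> GL r \<longrightarrow> f g = 0) \<and>
         (\<forall>g\<in>GL r. \<exists>n. \<forall>h\<in>GL r. mat_near val r n g h \<longrightarrow> f h = f g) \<and>
         (\<forall>b\<in>borel_B r. \<forall>g\<in>GL r. f (b * g) = delta_half_tau val r z b * f g)}"

definition iwahori_fixed ::
    "('a::field \<Rightarrow> int) \<Rightarrow> nat \<Rightarrow> (nat \<Rightarrow> complex) \<Rightarrow> ('a mat \<Rightarrow> complex) set" where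
  "iwahori_fixed val r z =
     {f \<in> principal_series val r z. \<forall>g\<in>GL r. \<forall>j\<in>iwahori_J val r. f (g * j) = f g}"

definition Phi ::
    "('a::field \<Rightarrow> int) \<Rightarrow> nat \<Rightarrow> (nat \<Rightarrow> complex) \<Rightarrow> (nat \<Rightarrow> nat) \<Rightarrow> 'a mat \<Rightarrow> complex" where
  "Phi val r z w g =
     (if \<exists>b\<in>borel_B r. \<exists>j\<in>iwahori_J val r. g = b * perm_mat r w * j
      then THE c. \<exists>b\<in>borel_B r. \<exists>j\<in>iwahori_J val r.
             g = b * perm_mat r w * j \<and> c = delta_half_tau val r z b
      else 0)"


section \<open>Intertwining operators\<close>

text \<open>The flat section through \<open>f\<close>: the element of the principal series with parameter
  \<open>y\<close> that agrees with \<open>f\<close> on \<open>GL\<^sub>r(\<oo>)\<close>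
  (Iwasawa decomposition).  In particular the flat section through \<open>Phi val r z w\<close> is
  \<open>y \<mapsto> Phi val r y w\<close>.\<close>

definition flat_section ::
    "('a::field \<Rightarrow> int) \<Rightarrow> nat \<Rightarrow> ('a mat \<Rightarrow> complex) \<Rightarrow> (nat \<Rightarrow> complex) \<Rightarrow> 'a mat \<Rightarrow> complex" where
  "flat_section val r f y g =
     (if g \<in> GL r
      then THE c. \<exists>b\<in>borel_B r. \<exists>h\<in>GL_int val r.
             g = b * h \<and> c = delta_half_tau val r y b * f h
      else 0)"

text \<open>Holomorphic functions of several variables on the torus: continuous and holomorphic in
  each variable separately.\<close>

definition holomorphic_on_torus :: "nat \<Rightarrow> ((nat \<Rightarrow> complex) \<Rightarrow> complex) \<Rightarrow> bool" where
  "holomorphic_on_torus r P \<longleftrightarrow>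
     continuous_on (spec_torus r) P \<and>
     (\<forall>z\<in>spec_torus r. \<forall>i<r. (\<lambda>t. P (z(i := t))) holomorphic_on - {0})"

text \<open>The value at \<open>z\<close> of the meromorphic continuation to the torus of a function
  \<open>h\<close> given on \<open>\<Omega>\<close>.  As the torus is a Stein manifold, a meromorphic
  function on it that is regular at \<open>z\<close> is a quotient \<open>P / Q\<close> of global
  holomorphic functions with \<open>Q z \<noteq> 0\<close>; if \<open>\<Omega>\<close> has nonempty
  interior, the value does not depend on the choice of \<open>P\<close> and \<open>Q\<close>.\<close>

definition mero_continuation ::
    "nat \<Rightarrow> (nat \<Rightarrow> complex) set \<Rightarrow> ((nat \<Rightarrow> complex) \<Rightarrow> complex) \<Rightarrow> (nat \<Rightarrow> complex) \<Rightarrow> complex" where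
  "mero_continuation r \<Omega> h z =
     (THE c. \<exists>P Q. holomorphic_on_torus r P \<and> holomorphic_on_torus r Q \<and>
               (\<forall>y\<in>\<Omega>. Q y * h y = P y) \<and> Q z \<noteq> 0 \<and> c = P z / Q z)"

text \<open>The operator \<open>A\<^sub>w\<close> on the principal series with parameter \<open>z\<close>;
  \<open>\<mu>\<close> is the normalised Haar measure on \<open>N_w r w\<close>.  The continuation
  starts from the parameters for which the integral converges absolutely.\<close>

definition intertwining ::
    "('a::field \<Rightarrow> int) \<Rightarrow> nat \<Rightarrow> 'a mat measure \<Rightarrow> (nat \<Rightarrow> nat) \<Rightarrow> (nat \<Rightarrow> complex) \<Rightarrow>
     ('a mat \<Rightarrow> complex) \<Rightarrow> 'a mat \<Rightarrow> complex" where
  "intertwining val r \<mu> w z f g =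
     (if g \<in> GL r
      then mero_continuation r
             {y \<in> spec_torus r. \<forall>g'\<in>GL r.
                integrable \<mu> (\<lambda>n. flat_section val r f y (perm_mat r (winv w) * n * g'))}
             (\<lambda>y. \<integral>n. flat_section val r f y (perm_mat r (winv w) * n * g) \<partial>\<mu>)
             z
      else 0)"

definition norm_intertwining ::
    "('a::field \<Rightarrow> int) \<Rightarrow> nat \<Rightarrow> 'a mat measure \<Rightarrow> nat \<Rightarrow> (nat \<Rightarrow> complex) \<Rightarrow>
     ('a mat \<Rightarrow> complex) \<Rightarrow> 'a mat \<Rightarrow> complex" where
  "norm_intertwining val r \<mu> k z f g =
     (1 - z_alpha z k) / (1 - complex_of_real (v_par val) * z_alpha z k) *
     intertwining val r \<mu> (simple_refl k) z f g"


section \<open>Tensor products of evaluation modules and R-matrices\<close>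

text \<open>\<open>EvB F i y\<close> is the \<open>i\<close>-th basis vector of \<open>U\<^sub>r(y)\<close> or
  \<open>V\<^sub>r(y)\<close>, according to \<open>F\<close>.  A tensor product of such spaces is the free
  complex vector space on lists of basis vectors, one for each factor.\<close>

datatype ev_family = U_fam | V_fam

datatype ev_basis = EvB (fam: ev_family) (idx: nat) (par: complex)

type_synonym tensor = "ev_basis list \<Rightarrow>\<^sub>0 complex"

definition smul :: "complex \<Rightarrow> tensor \<Rightarrow> tensor" where
  "smul c t = Poly_Mapping.map (\<lambda>a. c * a) t"

definition linear_ext :: "(ev_basis list \<Rightarrow> tensor) \<Rightarrow> tensor \<Rightarrow> tensor" where
  "linear_ext f t = (\<Sum>bs\<in>Poly_Mapping.keys t. smul (Poly_Mapping.lookup t bs) (f bs))"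

definition basis_tensor ::
    "ev_family \<Rightarrow> nat \<Rightarrow> (nat \<Rightarrow> complex) \<Rightarrow> (nat \<Rightarrow> nat) \<Rightarrow> tensor" where
  "basis_tensor F r z i = Poly_Mapping.single (map (\<lambda>m. EvB F (i m) (z m)) [0..<r]) 1"

text \<open>\<open>w(i\<^sub>0)\<close> for \<open>i\<^sub>0 = (0, \<dots>, r - 1)\<close>.\<close>

definition w_i0 :: "(nat \<Rightarrow> nat) \<Rightarrow> nat \<Rightarrow> nat" where
  "w_i0 w = winv w"

definition alt_space :: "ev_family \<Rightarrow> nat \<Rightarrow> (nat \<Rightarrow> complex) \<Rightarrow> tensor set" where
  "alt_space F r z = {\<Sum>p\<in>weyl r. smul (c p) (basis_tensor F r z p) | c. True}"

text \<open>\<open>e\<^sub>i\<^sub>j \<otimes> e\<^sub>l\<^sub>m\<close> acting on the tensor factors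
  \<open>k\<close> and \<open>Suc k\<close>, whose evaluation parameters it exchanges.\<close>

definition unit_pair :: "nat \<Rightarrow> nat \<Rightarrow> nat \<Rightarrow> nat \<Rightarrow> nat \<Rightarrow> tensor \<Rightarrow> tensor" where
  "unit_pair k i j l m = linear_ext (\<lambda>bs.
     if idx (bs ! k) = j \<and> idx (bs ! Suc k) = m
     then Poly_Mapping.single
            (bs[k := EvB (fam (bs ! k)) i (par (bs ! Suc k)),
                Suc k := EvB (fam (bs ! Suc k)) l (par (bs ! k))]) 1
     else 0)"

definition R_q :: "nat \<Rightarrow> complex \<Rightarrow> nat \<Rightarrow> complex \<Rightarrow> tensor \<Rightarrow> tensor" where
  "R_q r q k x t = smul (1 / (1 - q\<^sup>2 * x))
     ((\<Sum>i<r. smul (q - x * inverse q) (unit_pair k i i i i t)) +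
      (\<Sum>i<r. \<Sum>j<i. smul (- inverse q * (1 - x)) (unit_pair k i j j i t) +
                     smul (- q * (1 - x)) (unit_pair k j i i j t)) +
      (\<Sum>i<r. \<Sum>j<i. smul (q - inverse q) (unit_pair k j j i i t) +
                     smul (x * (q - inverse q)) (unit_pair k i i j j t)))"

definition R_col :: "nat \<Rightarrow> complex \<Rightarrow> nat \<Rightarrow> complex \<Rightarrow> tensor \<Rightarrow> tensor" where
  "R_col r v k x t =
     (\<Sum>i<r. unit_pair k i i i i t) +
     (\<Sum>i<r. \<Sum>j<i.
        smul ((1 - x) / (1 - v * x)) (unit_pair k i j j i t) +
        smul (v * (1 - x) / (1 - v * x)) (unit_pair k j i i j t) +
        smul ((1 - v) / (1 - v * x)) (unit_pair k j j i i t) +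
        smul ((1 - v) * x / (1 - v * x)) (unit_pair k i i j j t))"

text \<open>The linear maps determined by their values on the bases: expand the argument in the
  basis and map each basis vector to its image.\<close>

definition theta ::
    "('a::field \<Rightarrow> int) \<Rightarrow> nat \<Rightarrow> (nat \<Rightarrow> complex) \<Rightarrow> ('a mat \<Rightarrow> complex) \<Rightarrow> tensor" where
  "theta val r z f =
     (THE u. \<exists>c. (\<forall>g. f g = (\<Sum>w\<in>weyl r. c w * Phi val r z w g)) \<and>
                 u = (\<Sum>w\<in>weyl r. smul (c w) (basis_tensor U_fam r z (w_i0 w))))"

definition xi :: "nat \<Rightarrow> (nat \<Rightarrow> complex) \<Rightarrow> tensor \<Rightarrow> tensor" where
  "xi r z u =
     (THE t. \<exists>c. u = (\<Sum>w\<in>weyl r. smul (c w) (basis_tensor U_fam r z (w_i0 w))) \<and>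
                 t = (\<Sum>w\<in>weyl r. smul (c w) (basis_tensor V_fam r z (w_i0 w))))"


section \<open>Commutative squares\<close>

text \<open>Top, left, right and bottom arrow, in this order.\<close>

definition commutative_square ::
    "'a set \<Rightarrow> 'b set \<Rightarrow> 'c set \<Rightarrow> 'd set \<Rightarrow>
     ('a \<Rightarrow> 'b) \<Rightarrow> ('a \<Rightarrow> 'c) \<Rightarrow> ('b \<Rightarrow> 'd) \<Rightarrow> ('c \<Rightarrow> 'd) \<Rightarrow> bool" where
  "commutative_square X Y X' Y' f g h l \<longleftrightarrow>
     f \<in> X \<rightarrow> Y \<and> g \<in> X \<rightarrow> X' \<and> h \<in> Y \<rightarrow> Y' \<and> l \<in> X' \<rightarrow> Y' \<and>
     (\<forall>x\<in>X. l (g x) = h (f x))"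

end

theory Submission
  imports Defs "HOL-Complex_Analysis.Conformal_Mappings"
begin

text \<open>
  The values of an Iwahori-fixed vector \<open>f\<close> on permutation matrices are its coordinates in
  the basis \<open>\<Phi>\<^sub>w\<close>, because \<open>GL\<^sub>r(F)\<close> is the disjoint union of the
  cosets \<open>B w J\<close>.  Write \<open>s = s\<^sub>k\<close> and \<open>n(x)\<close> for the elements of the root
  subgroup of \<open>s\<close>.  For small \<open>x\<close> the element \<open>s n(x) w\<close> lies in
  \<open>s w J\<close>; otherwise the identity of two-by-two matrices
  \<open>[[0, 1], [1, x]] = [[-1/x, 1], [0, x]] [[1, 0], [1/x, 1]]\<close> puts it into \<open>B w J\<close>.  The
  integral defining \<open>A\<^sub>s f(w)\<close> is therefore a volume times \<open>f(s w)\<close> plus a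
  geometric series in \<open>z\<^sub>k / z\<^sub>k\<^sub>+\<^sub>1\<close> times \<open>f(w)\<close>.  Whether the boundary
  \<open>val x = 0\<close> counts as small depends on the order of \<open>w\<inverse>(k)\<close> and
  \<open>w\<inverse>(k + 1)\<close>, and this produces the two cases \<open>i > j\<close> and
  \<open>i < j\<close> of the colored R-matrix.  On tensors with pairwise distinct indices the
  diagonal terms of \<open>R\<^sub>q\<close> vanish and the others become those of the colored R-matrix
  after multiplication by \<open>-q\<close>.
\<close>

section \<open>Valuations\<close>

context nonarch_local_field begin

lemma val_one [simp]: "val 1 = 0"
  using val_mult[of 1 1] by simp

lemma val_uminus [simp]: "val (- x) = val x"
proof (cases "x = 0")
  case False
  have "val (-1) = 0" using val_mult[of "-1" "-1"] by simp
  then show ?thesis using val_mult[of "-1" x] False by simp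
qed simp

lemma val_inverse: "x \<noteq> 0 \<Longrightarrow> val (inverse x) = - val x"
  using val_mult[of x "inverse x"] by simp

lemma val_divide: "x \<noteq> 0 \<Longrightarrow> y \<noteq> 0 \<Longrightarrow> val (x / y) = val x - val y"
  by (simp add: divide_inverse val_mult val_inverse)

lemma val_prod: "finite A \<Longrightarrow> (\<And>i. i \<in> A \<Longrightarrow> f i \<noteq> 0) \<Longrightarrow> val (prod f A) = (\<Sum>i\<in>A. val (f i))"
  by (induction A rule: finite_induct) (auto simp: val_mult)

lemma p_power_zero [simp]: "0 \<in> p_power val n"
  by (simp add: p_power_def)

lemma p_power_add: "x \<in> p_power val n \<Longrightarrow> y \<in> p_power val n \<Longrightarrow> x + y \<in> p_power val n"
  using val_add[of x y] by (cases "x = 0"; cases "y = 0"; cases "x + y = 0") (auto simp: p_power_def)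

lemma p_power_uminus [simp]: "- x \<in> p_power val n \<longleftrightarrow> x \<in> p_power val n"
  by (auto simp: p_power_def)

lemma p_power_diff: "x \<in> p_power val n \<Longrightarrow> y \<in> p_power val n \<Longrightarrow> x - y \<in> p_power val n"
  using p_power_add[of x n "- y"] by simp

lemma p_power_diff_commute: "x - y \<in> p_power val n \<longleftrightarrow> y - x \<in> p_power val n"
  using p_power_uminus[of "x - y" n] by simp

lemma p_power_mult: "x \<in> p_power val m \<Longrightarrow> y \<in> p_power val n \<Longrightarrow> x * y \<in> p_power val (m + n)"
  by (cases "x = 0"; cases "y = 0") (auto simp: p_power_def val_mult)

lemma p_power_mult_left: "x \<in> int_ring val \<Longrightarrow> y \<in> p_power val n \<Longrightarrow> x * y \<in> p_power val n"
  using p_power_mult[of x 0 y n] by simp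

lemma p_power_mult_right: "x \<in> p_power val n \<Longrightarrow> y \<in> int_ring val \<Longrightarrow> x * y \<in> p_power val n"
  using p_power_mult[of x n y 0] by simp

lemma p_power_mult_iff: "a \<noteq> 0 \<Longrightarrow> a * x \<in> p_power val n \<longleftrightarrow> x \<in> p_power val (n - val a)"
  by (cases "x = 0") (auto simp: p_power_def val_mult)

lemma p_power_mono: "m \<le> n \<Longrightarrow> p_power val n \<subseteq> p_power val m"
  by (auto simp: p_power_def)

lemma p_power_sum: "(\<And>i. i \<in> A \<Longrightarrow> f i \<in> p_power val n) \<Longrightarrow> sum f A \<in> p_power val n"
  by (induction A rule: infinite_finite_induct) (auto intro: p_power_add)

lemma int_ring_one [simp]: "1 \<in> p_power val n \<longleftrightarrow> n \<le> 0"
  by (simp add: p_power_def)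

lemma int_ring_prod: "(\<And>i. i \<in> A \<Longrightarrow> f i \<in> int_ring val) \<Longrightarrow> prod f A \<in> int_ring val"
  by (induction A rule: infinite_finite_induct) (auto intro: p_power_mult_left)

lemma prod_mem_p_power:
  assumes "finite A" "a \<in> A" "f a \<in> p_power val n" "\<And>i. i \<in> A \<Longrightarrow> f i \<in> int_ring val"
  shows "prod f A \<in> p_power val n"
proof -
  have "prod f A = f a * prod f (A - {a})" using assms by (simp add: prod.remove)
  then show ?thesis using assms by (auto intro!: p_power_mult_right int_ring_prod)
qed

lemma uniformizer_power: obtains t where "t \<noteq> 0" "val t = n"
proof -
  obtain u where u: "u \<noteq> 0" "val u = 1" using uniformizer by blast
  have pow: "u ^ m \<noteq> 0 \<and> val (u ^ m) = int m" for m
    by (induction m) (auto simp: u val_mult)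
  show thesis
  proof (cases "n \<ge> 0")
    case True
    then show ?thesis using pow[of "nat n"] that[of "u ^ nat n"] by simp
  next
    case False
    then show ?thesis using pow[of "nat (-n)"] that[of "inverse (u ^ nat (-n))"] by (simp add: val_inverse)
  qed
qed

lemma val_unit_cong:
  assumes "x \<noteq> 0" "val x = 0" "y - x \<in> p_power val 1"
  shows "y \<noteq> 0 \<and> val y = 0"
proof -
  have "y \<noteq> 0" using assms by (auto simp: p_power_def)
  moreover have "val y \<ge> 0"
    using p_power_add[of x 0 "y - x"] assms \<open>y \<noteq> 0\<close> by (auto simp: p_power_def)
  moreover have "val y \<le> 0"
  proof (rule ccontr)
    assume "\<not> val y \<le> 0"
    then have "y \<in> p_power val 1" by (simp add: p_power_def)
    from p_power_diff[OF this assms(3)] have "x \<in> p_power val 1" by simp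
    then show False using assms by (auto simp: p_power_def)
  qed
  ultimately show ?thesis by simp
qed

abbreviation residue_rel :: "('a \<times> 'a) set" where
  "residue_rel \<equiv> {(x, y). x \<in> int_ring val \<and> y \<in> int_ring val \<and> x - y \<in> p_power val 1}"

lemma equiv_residue_rel: "equiv (int_ring val) residue_rel"
proof (rule equivI)
  show "residue_rel \<subseteq> int_ring val \<times> int_ring val" by auto
  show "refl_on (int_ring val) residue_rel" by (auto simp: refl_on_def)
  show "sym residue_rel" by (auto simp: sym_def p_power_diff_commute)
  show "trans residue_rel"
  proof (rule transI, clarify)
    fix x y z assume "x - y \<in> p_power val 1" "y - z \<in> p_power val 1"
    from p_power_add[OF this] show "x - z \<in> p_power val 1" by simp
  qed
qed

lemma card_residue_classes: "card (residue_classes val) > 1"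
proof -
  let ?c = "\<lambda>x. residue_rel `` {x}"
  have "{?c 0, ?c 1} \<subseteq> residue_classes val"
    unfolding residue_classes_def
    using quotientI[of 0 "int_ring val" residue_rel] quotientI[of 1 "int_ring val" residue_rel]
    by simp
  moreover have "?c 0 \<noteq> ?c 1"
    using eq_equiv_class_iff[OF equiv_residue_rel, of 0 1] by simp
  ultimately have "card {?c 0, ?c 1} \<le> card (residue_classes val)" "card {?c 0, ?c 1} = 2"
    using card_mono[OF finite_residue_field] by (blast, simp only: card_2_iff) blast
  then show ?thesis by simp
qed

lemma v_par_pos: "0 < v_par val" and v_par_less_1: "v_par val < 1"
  using card_residue_classes by (auto simp: v_par_def)

end

section \<open>Matrix groups and the Weyl group\<close>

lemma index_mult_mat_sum:
  "A \<in> carrier_mat n m \<Longrightarrow> B \<in> carrier_mat m l \<Longrightarrow> i < n \<Longrightarrow> j < l \<Longrightarrow>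
    (A * B) $$ (i, j) = (\<Sum>k<m. A $$ (i, k) * B $$ (k, j))"
  by (auto simp: times_mat_def scalar_prod_def atLeast0LessThan intro!: sum.cong)

declare index_mult_mat(1) [simp del]

lemma GL_carrier: "g \<in> GL r \<Longrightarrow> g \<in> carrier_mat r r"
  by (simp add: GL_def)

lemma GL_mult: "g \<in> GL r \<Longrightarrow> h \<in> GL r \<Longrightarrow> g * h \<in> GL r"
  by (auto simp: GL_def det_mult)

definition minv :: "'a::field mat \<Rightarrow> 'a mat" where
  "minv g = inverse (Determinant.det g) \<cdot>\<^sub>m adj_mat g"

lemma minv_carrier: "g \<in> carrier_mat r r \<Longrightarrow> minv g \<in> carrier_mat r r"
  using adj_mat(1)[of g r] by (simp add: minv_def)

lemma
  assumes "g \<in> GL r"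
  shows minv_right: "g * minv g = 1\<^sub>m r" and minv_left: "minv g * g = 1\<^sub>m r"
    and minv_GL: "minv g \<in> GL r"
proof -
  have c: "g \<in> carrier_mat r r" and d: "Determinant.det g \<noteq> 0" using assms by (auto simp: GL_def)
  have m: "minv g \<in> carrier_mat r r" using c by (rule minv_carrier)
  show 1: "g * minv g = 1\<^sub>m r" "minv g * g = 1\<^sub>m r"
    using adj_mat[OF c] c d by (auto simp: minv_def mult_smult_distrib mult_smult_assoc_mat[of _ r r _ r])
  have "Determinant.det g * Determinant.det (minv g) = 1"
    using det_mult[OF c m] 1 by simp
  then show "minv g \<in> GL r" using m by (auto simp: GL_def)
qed

lemmas square_mat_simps = mult_carrier_mat[of _ r r _ r] assoc_mult_mat[of _ r r _ r _ r] for r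

lemma minv_mult_cancel:
  assumes "g \<in> GL r" "h \<in> carrier_mat r r"
  shows "minv g * (g * h) = h" "g * (minv g * h) = h"
  using assms minv_left[OF assms(1)] minv_right[OF assms(1)] GL_carrier[OF assms(1)]
    GL_carrier[OF minv_GL[OF assms(1)]]
  by (simp_all add: assoc_mult_mat[of _ r r _ r _ r, symmetric])

lemma mult_minv_cancel:
  assumes "g \<in> GL r" "h \<in> carrier_mat r r"
  shows "(h * g) * minv g = h" "(h * minv g) * g = h"
  using assms minv_left[OF assms(1)] minv_right[OF assms(1)] GL_carrier[OF assms(1)]
    GL_carrier[OF minv_GL[OF assms(1)]]
  by (simp_all add: assoc_mult_mat[of _ r r _ r _ r])

lemma GL_carrierI: "g \<in> carrier_mat r r \<Longrightarrow> h \<in> carrier_mat r r \<Longrightarrow> g * h = 1\<^sub>m r \<Longrightarrow> g \<in> GL r"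
  using det_mult[of g r h] by (auto simp: GL_def)

lemma borel_GL: "b \<in> borel_B r \<Longrightarrow> b \<in> GL r"
  by (simp add: borel_B_def)

lemma borel_carrier: "b \<in> borel_B r \<Longrightarrow> b \<in> carrier_mat r r"
  by (simp add: borel_B_def GL_def)

lemma borel_lower: "b \<in> borel_B r \<Longrightarrow> j < i \<Longrightarrow> i < r \<Longrightarrow> b $$ (i, j) = 0"
  by (simp add: borel_B_def)

lemma det_upper:
  assumes "b \<in> carrier_mat r r" "\<And>i j. j < i \<Longrightarrow> i < r \<Longrightarrow> b $$ (i, j) = 0"
  shows "Determinant.det b = (\<Prod>i<r. b $$ (i, i))"
proof -
  have "upper_triangular b" using assms by auto
  from det_upper_triangular[OF this assms(1)] show ?thesis
    using assms(1) by (simp add: prod_list_diag_prod atLeast0LessThan)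
qed

lemma borel_det: "b \<in> borel_B r \<Longrightarrow> Determinant.det b = (\<Prod>i<r. b $$ (i, i))"
  by (rule det_upper) (auto simp: borel_carrier borel_lower)

lemma borel_diag: "b \<in> borel_B r \<Longrightarrow> i < r \<Longrightarrow> b $$ (i, i) \<noteq> 0"
  using borel_det[of b r] by (auto simp: borel_B_def GL_def)

lemma borelI:
  assumes "b \<in> carrier_mat r r" "\<And>i j. j < i \<Longrightarrow> i < r \<Longrightarrow> b $$ (i, j) = 0"
    "\<And>i. i < r \<Longrightarrow> b $$ (i, i) \<noteq> 0"
  shows "b \<in> borel_B r"
  using assms det_upper[OF assms(1,2)] by (auto simp: borel_B_def GL_def)

lemma borel_mult_diag:
  assumes "b \<in> borel_B r" "c \<in> borel_B r" "i < r"
  shows "(b * c) $$ (i, i) = b $$ (i, i) * c $$ (i, i)"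
proof -
  have "(b * c) $$ (i, i) = (\<Sum>l<r. b $$ (i, l) * c $$ (l, i))"
    using assms by (intro index_mult_mat_sum[of _ r r _ r]) (auto simp: borel_carrier)
  also have "\<dots> = (\<Sum>l<r. if l = i then b $$ (i, i) * c $$ (i, i) else 0)"
    using assms by (intro sum.cong) (auto simp: borel_lower neq_iff)
  finally show ?thesis using assms by simp
qed

lemma borel_mult:
  assumes "b \<in> borel_B r" "c \<in> borel_B r"
  shows "b * c \<in> borel_B r"
proof -
  have "(b * c) $$ (i, j) = 0" if "j < i" "i < r" for i j
  proof -
    have "(b * c) $$ (i, j) = (\<Sum>l<r. b $$ (i, l) * c $$ (l, j))"
      using assms that by (intro index_mult_mat_sum[of _ r r _ r]) (auto simp: borel_carrier)
    also have "\<dots> = 0"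
    proof (intro sum.neutral ballI)
      fix l assume "l \<in> {..<r}"
      then show "b $$ (i, l) * c $$ (l, j) = 0"
        using assms that by (cases "l < i") (auto simp: borel_lower)
    qed
    finally show ?thesis .
  qed
  then show ?thesis using assms by (auto simp: borel_B_def GL_mult)
qed

lemma borel_minv:
  assumes "b \<in> borel_B r"
  shows "minv b \<in> borel_B r"
proof -
  let ?c = "minv b"
  have b: "b \<in> GL r" using assms by (rule borel_GL)
  have c: "?c \<in> carrier_mat r r" using b by (simp add: minv_carrier GL_carrier)
  have "?c $$ (i, j) = 0" if "j < i" "i < r" for i j
    using that
  proof (induction "r - i" arbitrary: i rule: less_induct)
    case less
    have "0 = (b * ?c) $$ (i, j)" using less.prems minv_right[OF b] by simp
    also have "\<dots> = (\<Sum>l<r. b $$ (i, l) * ?c $$ (l, j))"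
      using b c less.prems by (intro index_mult_mat_sum[of _ r r _ r]) (auto simp: GL_carrier)
    also have "\<dots> = (\<Sum>l<r. if l = i then b $$ (i, i) * ?c $$ (i, j) else 0)"
    proof (intro sum.cong refl)
      fix l assume "l \<in> {..<r}"
      then show "b $$ (i, l) * ?c $$ (l, j) = (if l = i then b $$ (i, i) * ?c $$ (i, j) else 0)"
        using less.hyps[of l] less.prems borel_lower[OF assms, of l i]
        by (cases l i rule: linorder_cases) auto
    qed
    also have "\<dots> = b $$ (i, i) * ?c $$ (i, j)" using less.prems by simp
    finally show ?case using borel_diag[OF assms] less.prems by simp
  qed
  then show ?thesis using minv_GL[OF b] by (simp add: borel_B_def)
qed

lemma perm_mat_carrier [simp]: "perm_mat r w \<in> carrier_mat r r"
  by (simp add: perm_mat_def)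

lemma perm_mat_entry: "i < r \<Longrightarrow> j < r \<Longrightarrow> perm_mat r w $$ (i, j) = (if i = w j then 1 else 0)"
  by (simp add: perm_mat_def)

lemma weyl_less: "w \<in> weyl r \<Longrightarrow> i < r \<Longrightarrow> w i < r"
  using permutes_in_image[of w "{..<r}" i] by (simp add: weyl_def)

lemma winv_weyl: "w \<in> weyl r \<Longrightarrow> winv w \<in> weyl r"
  by (simp add: weyl_def permutes_inv)

lemma winv_eq_iff: "w \<in> weyl r \<Longrightarrow> winv w i = j \<longleftrightarrow> i = w j"
  by (auto simp: weyl_def permutes_inv_eq)

lemma mult_perm_mat_entry:
  assumes "A \<in> carrier_mat r r" "w \<in> weyl r" "i < r" "j < r"
  shows "(A * perm_mat r w) $$ (i, j) = A $$ (i, w j)"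
proof -
  have "(A * perm_mat r w) $$ (i, j) = (\<Sum>l<r. A $$ (i, l) * perm_mat r w $$ (l, j))"
    using assms by (intro index_mult_mat_sum[of _ r r _ r]) auto
  also have "\<dots> = (\<Sum>l<r. if l = w j then A $$ (i, w j) else 0)"
    using assms by (intro sum.cong) (auto simp: perm_mat_entry)
  finally show ?thesis using weyl_less[OF assms(2,4)] by simp
qed

lemma perm_mat_mult_entry:
  assumes "A \<in> carrier_mat r r" "w \<in> weyl r" "i < r" "j < r"
  shows "(perm_mat r w * A) $$ (i, j) = A $$ (winv w i, j)"
proof -
  have "(perm_mat r w * A) $$ (i, j) = (\<Sum>l<r. perm_mat r w $$ (i, l) * A $$ (l, j))"
    using assms by (intro index_mult_mat_sum[of _ r r _ r]) auto
  also have "\<dots> = (\<Sum>l<r. if l = winv w i then A $$ (winv w i, j) else 0)"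
    using assms by (intro sum.cong) (auto simp: perm_mat_entry winv_eq_iff[OF assms(2), symmetric])
  finally show ?thesis using weyl_less[OF winv_weyl[OF assms(2)] assms(3)] by simp
qed

lemma perm_mat_mult:
  assumes "w \<in> weyl r" "w' \<in> weyl r"
  shows "perm_mat r w * perm_mat r w' = perm_mat r (w \<circ> w')"
proof (rule eq_matI)
  fix i j assume "i < dim_row (perm_mat r (w \<circ> w'))" "j < dim_col (perm_mat r (w \<circ> w'))"
  then have "i < r" "j < r" by (auto simp: perm_mat_def)
  then show "(perm_mat r w * perm_mat r w') $$ (i, j) = perm_mat r (w \<circ> w') $$ (i, j)"
    using assms by (simp add: mult_perm_mat_entry perm_mat_entry weyl_less)
qed (auto simp: perm_mat_def)

lemma perm_mat_id: "perm_mat r id = 1\<^sub>m r"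
  by (rule eq_matI) (auto simp: perm_mat_def)

lemma weyl_comp: "w \<in> weyl r \<Longrightarrow> w' \<in> weyl r \<Longrightarrow> w \<circ> w' \<in> weyl r"
  by (simp add: weyl_def permutes_compose)

lemma perm_mat_winv: 
  assumes "w \<in> weyl r"
  shows "perm_mat r w * perm_mat r (winv w) = 1\<^sub>m r" "perm_mat r (winv w) * perm_mat r w = 1\<^sub>m r"
  using assms winv_weyl[OF assms] permutes_inv_o[of w "{..<r}"]
  by (simp_all add: perm_mat_mult perm_mat_id weyl_def)

lemma perm_mat_GL: "w \<in> weyl r \<Longrightarrow> perm_mat r w \<in> GL r"
  by (rule GL_carrierI[OF _ _ perm_mat_winv(1)]) auto

lemma finite_weyl: "finite (weyl r)"
  by (simp add: weyl_def finite_permutations)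

lemma simple_refl_weyl: "Suc k < r \<Longrightarrow> simple_refl k \<in> weyl r"
  unfolding weyl_def simple_refl_def by (auto intro: permutes_swap_id)

lemma winv_simple_refl [simp]: "winv (simple_refl k) = simple_refl k"
  by (simp add: simple_refl_def)

lemma simple_refl_invol [simp]: "simple_refl k (simple_refl k i) = i"
  by (simp add: simple_refl_def)

lemma simple_refl_comp_invol: "simple_refl k \<circ> (simple_refl k \<circ> w) = w"
  by (simp add: fun_eq_iff)

lemma winv_refl_comp: "w \<in> weyl r \<Longrightarrow> Suc k < r \<Longrightarrow> winv (simple_refl k \<circ> w) = winv w \<circ> simple_refl k"
  using permutes_bij[of w] permutes_bij[of "simple_refl k"] simple_refl_weyl[of k r]
  by (auto simp: o_inv_distrib weyl_def)

lemma simple_refl_simps: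
  "simple_refl k k = Suc k" "simple_refl k (Suc k) = k"
  "i \<noteq> k \<Longrightarrow> i \<noteq> Suc k \<Longrightarrow> simple_refl k i = i"
  by (auto simp: simple_refl_def)

lemma simple_refl_less: "Suc k < r \<Longrightarrow> i < r \<Longrightarrow> simple_refl k i < r"
  using weyl_less[OF simple_refl_weyl] .

section \<open>Integral matrices and the Iwahori subgroup\<close>

context nonarch_local_field begin

lemma integral_det:
  assumes "g \<in> integral_mats val r"
  shows "Determinant.det g \<in> int_ring val"
proof -
  have c: "g \<in> carrier_mat r r" using assms by (simp add: integral_mats_def)
  have "signof p * (\<Prod>i = 0..<r. g $$ (i, p i)) \<in> int_ring val" if "p permutes {0..<r}" for p
  proof (rule p_power_mult_left)
    show "signof p \<in> int_ring val" by (simp add: sign_def)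
    show "(\<Prod>i = 0..<r. g $$ (i, p i)) \<in> int_ring val"
      using assms permutes_in_image[OF that] by (auto intro!: int_ring_prod simp: integral_mats_def)
  qed
  then show ?thesis unfolding det_def'[OF c] by (intro p_power_sum) auto
qed

lemma integral_mult:
  assumes "g \<in> integral_mats val r" "h \<in> integral_mats val r"
  shows "g * h \<in> integral_mats val r"
proof -
  have "(g * h) $$ (i, j) \<in> int_ring val" if "i < r" "j < r" for i j
  proof -
    have "(g * h) $$ (i, j) = (\<Sum>l<r. g $$ (i, l) * h $$ (l, j))"
      using assms that by (intro index_mult_mat_sum[of _ r r _ r]) (auto simp: integral_mats_def)
    also have "\<dots> \<in> int_ring val"
      using assms that by (intro p_power_sum p_power_mult_left) (auto simp: integral_mats_def)
    finally show ?thesis .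
  qed
  then show ?thesis using assms by (auto simp: integral_mats_def)
qed

lemma GL_int_mult: "g \<in> GL_int val r \<Longrightarrow> h \<in> GL_int val r \<Longrightarrow> g * h \<in> GL_int val r"
  by (auto simp: GL_int_def GL_mult integral_mult det_mult[OF GL_carrier GL_carrier] val_mult)
     (auto simp: GL_def val_mult)

lemma GL_int_minv:
  assumes "g \<in> GL_int val r"
  shows "minv g \<in> GL_int val r"
proof -
  have g: "g \<in> GL r" "g \<in> integral_mats val r" "val (Determinant.det g) = 0"
    using assms by (auto simp: GL_int_def)
  have c: "g \<in> carrier_mat r r" and d: "Determinant.det g \<noteq> 0" using g by (auto simp: GL_def)
  have cof: "cofactor g j i \<in> int_ring val" if "i < r" "j < r" for i j
  proof -
    have "mat_delete g j i \<in> integral_mats val (r - 1)"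
      using g(2) that by (auto simp: mat_delete_def integral_mats_def)
    moreover have "(-1) ^ (j + i) \<in> int_ring val"
      by (cases "even (j + i)") auto
    ultimately show ?thesis
      unfolding cofactor_def by (intro p_power_mult_left integral_det)
  qed
  have inv: "inverse (Determinant.det g) \<in> int_ring val" using d g(3) by (simp add: p_power_def val_inverse)
  have "minv g $$ (i, j) \<in> int_ring val" if "i < r" "j < r" for i j
    using that c cof inv by (simp add: minv_def adj_mat_def p_power_mult_left)
  then have "minv g \<in> integral_mats val r"
    using minv_carrier[OF c] by (simp add: integral_mats_def)
  moreover have "val (Determinant.det (minv g)) = 0"
  proof -
    have "Determinant.det g * Determinant.det (minv g) = 1"
      using det_mult[OF c minv_carrier[OF c]] minv_right[OF g(1)] by simp
    then show ?thesis using val_mult[OF d, of "Determinant.det (minv g)"] g(3) by force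
  qed
  ultimately show ?thesis using minv_GL[OF g(1)] by (simp add: GL_int_def)
qed

lemma det_diag_cong:
  assumes "g \<in> integral_mats val r" "\<And>i j. i < j \<Longrightarrow> j < r \<Longrightarrow> g $$ (i, j) \<in> p_power val 1"
  shows "Determinant.det g - (\<Prod>i<r. g $$ (i, i)) \<in> p_power val 1"
proof -
  have c: "g \<in> carrier_mat r r" using assms by (simp add: integral_mats_def)
  let ?P = "{p. p permutes {0..<r}}" and ?t = "\<lambda>p. signof p * (\<Prod>i = 0..<r. g $$ (i, p i))"
  have "?t p \<in> p_power val 1" if p: "p permutes {0..<r}" "p \<noteq> id" for p
  proof (rule p_power_mult_left)
    show "signof p \<in> int_ring val" by (simp add: sign_def)
    have "\<exists>i\<in>{0..<r}. i < p i"
    proof (rule ccontr)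
      assume "\<not> ?thesis"
      then have "p = id" using permutes_natset_le[OF p(1)] by (auto simp: not_less)
      then show False using p by simp
    qed
    then obtain i where i: "i \<in> {0..<r}" "i < p i" by blast
    then show "(\<Prod>i = 0..<r. g $$ (i, p i)) \<in> p_power val 1"
      using assms permutes_in_image[OF p(1)]
      by (intro prod_mem_p_power[OF _ i(1)]) (auto simp: integral_mats_def)
  qed
  then have "(\<Sum>p\<in>?P - {id}. ?t p) \<in> p_power val 1" by (intro p_power_sum) auto
  moreover have "Determinant.det g = ?t id + (\<Sum>p\<in>?P - {id}. ?t p)"
    unfolding det_def'[OF c] by (rule sum.remove) (auto simp: finite_permutations permutes_id)
  ultimately show ?thesis by (simp add: atLeast0LessThan)
qed

lemma iwahori_J_iff:
  "g \<in> iwahori_J val r \<longleftrightarrow> g \<in> integral_mats val r \<and>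
     (\<forall>j<r. \<forall>i<j. g $$ (i, j) \<in> p_power val 1) \<and> (\<forall>i<r. g $$ (i, i) \<noteq> 0 \<and> val (g $$ (i, i)) = 0)"
  (is "_ \<longleftrightarrow> ?R")
proof
  assume g: "g \<in> iwahori_J val r"
  then have i: "g \<in> integral_mats val r" and u: "\<forall>j<r. \<forall>i<j. g $$ (i, j) \<in> p_power val 1"
    and d: "Determinant.det g \<noteq> 0" "val (Determinant.det g) = 0"
    by (auto simp: iwahori_J_def GL_int_def GL_def)
  have "(\<Prod>i<r. g $$ (i, i)) - Determinant.det g \<in> p_power val 1"
    using det_diag_cong[OF i] u by (simp add: p_power_diff_commute)
  from val_unit_cong[OF d this] have p: "(\<Prod>i<r. g $$ (i, i)) \<noteq> 0" "val (\<Prod>i<r. g $$ (i, i)) = 0"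
    by auto
  then have nz: "\<forall>i<r. g $$ (i, i) \<noteq> 0" by auto
  have "(\<Sum>i<r. val (g $$ (i, i))) = 0" using p nz by (subst val_prod[symmetric]) auto
  moreover have "\<forall>i\<in>{..<r}. val (g $$ (i, i)) \<ge> 0"
    using i nz by (auto simp: integral_mats_def p_power_def)
  ultimately have "\<forall>i\<in>{..<r}. val (g $$ (i, i)) = 0" by (subst sum_nonneg_eq_0_iff[symmetric]) auto
  then show ?R using i u nz by auto
next
  assume R: ?R
  then have "Determinant.det g - (\<Prod>i<r. g $$ (i, i)) \<in> p_power val 1"
    by (intro det_diag_cong) auto
  moreover have "val (\<Prod>i<r. g $$ (i, i)) = 0" using R by (subst val_prod) auto
  ultimately have "Determinant.det g \<noteq> 0" "val (Determinant.det g) = 0"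
    using val_unit_cong[of "\<Prod>i<r. g $$ (i, i)" "Determinant.det g"] R by auto
  then show "g \<in> iwahori_J val r"
    using R by (auto simp: iwahori_J_def GL_int_def GL_def integral_mats_def)
qed

lemma J_GL_int: "j \<in> iwahori_J val r \<Longrightarrow> j \<in> GL_int val r"
  by (simp add: iwahori_J_def)

lemma GL_int_GL: "j \<in> GL_int val r \<Longrightarrow> j \<in> GL r"
  by (simp add: GL_int_def)

lemma J_GL: "j \<in> iwahori_J val r \<Longrightarrow> j \<in> GL r"
  by (simp add: J_GL_int GL_int_GL)

lemma J_carrier: "j \<in> iwahori_J val r \<Longrightarrow> j \<in> carrier_mat r r"
  by (simp add: J_GL GL_carrier)

lemma J_entry: "g \<in> iwahori_J val r \<Longrightarrow> i < r \<Longrightarrow> j < r \<Longrightarrow> g $$ (i, j) \<in> int_ring val"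
  by (simp add: iwahori_J_iff integral_mats_def)

lemma J_upper: "g \<in> iwahori_J val r \<Longrightarrow> i < j \<Longrightarrow> j < r \<Longrightarrow> g $$ (i, j) \<in> p_power val 1"
  by (simp add: iwahori_J_iff)

lemma J_one: "1\<^sub>m r \<in> iwahori_J val r"
  by (auto simp: iwahori_J_iff integral_mats_def)

lemma J_mult:
  assumes "g \<in> iwahori_J val r" "h \<in> iwahori_J val r"
  shows "g * h \<in> iwahori_J val r"
proof -
  have "(g * h) $$ (i, j) \<in> p_power val 1" if ij: "i < j" "j < r" for i j
  proof -
    have "(g * h) $$ (i, j) = (\<Sum>l<r. g $$ (i, l) * h $$ (l, j))"
      using assms ij by (intro index_mult_mat_sum[of _ r r _ r]) (auto simp: J_carrier)
    also have "\<dots> \<in> p_power val 1"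
    proof (rule p_power_sum)
      fix l assume "l \<in> {..<r}"
      then show "g $$ (i, l) * h $$ (l, j) \<in> p_power val 1"
        using assms ij p_power_mult_left[of "g $$ (i, l)" "h $$ (l, j)" 1]
          p_power_mult_right[of "g $$ (i, l)" 1 "h $$ (l, j)"] J_entry J_upper
        by (cases "l < j") auto
    qed
    finally show ?thesis .
  qed
  then show ?thesis using assms by (auto simp: iwahori_J_def intro: GL_int_mult)
qed

lemma J_minv:
  assumes "g \<in> iwahori_J val r"
  shows "minv g \<in> iwahori_J val r"
proof -
  let ?h = "minv g"
  have h: "?h \<in> GL_int val r" using assms by (simp add: GL_int_minv J_GL_int)
  have hc: "?h \<in> carrier_mat r r" and hi: "\<And>i j. i < r \<Longrightarrow> j < r \<Longrightarrow> ?h $$ (i, j) \<in> int_ring val"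
    using h by (auto simp: GL_int_def integral_mats_def)
  have "?h $$ (i, j) \<in> p_power val 1" if "i < j" "j < r" for i j
    using that
  proof (induction i rule: less_induct)
    case (less i)
    have "0 = (g * ?h) $$ (i, j)" using less.prems minv_right[OF J_GL[OF assms]] by simp
    also have "\<dots> = (\<Sum>l<r. g $$ (i, l) * ?h $$ (l, j))"
      using hc assms less.prems by (intro index_mult_mat_sum[of _ r r _ r]) (auto simp: J_carrier)
    also have "\<dots> = g $$ (i, i) * ?h $$ (i, j) + (\<Sum>l\<in>{..<r} - {i}. g $$ (i, l) * ?h $$ (l, j))"
      using less.prems by (intro sum.remove) auto
    finally have "g $$ (i, i) * ?h $$ (i, j) = - (\<Sum>l\<in>{..<r} - {i}. g $$ (i, l) * ?h $$ (l, j))"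
      by (simp add: eq_neg_iff_add_eq_0)
    also have "\<dots> \<in> p_power val 1"
      unfolding p_power_uminus
    proof (rule p_power_sum)
      fix l assume "l \<in> {..<r} - {i}"
      then consider "l < i" | "l > i" "l < r" by fastforce
      then show "g $$ (i, l) * ?h $$ (l, j) \<in> p_power val 1"
      proof cases
        case 1
        then show ?thesis using less J_entry[OF assms] by (intro p_power_mult_left) auto
      next
        case 2
        then show ?thesis using less.prems J_upper[OF assms] hi by (intro p_power_mult_right) auto
      qed
    qed
    finally show ?case
      using less.prems assms by (subst (asm) p_power_mult_iff) (auto simp: iwahori_J_iff)
  qed
  then show ?thesis using h by (auto simp: iwahori_J_def)
qed

lemma perm_mat_GL_int:
  assumes "w \<in> weyl r"
  shows "perm_mat r w \<in> GL_int val r"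
proof -
  have i: "perm_mat r u \<in> integral_mats val r" for u
    by (auto simp: integral_mats_def perm_mat_def)
  let ?d = "\<lambda>u. Determinant.det (perm_mat r u :: 'a mat)"
  have 1: "?d w * ?d (winv w) = 1"
    using perm_mat_winv(1)[OF assms, where 'a='a] det_mult[of "perm_mat r w :: 'a mat" r "perm_mat r (winv w)"] by simp
  then have nz: "?d w \<noteq> 0" "?d (winv w) \<noteq> 0" by auto
  then have "val (?d w) + val (?d (winv w)) = 0" using val_mult[OF nz] 1 by simp
  moreover have "val (?d w) \<ge> 0" "val (?d (winv w)) \<ge> 0"
    using integral_det[OF i] nz by (auto simp: p_power_def)
  ultimately show ?thesis using nz i by (simp add: GL_int_def GL_def)
qed

lemma borel_int_diag:
  assumes "b \<in> borel_B r" "b \<in> GL_int val r" "i < r"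
  shows "val (b $$ (i, i)) = 0"
proof -
  have "(\<Sum>i<r. val (b $$ (i, i))) = 0"
    using assms borel_diag[OF assms(1)] borel_det[OF assms(1)]
    by (subst val_prod[symmetric]) (auto simp: GL_int_def)
  moreover have "\<forall>i\<in>{..<r}. val (b $$ (i, i)) \<ge> 0"
    using assms borel_diag[OF assms(1)] by (auto simp: GL_int_def integral_mats_def p_power_def)
  ultimately have "\<forall>i\<in>{..<r}. val (b $$ (i, i)) = 0" by (subst sum_nonneg_eq_0_iff[symmetric]) auto
  then show ?thesis using assms by simp
qed

lemma J_addrow_lower:
  "x \<in> int_ring val \<Longrightarrow> b < a \<Longrightarrow> addrow_mat r x a b \<in> iwahori_J val r"
  by (auto simp: iwahori_J_iff integral_mats_def)

lemma J_addrow_upper: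
  "x \<in> p_power val 1 \<Longrightarrow> a < b \<Longrightarrow> addrow_mat r x a b \<in> iwahori_J val r"
  using p_power_mono[of 0 1] by (auto simp: iwahori_J_iff integral_mats_def)

end

section \<open>The decomposition of the general linear group into double cosets\<close>

context nonarch_local_field begin

lemma iwahori_reduce_row:
  fixes h :: "'a mat"
  assumes h: "h \<in> GL r" and m: "m < r"
    and s: "\<And>i. m < i \<Longrightarrow> i < r \<Longrightarrow> s i < r"
    and rows: "\<And>i c. m < i \<Longrightarrow> i < r \<Longrightarrow> c < r \<Longrightarrow> h $$ (i, c) = (if c = s i then 1 else 0)"
    and cols: "\<And>i i'. m < i \<Longrightarrow> i < r \<Longrightarrow> i' < r \<Longrightarrow> h $$ (i', s i) = (if i' = i then 1 else 0)"
  obtains b j c where "b \<in> borel_B r" "j \<in> iwahori_J val r" "c < r"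
    "\<And>l. l < r \<Longrightarrow> (b * h * j) $$ (m, l) = (if l = c then 1 else 0)"
    "\<And>i. i < r \<Longrightarrow> (b * h * j) $$ (i, c) = (if i = m then 1 else 0)"
    "\<And>i l. m < i \<Longrightarrow> i < r \<Longrightarrow> l < r \<Longrightarrow> (b * h * j) $$ (i, l) = (if l = s i then 1 else 0)"
    "\<And>i i'. m < i \<Longrightarrow> i < r \<Longrightarrow> i' < r \<Longrightarrow> (b * h * j) $$ (i', s i) = (if i' = i then 1 else 0)"
proof -
  define S where "S = {c. c < r \<and> h $$ (m, c) \<noteq> 0}"
  have hc: "h \<in> carrier_mat r r" using h by (rule GL_carrier)
  have "S \<noteq> {}"
  proof
    assume "S = {}"
    then have z: "\<And>c. c < r \<Longrightarrow> h $$ (m, c) = 0" by (auto simp: S_def)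
    have "1 = (h * minv h) $$ (m, m)" using m minv_right[OF h] by simp
    also have "\<dots> = (\<Sum>l<r. h $$ (m, l) * minv h $$ (l, m))"
      using hc m by (intro index_mult_mat_sum[of _ r r _ r]) (auto simp: minv_carrier)
    also have "\<dots> = 0" using z by simp
    finally show False by simp
  qed
  define mv where "mv = Min ((\<lambda>c. val (h $$ (m, c))) ` S)"
  define T where "T = {c \<in> S. val (h $$ (m, c)) = mv}"
  define c where "c = Max T"
  have fin: "finite S" "finite T" by (auto simp: S_def T_def)
  have "mv \<in> (\<lambda>c. val (h $$ (m, c))) ` S"
    unfolding mv_def using fin \<open>S \<noteq> {}\<close> by (intro Min_in) auto
  then have "T \<noteq> {}" by (auto simp: T_def)
  then have cT: "c \<in> T" and cmax: "\<And>c'. c' \<in> T \<Longrightarrow> c' \<le> c"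
    using fin by (auto simp: c_def)
  then have c: "c < r" "h $$ (m, c) \<noteq> 0" "val (h $$ (m, c)) = mv" by (auto simp: T_def S_def)
  define x where "x l = h $$ (m, l) / h $$ (m, c)" for l
  have mvle: "mv \<le> val (h $$ (m, l))" if "l \<in> S" for l
    using fin that by (auto simp: mv_def)
  have x0: "x l \<in> int_ring val" if "l < r" for l
    using mvle[of l] that c
    by (cases "h $$ (m, l) = 0") (auto simp: x_def p_power_def val_divide S_def)
  have x1: "x l \<in> p_power val 1" if "l < r" "l > c" for l
  proof (cases "h $$ (m, l) = 0")
    case False
    then have "l \<in> S" "l \<notin> T" using that cmax[of l] by (auto simp: S_def)
    then have "mv < val (h $$ (m, l))" using mvle[of l] by (auto simp: T_def)
    then show ?thesis using False c by (simp add: x_def p_power_def val_divide)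
  qed (simp add: x_def)
  define j where "j = Matrix.mat r r (\<lambda>(i, l). if i = c \<and> l \<noteq> c then - x l else if i = l then 1 else 0)"
  define b where "b = Matrix.mat r r (\<lambda>(i, l). if l = m then (if i < m then - h $$ (i, c) / h $$ (m, c)
      else if i = m then 1 / h $$ (m, c) else 0) else if i = l then 1 else 0)"
  have jc: "j \<in> carrier_mat r r" and bc: "b \<in> carrier_mat r r" by (auto simp: j_def b_def)
  have jJ: "j \<in> iwahori_J val r"
    using x0 x1 by (auto simp: iwahori_J_iff integral_mats_def j_def)
  have bB: "b \<in> borel_B r"
    using c m by (intro borelI) (auto simp: b_def)
  have hj: "(h * j) $$ (i, l) = (if l = c then h $$ (i, c) else h $$ (i, l) - h $$ (i, c) * x l)"
    if "i < r" "l < r" for i l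
  proof -
    have "(h * j) $$ (i, l) = (\<Sum>k<r. h $$ (i, k) * j $$ (k, l))"
      using hc jc that by (intro index_mult_mat_sum[of _ r r _ r]) auto
    also have "\<dots> = (\<Sum>k<r. (if k = l then h $$ (i, l) else 0) +
        (if k = c then (if l = c then 0 else - h $$ (i, c) * x l) else 0))"
      using that c by (intro sum.cong) (auto simp: j_def)
    also have "\<dots> = (if l = c then h $$ (i, c) else h $$ (i, l) - h $$ (i, c) * x l)"
      using that c by (simp add: sum.distrib)
    finally show ?thesis .
  qed
  have hjm: "(h * j) $$ (m, l) = (if l = c then h $$ (m, c) else 0)" if "l < r" for l
    using hj[OF m that] c by (simp add: x_def)
  have bhj: "(b * h * j) $$ (i, l) = (if i = m then 0 else (h * j) $$ (i, l)) + b $$ (i, m) * (h * j) $$ (m, l)"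
    if "i < r" "l < r" for i l
  proof -
    have "(b * h * j) $$ (i, l) = (b * (h * j)) $$ (i, l)"
      using hc jc bc by (simp add: assoc_mult_mat[of _ r r _ r _ r])
    also have "\<dots> = (\<Sum>k<r. b $$ (i, k) * (h * j) $$ (k, l))"
      using hc jc bc that by (intro index_mult_mat_sum[of _ r r _ r]) auto
    also have "\<dots> = (\<Sum>k<r. (if k = i then (if i = m then 0 else (h * j) $$ (i, l)) else 0) +
        (if k = m then b $$ (i, m) * (h * j) $$ (m, l) else 0))"
      using that m by (intro sum.cong) (auto simp: b_def)
    also have "\<dots> = (if i = m then 0 else (h * j) $$ (i, l)) + b $$ (i, m) * (h * j) $$ (m, l)"
      using that m by (simp add: sum.distrib)
    finally show ?thesis .
  qed
  have bm: "b $$ (i, m) = (if i < m then - h $$ (i, c) / h $$ (m, c) else if i = m then 1 / h $$ (m, c) else 0)"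
    if "i < r" for i using that m by (simp add: b_def)
  have cs: "s i \<noteq> c" "x (s i) = 0" if "m < i" "i < r" for i
  proof -
    have "h $$ (m, s i) = 0" using cols[OF that m] that by simp
    then show "s i \<noteq> c" "x (s i) = 0" using c by (auto simp: x_def)
  qed
  have hic: "h $$ (i, c) = 0" if "m < i" "i < r" for i
    using rows[OF that c(1)] cs[OF that] by auto
  show thesis
  proof (rule that[OF bB jJ c(1)])
    show "(b * h * j) $$ (m, l) = (if l = c then 1 else 0)" if "l < r" for l
      using that m c by (simp add: bhj hjm bm)
    show "(b * h * j) $$ (i, c) = (if i = m then 1 else 0)" if "i < r" for i
      using that m c hic[of i] by (cases i m rule: linorder_cases) (auto simp: bhj hj bm)
    show "(b * h * j) $$ (i, l) = (if l = s i then 1 else 0)" if "m < i" "i < r" "l < r" for i l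
      using that m c hic[OF that(1,2)] rows[OF that] cs[OF that(1,2)]
      by (auto simp: bhj hj bm)
    show "(b * h * j) $$ (i', s i) = (if i' = i then 1 else 0)" if "m < i" "i < r" "i' < r" for i i'
      using that m cs[OF that(1,2)] s[OF that(1,2)] cols[OF that]
      by (simp add: bhj hj hjm) (use cols[OF that(1,2) m] in auto)
  qed
qed

lemma iwahori_reduce_rows:
  fixes g :: "'a mat"
  assumes "g \<in> GL r" "d \<le> r"
  shows "\<exists>b\<in>borel_B r. \<exists>j\<in>iwahori_J val r. \<exists>s. \<forall>i. r - d \<le> i \<and> i < r \<longrightarrow> s i < r \<and>
    (\<forall>c<r. (b * g * j) $$ (i, c) = (if c = s i then 1 else 0)) \<and>
    (\<forall>i'<r. (b * g * j) $$ (i', s i) = (if i' = i then 1 else 0))"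
  using assms(2)
proof (induction d)
  case 0
  have "1\<^sub>m r \<in> borel_B r" by (intro borelI) auto
  then show ?case by (intro bexI[of _ "1\<^sub>m r"] exI allI impI) (auto simp: J_one)
next
  case (Suc d)
  obtain b j s where bj: "b \<in> borel_B r" "j \<in> iwahori_J val r"
    and st': "\<forall>i. r - d \<le> i \<and> i < r \<longrightarrow> s i < r \<and>
      (\<forall>c<r. (b * g * j) $$ (i, c) = (if c = s i then 1 else 0)) \<and>
      (\<forall>i'<r. (b * g * j) $$ (i', s i) = (if i' = i then 1 else 0))"
    using Suc.IH[OF Suc_leD[OF Suc.prems]] by (elim bexE exE)
  let ?m = "r - Suc d"
  have m: "?m < r" and m_less: "\<And>i. ?m < i \<Longrightarrow> r - d \<le> i" using Suc.prems by auto
  have st: "\<And>i. ?m < i \<Longrightarrow> i < r \<Longrightarrow> s i < r"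
      "\<And>i c. ?m < i \<Longrightarrow> i < r \<Longrightarrow> c < r \<Longrightarrow> (b * g * j) $$ (i, c) = (if c = s i then 1 else 0)"
      "\<And>i i'. ?m < i \<Longrightarrow> i < r \<Longrightarrow> i' < r \<Longrightarrow> (b * g * j) $$ (i', s i) = (if i' = i then 1 else 0)"
    using st' m_less by blast+
  have h: "b * g * j \<in> GL r" using bj assms by (auto intro!: GL_mult simp: borel_GL J_GL)
  obtain b' j' c where n: "b' \<in> borel_B r" "j' \<in> iwahori_J val r" "c < r"
    "\<And>l. l < r \<Longrightarrow> (b' * (b * g * j) * j') $$ (?m, l) = (if l = c then 1 else 0)"
    "\<And>i. i < r \<Longrightarrow> (b' * (b * g * j) * j') $$ (i, c) = (if i = ?m then 1 else 0)"
    "\<And>i l. ?m < i \<Longrightarrow> i < r \<Longrightarrow> l < r \<Longrightarrow> (b' * (b * g * j) * j') $$ (i, l) = (if l = s i then 1 else 0)"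
    "\<And>i i'. ?m < i \<Longrightarrow> i < r \<Longrightarrow> i' < r \<Longrightarrow> (b' * (b * g * j) * j') $$ (i', s i) = (if i' = i then 1 else 0)"
    by (rule iwahori_reduce_row[OF h m st]) blast+
  have eq: "b' * (b * g * j) * j' = (b' * b) * g * (j * j')"
    using n(1,2) bj assms
    by (simp add: square_mat_simps[where r=r] borel_carrier J_carrier GL_carrier)
  show ?case
  proof (intro bexI exI allI impI conjI)
    fix i i' assume i: "?m \<le> i \<and> i < r"
    show "(if i = ?m then c else s i) < r" using i n(3) st(1)[of i] by auto
    show "((b' * b) * g * (j * j')) $$ (i, i') = (if i' = (if i = ?m then c else s i) then 1 else 0)" if "i' < r"
      unfolding eq[symmetric] using i n(4)[OF that] n(6)[of i, OF _ _ that] by auto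
    show "((b' * b) * g * (j * j')) $$ (i', (if i = ?m then c else s i)) = (if i' = i then 1 else 0)" if "i' < r"
      unfolding eq[symmetric] using i n(5)[OF that] n(7)[of i, OF _ _ that] by auto
  qed (use n(1,2) bj in \<open>auto simp: borel_mult J_mult\<close>)
qed

lemma iwahori_bruhat:
  fixes g :: "'a mat"
  assumes "g \<in> GL r"
  obtains b w j where "b \<in> borel_B r" "w \<in> weyl r" "j \<in> iwahori_J val r" "g = b * perm_mat r w * j"
proof -
  obtain b j s where bj: "b \<in> borel_B r" "j \<in> iwahori_J val r"
    and s': "\<forall>i. r - r \<le> i \<and> i < r \<longrightarrow> s i < r \<and>
      (\<forall>c<r. (b * g * j) $$ (i, c) = (if c = s i then 1 else 0)) \<and>
      (\<forall>i'<r. (b * g * j) $$ (i', s i) = (if i' = i then 1 else 0))"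
    using iwahori_reduce_rows[OF assms order.refl] by blast
  have s: "\<And>i. i < r \<Longrightarrow> s i < r"
      "\<And>i c. i < r \<Longrightarrow> c < r \<Longrightarrow> (b * g * j) $$ (i, c) = (if c = s i then 1 else 0)"
      "\<And>i i'. i < r \<Longrightarrow> i' < r \<Longrightarrow> (b * g * j) $$ (i', s i) = (if i' = i then 1 else 0)"
    using s' unfolding diff_self_eq_0 by blast+
  define u where "u i = (if i < r then s i else i)" for i
  have inj: "inj_on s {..<r}"
  proof (rule inj_onI)
    fix i i' assume "i \<in> {..<r}" "i' \<in> {..<r}" "s i = s i'"
    then show "i = i'" using s(2)[of i' "s i"] s(3)[of i i'] s(1) by (auto split: if_splits)
  qed
  have "u ` {..<r} = {..<r}"
  proof (rule endo_inj_surj)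
    show "u ` {..<r} \<subseteq> {..<r}" using s(1) by (auto simp: u_def)
    show "inj_on u {..<r}" using inj by (auto simp: inj_on_def u_def)
  qed simp
  moreover have "inj_on u {..<r}" using inj by (auto simp: inj_on_def u_def)
  ultimately have "u permutes {..<r}"
    by (intro bij_imp_permutes) (auto simp: bij_betw_def u_def)
  then have u: "u \<in> weyl r" by (simp add: weyl_def)
  let ?w = "winv u"
  have w: "?w \<in> weyl r" using u by (rule winv_weyl)
  have c: "b \<in> GL r" "j \<in> GL r" "g \<in> GL r" using bj assms by (auto simp: borel_GL J_GL)
  have "b * g * j = perm_mat r ?w"
  proof (rule eq_matI)
    fix i l assume "i < dim_row (perm_mat r ?w :: 'a mat)" "l < dim_col (perm_mat r ?w :: 'a mat)"
    then have "i < r" "l < r" by (auto simp: perm_mat_def)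
    then show "(b * g * j) $$ (i, l) = perm_mat r ?w $$ (i, l)"
      using s(2)[of i l] winv_eq_iff[OF u, of l i] by (auto simp: perm_mat_entry u_def)
  qed (use c in \<open>auto dest!: GL_carrier simp: perm_mat_def\<close>)
  moreover have "g = minv b * (b * g * j) * minv j"
    using minv_mult_cancel(1)[OF c(1), of g] mult_minv_cancel(1)[OF c(2), of g] c
    by (simp add: square_mat_simps[where r=r] GL_carrier minv_GL GL_mult minv_mult_cancel mult_minv_cancel)
  ultimately show thesis using that[of "minv b" ?w "minv j"] bj w by (simp add: borel_minv J_minv)
qed

lemma iwahori_bruhat_unique:
  fixes b b' j j' :: "'a mat"
  assumes "b \<in> borel_B r" "b' \<in> borel_B r" "w \<in> weyl r" "w' \<in> weyl r"
    "j \<in> iwahori_J val r" "j' \<in> iwahori_J val r"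
    and eq: "b * perm_mat r w * j = b' * perm_mat r w' * j'"
  shows "w = w'" "minv b' * b \<in> GL_int val r"
proof -
  let ?c = "minv b' * b" and ?m = "j' * minv j"
  note G = assms(1,2)[THEN borel_GL] assms(5,6)[THEN J_GL]
  note C = G[THEN GL_carrier] G[THEN minv_GL, THEN GL_carrier]
  have cB: "?c \<in> borel_B r" using assms by (simp add: borel_mult borel_minv)
  have mJ: "?m \<in> iwahori_J val r" using assms by (simp add: J_mult J_minv)
  have "minv b' * (b * perm_mat r w * j) * minv j = minv b' * (b' * perm_mat r w' * j') * minv j"
    by (simp add: eq)
  then have 1: "?c * perm_mat r w = perm_mat r w' * ?m"
    using C minv_right[OF G(3)] minv_mult_cancel(1)[OF G(2)]
    by (simp add: square_mat_simps[where r=r] right_mult_one_mat[of _ r r])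
  have le: "w' l \<le> w l" if "l < r" for l
  proof (rule ccontr)
    assume "\<not> w' l \<le> w l"
    then have "?c $$ (w' l, w l) = 0" using borel_lower[OF cB] weyl_less[OF assms(4) that] by simp
    also have "?c $$ (w' l, w l) = (?c * perm_mat r w) $$ (w' l, l)"
      using borel_carrier[OF cB] assms that by (simp add: mult_perm_mat_entry weyl_less)
    also have "\<dots> = ?m $$ (l, l)"
      unfolding 1 using J_carrier[OF mJ] assms that winv_eq_iff[OF assms(4), of "w' l" l]
      by (subst perm_mat_mult_entry) (auto simp: weyl_less)
    finally show False using mJ that by (simp add: iwahori_J_iff)
  qed
  have "w' \<circ> winv w = id"
  proof (rule permutes_natset_le[of _ "{..<r}"])
    show "w' \<circ> winv w permutes {..<r}"
      using assms(3,4) by (simp add: weyl_def permutes_compose permutes_inv)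
    show "\<forall>i\<in>{..<r}. (w' \<circ> winv w) i \<le> i"
      using le weyl_less[OF winv_weyl[OF assms(3)]] assms(3)
      by (force simp: weyl_def permutes_inverses)
  qed
  then have "w' \<circ> winv w \<circ> w = w" by simp
  then show ww: "w = w'" using assms(3) by (simp add: comp_assoc weyl_def permutes_inv_o)
  have "?c = ?c * (perm_mat r w * perm_mat r (winv w))"
    using borel_carrier[OF cB] by (simp only: perm_mat_winv[OF assms(3)] right_mult_one_mat)
  also have "\<dots> = perm_mat r w * ?m * perm_mat r (winv w)"
    using 1 ww borel_carrier[OF cB] by (simp add: assoc_mult_mat[of _ r r _ r _ r, symmetric])
  also have "\<dots> \<in> GL_int val r"
    using J_GL_int[OF mJ] assms by (intro GL_int_mult[OF GL_int_mult]) (auto simp: perm_mat_GL_int winv_weyl)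
  finally show "?c \<in> GL_int val r" .
qed

end

section \<open>Iwahori-fixed vectors\<close>

lemma spec_torus_nonzero: "z \<in> spec_torus r \<Longrightarrow> i < r \<Longrightarrow> z i \<noteq> 0"
  by (auto simp: spec_torus_def PiE_def Pi_def)

lemma weyl_act_refl: "weyl_act (simple_refl k) z = (\<lambda>i. z (simple_refl k i))"
  by (simp add: weyl_act_def)

lemma weyl_act_refl_torus:
  assumes "Suc k < r" "z \<in> spec_torus r"
  shows "weyl_act (simple_refl k) z \<in> spec_torus r"
proof -
  have "simple_refl k i = i" if "i \<ge> r" for i
    using that assms by (intro simple_refl_simps) auto
  then show ?thesis
    using assms simple_refl_less[OF assms(1)]
    by (fastforce simp: spec_torus_def weyl_act_refl PiE_def extensional_def Pi_def)
qed

definition half_density_char :: "real \<Rightarrow> nat \<Rightarrow> (nat \<Rightarrow> complex) \<Rightarrow> nat \<Rightarrow> complex" where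
  "half_density_char v r z i = complex_of_real (sqrt v powi (int r - 1 - 2 * int i)) * z i"

context nonarch_local_field begin

lemma half_density_char_nonzero:
  "z \<in> spec_torus r \<Longrightarrow> i < r \<Longrightarrow> half_density_char (v_par val) r z i \<noteq> 0"
  using v_par_pos spec_torus_nonzero[of z r i] by (simp add: half_density_char_def)

lemma prod_root_abs:
  fixes D :: "nat \<Rightarrow> int"
  assumes "v \<noteq> (0::real)"
  shows "(\<Prod>j<r. \<Prod>i<j. v powi (D i - D j)) = (\<Prod>i<r. v powi ((int r - 1 - 2 * int i) * D i))"
proof (induction r)
  case (Suc r)
  have "(\<Prod>i<r. v powi ((int r - 1 - 2 * int i) * D i)) * (\<Prod>i<r. v powi (D i - D r))
      = (\<Prod>i<r. v powi ((int r - 2 * int i) * D i) * v powi (- D r))"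
    using assms by (auto simp: prod.distrib[symmetric] power_int_add[symmetric] algebra_simps intro!: prod.cong)
  also have "\<dots> = (\<Prod>i<r. v powi ((int r - 2 * int i) * D i)) * v powi (- int r * D r)"
    using power_int_power'[of v "- D r" r] by (simp add: prod.distrib mult.commute)
  finally show ?case using Suc by simp
qed simp

lemma delta_half_tau_eq:
  assumes b: "b \<in> borel_B r"
  shows "delta_half_tau val r z b = (\<Prod>i<r. half_density_char (v_par val) r z i powi val (b $$ (i, i)))"
proof -
  let ?v = "v_par val" and ?D = "\<lambda>i. val (b $$ (i, i))"
  have "modular_delta val r b = (\<Prod>j<r. \<Prod>i<j. ?v powi (?D i - ?D j))"
    unfolding modular_delta_def using borel_diag[OF b]
    by (intro prod.cong refl) (auto simp: abs_F_def val_divide)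
  also have "\<dots> = (\<Prod>i<r. ?v powi ((int r - 1 - 2 * int i) * ?D i))"
    using v_par_pos by (intro prod_root_abs) simp
  also have "\<dots> = (\<Prod>i<r. sqrt ?v powi ((int r - 1 - 2 * int i) * ?D i))\<^sup>2"
  proof -
    have "?v powi n = (sqrt ?v powi n)\<^sup>2" for n
      using v_par_pos power_int_mult_distrib[of "sqrt ?v" "sqrt ?v" n] by (simp add: power2_eq_square)
    then show ?thesis by (simp add: prod_power_distrib)
  qed
  finally have "sqrt (modular_delta val r b) = (\<Prod>i<r. sqrt ?v powi ((int r - 1 - 2 * int i) * ?D i))"
    using v_par_pos by (simp add: prod_nonneg)
  then show ?thesis
    unfolding delta_half_tau_def tau_def half_density_char_def
    by (simp add: prod.distrib[symmetric] power_int_mult_distrib power_int_mult)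
qed

lemma delta_half_tau_mult:
  assumes "z \<in> spec_torus r" "b \<in> borel_B r" "c \<in> borel_B r"
  shows "delta_half_tau val r z (b * c) = delta_half_tau val r z b * delta_half_tau val r z c"
  using assms half_density_char_nonzero[OF assms(1)] borel_diag[OF assms(2)] borel_diag[OF assms(3)]
  by (simp add: delta_half_tau_eq borel_mult borel_mult_diag val_mult power_int_add prod.distrib)

lemma delta_half_tau_int:
  "b \<in> borel_B r \<Longrightarrow> b \<in> GL_int val r \<Longrightarrow> delta_half_tau val r z b = 1"
  by (simp add: delta_half_tau_eq borel_int_diag)

lemma delta_half_tau_cong:
  assumes "z \<in> spec_torus r" "b \<in> borel_B r" "b' \<in> borel_B r" "minv b' * b \<in> GL_int val r"
  shows "delta_half_tau val r z b = delta_half_tau val r z b'"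
proof -
  have c: "minv b' * b \<in> borel_B r" using assms by (simp add: borel_mult borel_minv)
  have "b' * (minv b' * b) = b"
    using minv_mult_cancel(2)[OF borel_GL[OF assms(3)] borel_carrier[OF assms(2)]] .
  then have "delta_half_tau val r z b = delta_half_tau val r z b' * delta_half_tau val r z (minv b' * b)"
    using delta_half_tau_mult[OF assms(1,3) c] by simp
  then show ?thesis using delta_half_tau_int[OF c assms(4)] by simp
qed

lemma Phi_bruhat:
  assumes "z \<in> spec_torus r" "b \<in> borel_B r" "w \<in> weyl r" "w' \<in> weyl r" "j \<in> iwahori_J val r"
  shows "Phi val r z w (b * perm_mat r w' * j) = (if w = w' then delta_half_tau val r z b else 0)"
proof (cases "w = w'")
  case True
  have "(THE c. \<exists>b'\<in>borel_B r. \<exists>j'\<in>iwahori_J val r.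
      b * perm_mat r w' * j = b' * perm_mat r w * j' \<and> c = delta_half_tau val r z b') = delta_half_tau val r z b"
  proof (rule the_equality)
    show "\<exists>b'\<in>borel_B r. \<exists>j'\<in>iwahori_J val r.
      b * perm_mat r w' * j = b' * perm_mat r w * j' \<and> delta_half_tau val r z b = delta_half_tau val r z b'"
      using True assms by blast
  next
    fix c assume "\<exists>b'\<in>borel_B r. \<exists>j'\<in>iwahori_J val r.
      b * perm_mat r w' * j = b' * perm_mat r w * j' \<and> c = delta_half_tau val r z b'"
    then show "c = delta_half_tau val r z b"
      using iwahori_bruhat_unique(2)[OF assms(2) _ assms(4,3,5)] delta_half_tau_cong[OF assms(1,2)] by metis
  qed
  then show ?thesis using True assms by (auto simp: Phi_def)
next
  case False
  then have "\<not> (\<exists>b'\<in>borel_B r. \<exists>j'\<in>iwahori_J val r. b * perm_mat r w' * j = b' * perm_mat r w * j')"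
    using iwahori_bruhat_unique(1)[OF assms(2) _ assms(4,3,5)] by metis
  then show ?thesis using False by (simp add: Phi_def)
qed

lemma Phi_outside: "g \<notin> GL r \<Longrightarrow> w \<in> weyl r \<Longrightarrow> Phi val r z w g = 0"
  by (auto simp: Phi_def GL_mult borel_GL perm_mat_GL J_GL)

lemma iwahori_fixed_bruhat:
  assumes "f \<in> iwahori_fixed val r z" "b \<in> borel_B r" "w \<in> weyl r" "j \<in> iwahori_J val r"
  shows "f (b * perm_mat r w * j) = delta_half_tau val r z b * f (perm_mat r w)"
  using assms by (simp add: iwahori_fixed_def principal_series_def GL_mult borel_GL perm_mat_GL)

lemma iwahori_fixed_outside: "f \<in> iwahori_fixed val r z \<Longrightarrow> g \<notin> GL r \<Longrightarrow> f g = 0"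
  by (simp add: iwahori_fixed_def principal_series_def)

lemma iwahori_fixed_expansion:
  assumes "z \<in> spec_torus r" "f \<in> iwahori_fixed val r z"
  shows "f g = (\<Sum>w\<in>weyl r. f (perm_mat r w) * Phi val r z w g)"
proof (cases "g \<in> GL r")
  case True
  then obtain b w j where g: "b \<in> borel_B r" "w \<in> weyl r" "j \<in> iwahori_J val r" "g = b * perm_mat r w * j"
    by (rule iwahori_bruhat)
  have "(\<Sum>u\<in>weyl r. f (perm_mat r u) * Phi val r z u g)
      = (\<Sum>u\<in>weyl r. if u = w then f (perm_mat r w) * delta_half_tau val r z b else 0)"
    using g assms by (intro sum.cong) (auto simp: Phi_bruhat)
  then show ?thesis using g assms by (simp add: iwahori_fixed_bruhat finite_weyl)
qed (simp add: iwahori_fixed_outside[OF assms(2)] Phi_outside)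

lemma flat_section_bruhat:
  assumes y: "y \<in> spec_torus r" and f: "f \<in> iwahori_fixed val r z"
    and bwj: "b \<in> borel_B r" "w \<in> weyl r" "j \<in> iwahori_J val r"
  shows "flat_section val r f y (b * perm_mat r w * j) = delta_half_tau val r y b * f (perm_mat r w)"
proof -
  let ?h = "perm_mat r w * j" and ?g = "b * perm_mat r w * j"
  have h: "?h \<in> GL_int val r" using bwj by (simp add: GL_int_mult perm_mat_GL_int J_GL_int)
  have g: "?g = b * ?h" using bwj by (simp add: square_mat_simps[where r=r] borel_carrier J_carrier)
  have fh: "f ?h = f (perm_mat r w)" using f bwj by (simp add: iwahori_fixed_def perm_mat_GL)
  have "(THE c. \<exists>b'\<in>borel_B r. \<exists>h'\<in>GL_int val r. ?g = b' * h' \<and> c = delta_half_tau val r y b' * f h')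
      = delta_half_tau val r y b * f ?h"
  proof (rule the_equality)
    show "\<exists>b'\<in>borel_B r. \<exists>h'\<in>GL_int val r. ?g = b' * h' \<and>
        delta_half_tau val r y b * f ?h = delta_half_tau val r y b' * f h'"
      using bwj(1) h g by blast
  next
    fix c assume "\<exists>b'\<in>borel_B r. \<exists>h'\<in>GL_int val r. ?g = b' * h' \<and> c = delta_half_tau val r y b' * f h'"
    then obtain b' h' where b': "b' \<in> borel_B r" "h' \<in> GL_int val r" "b * ?h = b' * h'"
      and c: "c = delta_half_tau val r y b' * f h'" by (auto simp: g)
    let ?u = "minv b' * b"
    note C = bwj(1)[THEN borel_carrier] b'(1)[THEN borel_carrier] h[THEN GL_int_GL, THEN GL_carrier]
      b'(2)[THEN GL_int_GL, THEN GL_carrier] borel_minv[OF b'(1), THEN borel_carrier]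
      GL_int_minv[OF h, THEN GL_int_GL, THEN GL_carrier]
    have uB: "?u \<in> borel_B r" using bwj b' by (simp add: borel_mult borel_minv)
    have uh: "?u * ?h = h'"
      using C b'(3) minv_mult_cancel(1)[OF borel_GL[OF b'(1)], of h']
      by (simp add: assoc_mult_mat[of _ r r _ r ?h r])
    then have "?u = h' * minv ?h"
      using mult_minv_cancel(1)[OF GL_int_GL[OF h] borel_carrier[OF uB]] by simp
    then have uK: "?u \<in> GL_int val r" using h b' by (simp add: GL_int_mult GL_int_minv)
    have "f h' = delta_half_tau val r z ?u * f ?h"
      using f uB h unfolding uh[symmetric]
      by (simp add: iwahori_fixed_def principal_series_def GL_int_GL)
    then have "f h' = f ?h" using delta_half_tau_int[OF uB uK] by simp
    then show "c = delta_half_tau val r y b * f ?h"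
      using c delta_half_tau_cong[OF y bwj(1) b'(1) uK] by simp
  qed
  moreover have "?g \<in> GL r" using bwj by (simp add: GL_mult borel_GL perm_mat_GL J_GL)
  ultimately show ?thesis by (simp add: flat_section_def fh)
qed

lemma J_neighbourhood:
  fixes g :: "'a mat"
  assumes g: "g \<in> GL r"
  obtains n where "\<And>h. h \<in> carrier_mat r r \<Longrightarrow> mat_near val r n g h \<Longrightarrow> minv g * h \<in> iwahori_J val r"
proof -
  let ?G = "minv g"
  define n where "n = 1 - Min (insert 0 ((\<lambda>(i, l). val (?G $$ (i, l))) ` ({..<r} \<times> {..<r})))"
  have G: "?G $$ (i, l) \<in> p_power val (1 - n)" if "i < r" "l < r" for i l
    using that by (auto simp: p_power_def n_def intro!: Min_le)
  have c: "g \<in> carrier_mat r r" "?G \<in> carrier_mat r r" using g by (simp_all add: GL_carrier minv_GL)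
  show thesis
  proof (rule that)
    fix h assume h: "h \<in> carrier_mat r r" and near: "mat_near val r n g h"
    have d: "(?G * h) $$ (i, j) - (if i = j then 1 else 0) \<in> p_power val 1" if ij: "i < r" "j < r" for i j
    proof -
      have "(?G * h) $$ (i, j) - (?G * g) $$ (i, j) = (\<Sum>l<r. ?G $$ (i, l) * (h $$ (l, j) - g $$ (l, j)))"
        using c h ij by (simp add: index_mult_mat_sum[of _ r r _ r] sum_subtractf right_diff_distrib)
      also have "\<dots> \<in> p_power val (1 - n + n)"
        using G near ij by (intro p_power_sum p_power_mult) (auto simp: mat_near_def)
      finally show ?thesis using ij minv_left[OF g] by simp
    qed
    have off: "(?G * h) $$ (i, j) \<in> p_power val 1" if "i < r" "j < r" "i \<noteq> j" for i j
      using d[OF that(1,2)] that by simp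
    have diag: "(?G * h) $$ (i, i) \<noteq> 0 \<and> val ((?G * h) $$ (i, i)) = 0" if "i < r" for i
      using val_unit_cong[of 1 "(?G * h) $$ (i, i)"] d[OF that that] by simp
    have "(?G * h) $$ (i, j) \<in> int_ring val" if "i < r" "j < r" for i j
      using off[OF that] diag[OF that(1)] p_power_mono[of 0 1] by (cases "i = j") (auto simp: p_power_def)
    then show "?G * h \<in> iwahori_J val r"
      using off diag c h by (auto simp: iwahori_J_iff integral_mats_def)
  qed
qed

lemma iwahori_fixedI:
  fixes F :: "'a mat \<Rightarrow> complex"
  assumes z: "z \<in> spec_torus r" and out: "\<And>g. g \<notin> GL r \<Longrightarrow> F g = 0"
    and bwj: "\<And>b w j. b \<in> borel_B r \<Longrightarrow> w \<in> weyl r \<Longrightarrow> j \<in> iwahori_J val r \<Longrightarrow>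
      F (b * perm_mat r w * j) = delta_half_tau val r z b * F (perm_mat r w)"
  shows "F \<in> iwahori_fixed val r z"
proof -
  have J: "F (g * j) = F g" if "g \<in> GL r" "j \<in> iwahori_J val r" for g j
  proof -
    obtain b w i where g: "b \<in> borel_B r" "w \<in> weyl r" "i \<in> iwahori_J val r" "g = b * perm_mat r w * i"
      using \<open>g \<in> GL r\<close> by (rule iwahori_bruhat)
    have "g * j = b * perm_mat r w * (i * j)"
      using g that by (simp add: square_mat_simps[where r=r] borel_carrier J_carrier)
    then show ?thesis using g that by (simp add: bwj J_mult)
  qed
  have B: "F (b * g) = delta_half_tau val r z b * F g" if "b \<in> borel_B r" "g \<in> GL r" for b g
  proof -
    obtain b' w i where g: "b' \<in> borel_B r" "w \<in> weyl r" "i \<in> iwahori_J val r" "g = b' * perm_mat r w * i"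
      using \<open>g \<in> GL r\<close> by (rule iwahori_bruhat)
    have "b * g = (b * b') * perm_mat r w * i"
      using g that by (simp add: square_mat_simps[where r=r] borel_carrier J_carrier)
    then show ?thesis using g that z by (simp add: bwj borel_mult delta_half_tau_mult)
  qed
  have "\<exists>n. \<forall>h\<in>GL r. mat_near val r n g h \<longrightarrow> F h = F g" if g: "g \<in> GL r" for g
  proof -
    obtain n where n: "\<And>h. h \<in> carrier_mat r r \<Longrightarrow> mat_near val r n g h \<Longrightarrow> minv g * h \<in> iwahori_J val r"
      using J_neighbourhood[OF g] by blast
    have "F h = F g" if "h \<in> GL r" "mat_near val r n g h" for h
      using J[OF g n[OF GL_carrier[OF that(1)] that(2)]] minv_mult_cancel(2)[OF g GL_carrier[OF that(1)]] by simp
    then show ?thesis by blast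
  qed
  then show ?thesis using out B J by (simp add: iwahori_fixed_def principal_series_def)
qed

end

section \<open>The root subgroup of a simple reflection\<close>

abbreviation root_elt :: "nat \<Rightarrow> nat \<Rightarrow> 'a::field \<Rightarrow> 'a mat" where
  "root_elt r k x \<equiv> addrow_mat r x k (Suc k)"

lemma simple_refl_strict_mono:
  "i < j \<Longrightarrow> \<not> (i = k \<and> j = Suc k) \<Longrightarrow> simple_refl k i < simple_refl k j"
  by (auto simp: simple_refl_def Transposition.transpose_def)

lemma simple_refl_conj_entry:
  assumes "Suc k < r" "A \<in> carrier_mat r r" "i < r" "j < r"
  shows "(perm_mat r (simple_refl k) * A * perm_mat r (simple_refl k)) $$ (i, j)
    = A $$ (simple_refl k i, simple_refl k j)"
  using assms
  by (simp add: mult_perm_mat_entry perm_mat_mult_entry simple_refl_weyl simple_refl_less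
      mult_carrier_mat[of _ r r])

lemma root_elt_borel: "Suc k < r \<Longrightarrow> root_elt r k x \<in> borel_B r"
  by (rule borelI) auto

lemma root_elt_mult: "Suc k < r \<Longrightarrow> root_elt r k x * root_elt r k y = root_elt r k (x + y)"
  by (subst addrow_mat[symmetric, of _ r r]) (auto intro!: eq_matI)

lemma root_elt_zero: "root_elt r k 0 = 1\<^sub>m r"
  by (rule eq_matI) auto

lemma root_elt_inj: "Suc k < r \<Longrightarrow> root_elt r k x = root_elt r k y \<Longrightarrow> x = y"
  by (drule arg_cong[of _ _ "\<lambda>A. A $$ (k, Suc k)"]) simp

lemma N_simple_refl:
  assumes k: "Suc k < r"
  shows "N_w r (simple_refl k) = range (root_elt r k :: 'a::field \<Rightarrow> 'a mat)"
proof (intro equalityI subsetI)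
  fix g :: "'a mat" assume "g \<in> N_w r (simple_refl k)"
  then obtain n where g: "g \<in> unip_N r" and n: "n \<in> unip_N_minus r"
    "g = perm_mat r (simple_refl k) * n * perm_mat r (simple_refl k)"
    by (auto simp: N_w_def)
  have gc: "g \<in> carrier_mat r r" and nc: "n \<in> carrier_mat r r"
    using g n by (auto simp: unip_N_def unip_N_minus_def borel_B_def GL_def)
  have "g = root_elt r k (g $$ (k, Suc k))"
  proof (rule eq_matI)
    fix i j assume "i < dim_row (root_elt r k (g $$ (k, Suc k)))" "j < dim_col (root_elt r k (g $$ (k, Suc k)))"
    then have ij: "i < r" "j < r" by auto
    show "g $$ (i, j) = root_elt r k (g $$ (k, Suc k)) $$ (i, j)"
    proof (cases "i < j \<and> \<not> (i = k \<and> j = Suc k)")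
      case True
      then have "n $$ (simple_refl k i, simple_refl k j) = 0"
        using n(1) ij k simple_refl_strict_mono[of i j k] by (simp add: unip_N_minus_def simple_refl_less)
      then show ?thesis using True ij nc k by (auto simp: n(2) simple_refl_conj_entry)
    next
      case False
      then show ?thesis using g ij by (auto simp: unip_N_def borel_B_def not_less le_less)
    qed
  qed (use gc in auto)
  then show "g \<in> range (root_elt r k)" by blast
next
  fix g :: "'a mat" assume "g \<in> range (root_elt r k)"
  then obtain x where g: "g = root_elt r k x" by blast
  have "g = perm_mat r (simple_refl k) * addrow_mat r x (Suc k) k * perm_mat r (simple_refl k)"
  proof (rule eq_matI)
    fix i j assume "i < dim_row (perm_mat r (simple_refl k) * addrow_mat r x (Suc k) k * perm_mat r (simple_refl k))"
      "j < dim_col (perm_mat r (simple_refl k) * addrow_mat r x (Suc k) k * perm_mat r (simple_refl k))"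
    then have ij: "i < r" "j < r" by (auto simp: perm_mat_def)
    then show "g $$ (i, j) = (perm_mat r (simple_refl k) * addrow_mat r x (Suc k) k * perm_mat r (simple_refl k)) $$ (i, j)"
      using k by (subst simple_refl_conj_entry) (auto simp: g simple_refl_less simple_refl_def Transposition.transpose_def)
  qed (auto simp: g perm_mat_def)
  moreover have "addrow_mat r x (Suc k) k \<in> unip_N_minus r"
    by (auto simp: unip_N_minus_def GL_def det_addrow_mat)
  moreover have "g \<in> unip_N r" using root_elt_borel[OF k] by (auto simp: g unip_N_def)
  ultimately show "g \<in> N_w r (simple_refl k)" by (auto simp: N_w_def)
qed

lemma refl_root_elt_borel:
  fixes b :: "'a::field mat"
  assumes k: "Suc k < r" and b: "b \<in> borel_B r"
  obtains b' where "b' \<in> borel_B r" "\<And>i. i < r \<Longrightarrow> b' $$ (i, i) = b $$ (simple_refl k i, simple_refl k i)"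
    "perm_mat r (simple_refl k) * root_elt r k x * b = b' * (perm_mat r (simple_refl k) *
       root_elt r k ((b $$ (k, Suc k) + x * b $$ (Suc k, Suc k)) / b $$ (k, k)))"
proof -
  let ?s = "simple_refl k" and ?P = "perm_mat r (simple_refl k) :: 'a mat"
  let ?y = "(b $$ (k, Suc k) + x * b $$ (Suc k, Suc k)) / b $$ (k, k)"
  let ?c = "root_elt r k x * b * root_elt r k (- ?y)"
  let ?b = "?P * ?c * ?P"
  have c: "?c \<in> borel_B r" using k b by (intro borel_mult root_elt_borel)
  have diag: "?c $$ (i, i) = b $$ (i, i)" if "i < r" for i
    using k that borel_mult_diag[OF borel_mult[OF root_elt_borel[OF k] b] root_elt_borel[OF k] that]
      borel_mult_diag[OF root_elt_borel[OF k] b that] by auto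
  have ck: "?c $$ (k, Suc k) = 0"
  proof -
    have e: "(root_elt r k x * b) $$ (k, j) = x * b $$ (Suc k, j) + b $$ (k, j)" if "j < r" for j
      using k that borel_carrier[OF b] by (subst addrow_mat[symmetric, of _ r r]) auto
    have "?c $$ (k, Suc k) = - ?y * (root_elt r k x * b) $$ (k, k) + (root_elt r k x * b) $$ (k, Suc k)"
      using k borel_carrier[OF b] by (subst addcol_mat[symmetric, of _ r]) auto
    then show ?thesis
      using k borel_lower[OF b, of k "Suc k"] borel_diag[OF b, of k] by (simp add: e)
  qed
  have ent: "?b $$ (i, j) = ?c $$ (?s i, ?s j)" if "i < r" "j < r" for i j
    using k borel_carrier[OF c] that by (rule simple_refl_conj_entry)
  have B: "?b \<in> borel_B r"
  proof (rule borelI)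
    show "?b \<in> carrier_mat r r" using borel_carrier[OF c] by (simp add: mult_carrier_mat[of _ r r])
    show "?b $$ (i, j) = 0" if "j < i" "i < r" for i j
      using that k ck borel_lower[OF c, of "?s j" "?s i"] simple_refl_strict_mono[OF that(1), of k]
      by (cases "j = k \<and> i = Suc k") (auto simp: ent simple_refl_less simple_refl_simps)
    show "?b $$ (i, i) \<noteq> 0" if "i < r" for i
      using that k borel_diag[OF c] by (simp add: ent simple_refl_less)
  qed
  have PP: "?P * ?P = 1\<^sub>m r" using perm_mat_winv(1)[OF simple_refl_weyl[OF k]] by simp
  have "?b * (?P * root_elt r k ?y) = ?P * (?c * (?P * ?P) * root_elt r k ?y)"
    using borel_carrier[OF b] by (simp add: square_mat_simps[where r=r])
  also have "\<dots> = ?P * root_elt r k x * b"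
    using borel_carrier[OF b] root_elt_mult[OF k, of "- ?y" ?y] right_mult_one_mat[of _ r r]
    by (simp add: PP square_mat_simps[where r=r] root_elt_zero)
  finally show thesis using that[OF B] k diag by (simp add: ent simple_refl_less)
qed

lemma root_elt_perm_mat:
  assumes "Suc k < r" "w \<in> weyl r"
  shows "root_elt r k x * perm_mat r w = perm_mat r w * addrow_mat r x (winv w k) (winv w (Suc k))"
proof (rule eq_matI)
  fix i j assume "i < dim_row (perm_mat r w * addrow_mat r x (winv w k) (winv w (Suc k)))"
    "j < dim_col (perm_mat r w * addrow_mat r x (winv w k) (winv w (Suc k)))"
  then have ij: "i < r" "j < r" by (auto simp: perm_mat_def)
  have "winv w k = winv w i \<longleftrightarrow> k = i"
    using assms(2) by (metis winv_eq_iff)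
  then show "(root_elt r k x * perm_mat r w) $$ (i, j) =
      (perm_mat r w * addrow_mat r x (winv w k) (winv w (Suc k))) $$ (i, j)"
    using ij assms
    by (simp add: mult_perm_mat_entry perm_mat_mult_entry weyl_less winv_weyl winv_eq_iff)
qed (auto simp: perm_mat_def)

context nonarch_local_field begin

lemma half_density_shift:
  "sqrt (v_par val) powi (int r - 1 - 2 * int k) = v_par val * sqrt (v_par val) powi (int r - 1 - 2 * int (Suc k))"
proof -
  have "int r - 1 - 2 * int k = (int r - 1 - 2 * int (Suc k)) + 2" by simp
  then have "sqrt (v_par val) powi (int r - 1 - 2 * int k) = sqrt (v_par val) powi (int r - 1 - 2 * int (Suc k)) * sqrt (v_par val) powi 2"
    using v_par_pos power_int_add[of "sqrt (v_par val)" "int r - 1 - 2 * int (Suc k)" 2] by (simp only:) simp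
  then show ?thesis using v_par_pos by simp
qed

definition ascent :: "nat \<Rightarrow> (nat \<Rightarrow> nat) \<Rightarrow> int" where
  "ascent k w = (if winv w k < winv w (Suc k) then 1 else 0)"

lemma winv_neq: "w \<in> weyl r \<Longrightarrow> winv w k \<noteq> winv w (Suc k)"
  by (metis winv_eq_iff n_not_Suc_n)

lemma refl_root_elt_small:
  fixes x :: 'a
  assumes k: "Suc k < r" and w: "w \<in> weyl r" and x: "x \<in> p_power val (ascent k w)"
  obtains j where "j \<in> iwahori_J val r"
    "perm_mat r (simple_refl k) * root_elt r k x * perm_mat r w = perm_mat r (simple_refl k \<circ> w) * j"
proof
  let ?j = "addrow_mat r x (winv w k) (winv w (Suc k))"
  show "?j \<in> iwahori_J val r"
    using x winv_neq[OF w, of k]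
    by (cases "winv w k" "winv w (Suc k)" rule: linorder_cases)
       (auto simp: ascent_def intro: J_addrow_lower J_addrow_upper)
  show "perm_mat r (simple_refl k) * root_elt r k x * perm_mat r w = perm_mat r (simple_refl k \<circ> w) * ?j"
    using k w by (simp add: square_mat_simps[where r=r] root_elt_perm_mat perm_mat_mult[symmetric] simple_refl_weyl)
qed

lemma refl_root_elt_large:
  fixes x :: 'a
  assumes k: "Suc k < r" and w: "w \<in> weyl r" and x: "x \<notin> p_power val (ascent k w)"
    and y: "y \<in> spec_torus r"
  obtains b j where "b \<in> borel_B r" "j \<in> iwahori_J val r"
    "perm_mat r (simple_refl k) * root_elt r k x * perm_mat r w = b * perm_mat r w * j"
    "delta_half_tau val r y b = (complex_of_real (v_par val) * z_alpha y k) powi (- val x)"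
proof
  let ?j = "addrow_mat r (inverse x) (winv w (Suc k)) (winv w k)"
  let ?b = "Matrix.mat r r (\<lambda>(i, j). if i = k \<and> j = k then - inverse x else if i = k \<and> j = Suc k then 1
      else if i = Suc k \<and> j = Suc k then x else if i = j then 1 else 0)"
  let ?P = "perm_mat r (simple_refl k) :: 'a mat"
  have x0: "x \<noteq> 0" using x by auto
  show J: "?j \<in> iwahori_J val r"
  proof (cases "winv w k < winv w (Suc k)")
    case True
    then show ?thesis
      using x x0 by (intro J_addrow_lower) (auto simp: ascent_def p_power_def val_inverse)
  next
    case False
    then show ?thesis
      using x x0 winv_neq[OF w, of k]
      by (intro J_addrow_upper) (auto simp: ascent_def p_power_def val_inverse)
  qed
  show B: "?b \<in> borel_B r" using x0 by (intro borelI) auto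
  have bc: "?b \<in> carrier_mat r r" by simp
  have 1: "?P * root_elt r k x = ?b * addrow_mat r (inverse x) (Suc k) k"
  proof (rule eq_matI)
    fix i j assume "i < dim_row (?b * addrow_mat r (inverse x) (Suc k) k)"
      "j < dim_col (?b * addrow_mat r (inverse x) (Suc k) k)"
    then have ij: "i < r" "j < r" by auto
    have "(?P * root_elt r k x) $$ (i, j) = root_elt r k x $$ (simple_refl k i, j)"
      using ij k by (simp add: perm_mat_mult_entry simple_refl_weyl)
    moreover have "(?b * addrow_mat r (inverse x) (Suc k) k) $$ (i, j) = addcol (inverse x) k (Suc k) ?b $$ (i, j)"
      using k by (subst addcol_mat[OF bc]) auto
    ultimately show "(?P * root_elt r k x) $$ (i, j) = (?b * addrow_mat r (inverse x) (Suc k) k) $$ (i, j)"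
      using ij k x0 simple_refl_less[OF k ij(1)] by (auto simp: simple_refl_def Transposition.transpose_def)
  qed (auto simp: perm_mat_def)
  have 2: "addrow_mat r (inverse x) (Suc k) k * perm_mat r w = perm_mat r w * ?j"
  proof (rule eq_matI)
    fix i j assume "i < dim_row (perm_mat r w * ?j)" "j < dim_col (perm_mat r w * ?j)"
    then have ij: "i < r" "j < r" by (auto simp: perm_mat_def)
    have "winv w (Suc k) = winv w i \<longleftrightarrow> Suc k = i"
      using w by (metis winv_eq_iff)
    then show "(addrow_mat r (inverse x) (Suc k) k * perm_mat r w) $$ (i, j) = (perm_mat r w * ?j) $$ (i, j)"
      using ij w k by (simp add: mult_perm_mat_entry perm_mat_mult_entry weyl_less winv_weyl winv_eq_iff)
  qed (auto simp: perm_mat_def)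
  show "?P * root_elt r k x * perm_mat r w = ?b * perm_mat r w * ?j"
    using 2 bc by (simp add: 1 square_mat_simps[where r=r])
  let ?h = "half_density_char (v_par val) r y"
  have h: "?h k \<noteq> 0" "?h (Suc k) \<noteq> 0" using half_density_char_nonzero[OF y] k by auto
  have "delta_half_tau val r y ?b = (\<Prod>i<r. if i = k then ?h k powi (- val x) else if i = Suc k then ?h (Suc k) powi (val x) else 1)"
    unfolding delta_half_tau_eq[OF B] using x0 by (intro prod.cong) (auto simp: val_inverse)
  also have "\<dots> = (\<Prod>i\<in>{k, Suc k}. if i = k then ?h k powi (- val x) else if i = Suc k then ?h (Suc k) powi (val x) else 1)"
    using k by (intro prod.mono_neutral_right) auto
  also have "\<dots> = (?h k / ?h (Suc k)) powi (- val x)"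
    using h by (simp add: power_int_mult_distrib power_int_inverse power_int_minus divide_inverse mult.commute)
  also have "?h k / ?h (Suc k) = complex_of_real (v_par val) * z_alpha y k"
  proof -
    show ?thesis using v_par_pos half_density_shift[of r k] by (simp add: half_density_char_def z_alpha_def)
  qed
  finally show "delta_half_tau val r y ?b = (complex_of_real (v_par val) * z_alpha y k) powi (- val x)" .
qed

lemma delta_half_tau_refl:
  assumes k: "Suc k < r" and b: "b \<in> borel_B r" "b' \<in> borel_B r" and y: "y \<in> spec_torus r"
    and diag: "\<And>i. i < r \<Longrightarrow> b' $$ (i, i) = b $$ (simple_refl k i, simple_refl k i)"
  shows "delta_half_tau val r y b' = delta_half_tau val r (weyl_act (simple_refl k) y) b *
    complex_of_real (v_par val powi (val (b $$ (Suc k, Suc k)) - val (b $$ (k, k))))"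
proof -
  let ?s = "simple_refl k" and ?D = "\<lambda>i. val (b $$ (i, i))" and ?v = "complex_of_real (v_par val)"
  let ?h = "half_density_char (v_par val) r y" and ?h' = "half_density_char (v_par val) r (weyl_act ?s y)"
  let ?e = "\<lambda>i. if i = k then ?v powi (- ?D k) else if i = Suc k then ?v powi ?D (Suc k) else 1"
  have "delta_half_tau val r y b' = (\<Prod>i<r. ?h i powi ?D (?s i))"
    unfolding delta_half_tau_eq[OF b(2)] using diag by (intro prod.cong) auto
  also have "\<dots> = (\<Prod>i<r. ?h (?s i) powi ?D i)"
    using k by (intro prod.reindex_bij_witness[of _ ?s ?s]) (auto simp: simple_refl_less)
  also have "\<dots> = (\<Prod>i<r. ?h' i powi ?D i * ?e i)"
  proof (intro prod.cong refl)
    fix i assume "i \<in> {..<r}"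
    have "?h (?s k) = ?h' k * inverse ?v" "?h (?s (Suc k)) = ?h' (Suc k) * ?v"
      using v_par_pos half_density_shift[of r k] by (simp_all add: half_density_char_def weyl_act_refl simple_refl_simps)
    then show "?h (?s i) powi ?D i = ?h' i powi ?D i * ?e i"
      using v_par_pos simple_refl_simps(3)[of i k]
      by (auto simp: power_int_mult_distrib power_int_inverse power_int_minus half_density_char_def weyl_act_refl)
  qed
  also have "\<dots> = delta_half_tau val r (weyl_act ?s y) b * (\<Prod>i<r. ?e i)"
    by (simp add: delta_half_tau_eq[OF b(1)] prod.distrib)
  also have "(\<Prod>i<r. ?e i) = (\<Prod>i\<in>{k, Suc k}. ?e i)"
    using k by (intro prod.mono_neutral_right) auto
  also have "\<dots> = complex_of_real (v_par val powi (?D (Suc k) - ?D k))"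
    using v_par_pos by (simp add: power_int_diff power_int_minus field_simps)
  finally show ?thesis .
qed

lemma flat_section_refl_root_elt:
  fixes x :: 'a
  assumes k: "Suc k < r" and y: "y \<in> spec_torus r" and f: "f \<in> iwahori_fixed val r z"
    and b: "b \<in> borel_B r" and w: "w \<in> weyl r" and j: "j \<in> iwahori_J val r"
  defines "x' \<equiv> b $$ (Suc k, Suc k) / b $$ (k, k) * x + b $$ (k, Suc k) / b $$ (k, k)"
  shows "flat_section val r f y (perm_mat r (simple_refl k) * root_elt r k x * (b * perm_mat r w * j)) =
    delta_half_tau val r (weyl_act (simple_refl k) y) b *
    complex_of_real (v_par val powi val (b $$ (Suc k, Suc k) / b $$ (k, k))) *
    (if x' \<in> p_power val (ascent k w) then f (perm_mat r (simple_refl k \<circ> w))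
     else (complex_of_real (v_par val) * z_alpha y k) powi (- val x') * f (perm_mat r w))"
proof -
  let ?s = "simple_refl k" and ?P = "perm_mat r (simple_refl k) :: 'a mat"
  have x': "x' = (b $$ (k, Suc k) + x * b $$ (Suc k, Suc k)) / b $$ (k, k)"
    by (simp add: x'_def add_divide_distrib)
  obtain b' where b': "b' \<in> borel_B r" "\<And>i. i < r \<Longrightarrow> b' $$ (i, i) = b $$ (?s i, ?s i)"
    "?P * root_elt r k x * b = b' * (?P * root_elt r k x')"
    using refl_root_elt_borel[OF k b, of x] unfolding x' by blast
  have "b $$ (Suc k, Suc k) \<noteq> 0" "b $$ (k, k) \<noteq> 0" using b k by (auto simp: borel_diag)
  then have d: "delta_half_tau val r y b' = delta_half_tau val r (weyl_act ?s y) b *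
    complex_of_real (v_par val powi val (b $$ (Suc k, Suc k) / b $$ (k, k)))"
    using delta_half_tau_refl[OF k b b'(1) y b'(2)] by (simp add: val_divide)
  note C = borel_carrier[OF b] borel_carrier[OF b'(1)] J_carrier[OF j]
  have "?P * root_elt r k x * (b * perm_mat r w * j) = ?P * root_elt r k x * b * perm_mat r w * j"
    using C by (simp add: square_mat_simps[where r=r])
  also have "\<dots> = b' * (?P * root_elt r k x' * perm_mat r w) * j"
    unfolding b'(3) using C by (simp add: square_mat_simps[where r=r])
  finally have eq: "?P * root_elt r k x * (b * perm_mat r w * j) = b' * (?P * root_elt r k x' * perm_mat r w) * j" .
  show ?thesis
  proof (cases "x' \<in> p_power val (ascent k w)")
    case True
    obtain i where i: "i \<in> iwahori_J val r"
      "?P * root_elt r k x' * perm_mat r w = perm_mat r (?s \<circ> w) * i"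
      using refl_root_elt_small[OF k w True] by blast
    have "b' * (?P * root_elt r k x' * perm_mat r w) * j = b' * perm_mat r (?s \<circ> w) * (i * j)"
      using C J_carrier[OF i(1)] by (simp add: i(2) square_mat_simps[where r=r])
    then show ?thesis
      using True flat_section_bruhat[OF y f b'(1) weyl_comp[OF simple_refl_weyl[OF k] w] J_mult[OF i(1) j]]
      by (simp add: eq d)
  next
    case False
    obtain c i where c: "c \<in> borel_B r" "i \<in> iwahori_J val r"
      "?P * root_elt r k x' * perm_mat r w = c * perm_mat r w * i"
      "delta_half_tau val r y c = (complex_of_real (v_par val) * z_alpha y k) powi (- val x')"
      using refl_root_elt_large[OF k w False y] by blast
    have "b' * (?P * root_elt r k x' * perm_mat r w) * j = (b' * c) * perm_mat r w * (i * j)"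
      using C J_carrier[OF c(2)] borel_carrier[OF c(1)] by (simp add: c(3) square_mat_simps[where r=r])
    then show ?thesis
      using False flat_section_bruhat[OF y f borel_mult[OF b'(1) c(1)] w J_mult[OF c(2) j]]
      by (simp add: eq d c(4) delta_half_tau_mult[OF y b'(1) c(1)])
  qed
qed

end

section \<open>Integrals of countably valued functions\<close>

lemma suminf_indicator_disjoint:
  fixes u :: "nat \<Rightarrow> complex"
  assumes "disjoint_family T" "x \<in> T i"
  shows "(\<lambda>i. indicator (T i) x *\<^sub>R u i) sums u i"
proof -
  have "indicator (T j) x *\<^sub>R u j = (if j = i then u i else 0)" for j
    using assms disjoint_family_onD[OF assms(1), of i j] by (auto simp: indicator_def)
  then show ?thesis using sums_single[of i "\<lambda>_. u i"] by (simp only:)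
qed

lemma
  fixes F :: "'b \<Rightarrow> complex" and T :: "nat \<Rightarrow> 'b set"
  assumes T: "\<And>i. T i \<in> sets M" "disjoint_family T" "(\<Union>i. T i) = space M"
    and fin: "\<And>i. emeasure M (T i) < \<infinity>" and F: "\<And>i x. x \<in> T i \<Longrightarrow> F x = u i"
  shows integrable_countable_range: "integrable M F \<longleftrightarrow> summable (\<lambda>i. norm (u i) * measure M (T i))" (is ?A)
    and integral_countable_range: "integrable M F \<Longrightarrow> (\<lambda>i. measure M (T i) *\<^sub>R u i) sums (\<integral>x. F x \<partial>M)" (is "_ \<Longrightarrow> ?B")
proof -
  let ?f = "\<lambda>i x. indicator (T i) x *\<^sub>R u i"
  have cover: "\<exists>i. x \<in> T i" if "x \<in> space M" for x
    using that unfolding T(3)[symmetric] by simp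
  have Tsp: "T i \<subseteq> space M" for i using T(1) sets.sets_into_space by blast
  have sums: "(\<lambda>i. ?f i x) sums F x" if x: "x \<in> space M" for x
  proof -
    obtain i where "x \<in> T i" using cover[OF x] by blast
    then show ?thesis using suminf_indicator_disjoint[OF T(2), of x i u] F by simp
  qed
  have f: "integrable M (?f i)" for i using T(1) fin by simp
  have nf: "(\<integral>x. norm (?f i x) \<partial>M) = norm (u i) * measure M (T i)" for i
    using Tsp[of i] by (simp add: Int_absorb2)
  have If: "(\<integral>x. ?f i x \<partial>M) = measure M (T i) *\<^sub>R u i" for i
    using T(1) fin Tsp[of i] by (simp add: Int_absorb2)
  have eq: "integrable M F \<longleftrightarrow> integrable M (\<lambda>x. suminf (\<lambda>i. ?f i x))"
    "integral\<^sup>L M F = integral\<^sup>L M (\<lambda>x. suminf (\<lambda>i. ?f i x))"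
    using sums[THEN sums_unique]
    by (intro Bochner_Integration.integrable_cong Bochner_Integration.integral_cong refl; simp)+
  have sn: "AE x in M. summable (\<lambda>i. norm (?f i x))"
  proof (rule AE_I2)
    fix x assume "x \<in> space M"
    then obtain i where i: "x \<in> T i" using cover by blast
    have "norm (?f j x) = (if j = i then norm (u i) else 0)" for j
      using i disjoint_family_onD[OF T(2), of i j] by (auto simp: indicator_def)
    then show "summable (\<lambda>i. norm (?f i x))"
      using sums_summable[OF sums_single[of i "\<lambda>_. norm (u i)"]] by (simp only:)
  qed
  show A: ?A
  proof
    assume "summable (\<lambda>i. norm (u i) * measure M (T i))"
    then show "integrable M F"
      unfolding eq(1) by (intro integrable_suminf f sn) (simp only: nf)
  next
    assume int: "integrable M F"
    show "summable (\<lambda>i. norm (u i) * measure M (T i))"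
    proof (rule summableI_nonneg_bounded)
      show "0 \<le> norm (u n) * measure M (T n)" for n by simp
      show "(\<Sum>i<n. norm (u i) * measure M (T i)) \<le> (\<integral>x. norm (F x) \<partial>M)" for n
      proof -
        have "(\<Sum>i<n. norm (u i) * measure M (T i)) = (\<integral>x. (\<Sum>i<n. norm (?f i x)) \<partial>M)"
          by (subst Bochner_Integration.integral_sum) (intro integrable_norm f, simp only: nf)
        also have "\<dots> \<le> (\<integral>x. norm (F x) \<partial>M)"
        proof (rule integral_mono)
          show "integrable M (\<lambda>x. \<Sum>i<n. norm (?f i x))" by (intro Bochner_Integration.integrable_sum Bochner_Integration.integrable_norm f)
          show "integrable M (\<lambda>x. norm (F x))" using int by (rule integrable_norm)
          fix x assume "x \<in> space M"
          then obtain i where i: "x \<in> T i" using cover by blast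
          have "norm (?f j x) = (if j = i then norm (u i) else 0)" for j
            using i disjoint_family_onD[OF T(2), of i j] by (auto simp: indicator_def)
          then have "(\<Sum>j<n. norm (?f j x)) = (\<Sum>j<n. if j = i then norm (u i) else 0)" by (simp only:)
          also have "\<dots> \<le> norm (u i)" by simp
          finally show "(\<Sum>j<n. norm (?f j x)) \<le> norm (F x)" using F[OF i] by simp
        qed
        finally show ?thesis .
      qed
    qed
  qed
  show ?B if "integrable M F"
  proof -
    have s: "summable (\<lambda>i. \<integral>x. norm (?f i x) \<partial>M)" using A that by (simp only: nf)
    have "(\<lambda>i. \<integral>x. ?f i x \<partial>M) sums (\<integral>x. suminf (\<lambda>i. ?f i x) \<partial>M)"
      by (rule sums_integral[OF f sn s])
    then show ?thesis by (simp only: If eq(2))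
  qed
qed

text \<open>The integrand is a geometric series: its value on the \<open>m\<close>-th shell is
  \<open>c (v X)\<^sup>-\<^sup>m\<close>, against the volume \<open>C (1 - v) v\<^sup>m\<close>.\<close>

lemma
  fixes F :: "'b \<Rightarrow> complex" and A :: "int \<Rightarrow> 'b set" and n :: int and C v :: real and a c X :: complex
  assumes A: "\<And>m. A m \<in> sets M" "\<And>m. A (m + 1) \<subseteq> A m" "(\<Union>m. A m) = space M"
    and meas: "\<And>m. emeasure M (A m) = ennreal (C * v powi m)" and C: "C > 0" and v: "0 < v" "v < 1"
    and X: "X \<noteq> 0" and Fa: "\<And>x. x \<in> A n \<Longrightarrow> F x = a"
    and Fc: "\<And>x m. x \<in> A m \<Longrightarrow> x \<notin> A (m + 1) \<Longrightarrow> m < n \<Longrightarrow> F x = c * (complex_of_real v * X) powi (- m)"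
  shows shell_integrable: "norm X < 1 \<Longrightarrow> integrable M F"
    and shell_integral: "integrable M F \<Longrightarrow> (1 - X) * (\<integral>x. F x \<partial>M) =
      complex_of_real C * ((1 - X) * a * complex_of_real v powi n + c * (1 - complex_of_real v) * X powi (1 - n))"
proof -
  define T where "T i = (case i of 0 \<Rightarrow> A n | Suc j \<Rightarrow> A (n - 1 - int j) - A (n - int j))" for i
  define u where "u i = (case i of 0 \<Rightarrow> a | Suc j \<Rightarrow> c * (complex_of_real v * X) powi (1 + int j - n))" for i
  have anti: "A (m + int d) \<subseteq> A m" for m d
  proof (induction d)
    case (Suc d)
    have "A (m + int (Suc d)) = A ((m + int d) + 1)" by (simp add: algebra_simps)
    then show ?case using A(2)[of "m + int d"] Suc by simp
  qed simp
  have anti': "A m' \<subseteq> A m" if "m \<le> m'" for m m'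
    using anti[of m "nat (m' - m)"] that by simp
  have TS: "T (Suc j) = A (n - 1 - int j) - A (n - int j)" and T0: "T 0 = A n"
    and uS: "u (Suc j) = c * (complex_of_real v * X) powi (1 + int j - n)" and u0: "u 0 = a" for j
    by (auto simp: T_def u_def)
  have Tsets: "T i \<in> sets M" for i using A(1) by (cases i) (auto simp: T0 TS)
  have disj: "disjoint_family T"
  proof -
    have less: "T i \<inter> T i' = {}" if "i < i'" for i i'
    proof -
      define j where "j = i' - 1"
      have j: "i' = Suc j" "i \<le> j" using that by (auto simp: j_def)
      have "T i \<subseteq> A (n - int j)"
      proof (cases i)
        case 0
        then show ?thesis using anti'[of "n - int j" n] by (simp add: T0)
      next
        case (Suc m)
        then show ?thesis using j anti'[of "n - int j" "n - 1 - int m"] by (auto simp: TS)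
      qed
      then show ?thesis using j by (auto simp: TS)
    qed
    have "T i \<inter> T i' = {}" if "i \<noteq> i'" for i i'
      using that less[of i i'] less[of i' i] by (auto simp: neq_iff)
    then show ?thesis by (simp add: disjoint_family_on_def)
  qed
  have union: "(\<Union>i. T i) = space M"
  proof
    show "(\<Union>i. T i) \<subseteq> space M" using sets.sets_into_space[OF Tsets] by (rule UN_least)
    show "space M \<subseteq> (\<Union>i. T i)"
    proof
      fix x assume "x \<in> space M"
      then have "\<exists>m. x \<in> A m" unfolding A(3)[symmetric] by simp
      then obtain m where m: "x \<in> A m" by blast
      show "x \<in> (\<Union>i. T i)"
      proof (cases "x \<in> A n")
        case True then show ?thesis using T0 by blast
      next
        case False
        define P where "P d \<longleftrightarrow> x \<in> A (n - int d)" for d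
        have "P (nat (n - m))" using m False anti'[of n m] by (cases "m \<le> n") (auto simp: P_def)
        moreover have "\<not> P 0" using False by (simp add: P_def)
        ultimately obtain d where "\<not> P d" "P (Suc d)"
          using ex_least_nat_less[of P] by blast
        then have "x \<in> T (Suc d)" by (auto simp: P_def TS algebra_simps)
        then show ?thesis by blast
      qed
    qed
  qed
  have fin: "emeasure M (A m) < \<infinity>" for m by (simp add: meas)
  have mA: "measure M (A m) = C * v powi m" for m using C v by (simp add: measure_def meas)
  have mS: "measure M (T (Suc j)) = C * (1 - v) * v powi (n - 1 - int j)" for j
  proof -
    have "v powi (n - int j) = v * v powi (n - 1 - int j)"
      using v power_int_add_1'[of v "n - 1 - int j"] by simp
    moreover have "measure M (T (Suc j)) = measure M (A (n - 1 - int j)) - measure M (A (n - int j))"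
      unfolding TS using A(1) fin[of "n - 1 - int j"] anti'[of "n - 1 - int j" "n - int j"] by (intro measure_Diff) auto
    ultimately show ?thesis by (simp add: mA algebra_simps)
  qed
  have finT: "emeasure M (T i) < \<infinity>" for i
  proof -
    obtain m where "T i \<subseteq> A m" by (cases i) (auto simp: T0 TS)
    then show ?thesis using emeasure_mono[of "T i" "A m" M] A(1) fin[of m] by (auto intro: le_less_trans)
  qed
  have FT: "F x = u i" if "x \<in> T i" for i x
  proof (cases i)
    case 0 then show ?thesis using that Fa by (simp add: T0 u0)
  next
    case (Suc j)
    then show ?thesis using that Fc[of x "n - 1 - int j"] by (simp add: TS uS algebra_simps)
  qed
  have int_iff: "integrable M F \<longleftrightarrow> summable (\<lambda>i. norm (u i) * measure M (T i))"
    using FT by (rule integrable_countable_range[OF Tsets disj union finT])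
  have int_sums: "(\<lambda>i. measure M (T i) *\<^sub>R u i) sums (\<integral>x. F x \<partial>M)" if "integrable M F"
    using FT that by (rule integral_countable_range[OF Tsets disj union finT])
  have geo: "complex_of_real (measure M (T (Suc j))) * u (Suc j) = complex_of_real (C * (1 - v)) * c * X powi (1 - n) * X ^ j" for j
  proof -
    have "complex_of_real (v powi (n - 1 - int j)) * (complex_of_real v * X) powi (1 + int j - n) = X powi (1 + int j - n)"
    proof -
      have "n - 1 - int j = - (1 + int j - n)" by simp
      then have "complex_of_real (v powi (n - 1 - int j)) = inverse (complex_of_real v powi (1 + int j - n))"
        by (simp only: power_int_minus of_real_power_int of_real_inverse)
      then show ?thesis using v by (simp add: power_int_mult_distrib)
    qed
    moreover have "X powi (1 + int j - n) = X powi (1 - n) * X ^ j"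
      using X power_int_add[of X "1 - n" "int j"] by (simp add: algebra_simps)
    ultimately show ?thesis by (simp add: mS uS algebra_simps)
  qed
  have ngeo: "norm (u (Suc j)) * measure M (T (Suc j)) = norm (complex_of_real (C * (1 - v)) * c * X powi (1 - n)) * norm X ^ j" for j
  proof -
    have "norm (u (Suc j)) * measure M (T (Suc j)) = norm (complex_of_real (measure M (T (Suc j))) * u (Suc j))"
      by (simp add: norm_mult)
    then show ?thesis unfolding geo by (simp only: norm_mult norm_power)
  qed
  show "integrable M F" if "norm X < 1"
    unfolding int_iff by (subst summable_Suc_iff[symmetric]) (use that in \<open>simp only: ngeo, intro summable_mult summable_geometric, simp\<close>)
  show "(1 - X) * (\<integral>x. F x \<partial>M) =
      complex_of_real C * ((1 - X) * a * complex_of_real v powi n + c * (1 - complex_of_real v) * X powi (1 - n))"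
    if int: "integrable M F"
  proof -
    let ?K = "complex_of_real (C * (1 - v)) * c * X powi (1 - n)"
    have "summable (\<lambda>j. norm ?K * norm X ^ j)"
      using int unfolding int_iff by (subst (asm) summable_Suc_iff[symmetric]) (simp only: ngeo)
    then have cases: "c = 0 \<or> norm X < 1"
      using C v X by (auto simp: summable_cmult_iff summable_geometric_iff)
    have "\<exists>S. (\<lambda>j. ?K * X ^ j) sums S \<and> (1 - X) * S = ?K"
    proof (cases "c = 0")
      case False
      then have X1: "norm X < 1" using cases by simp
      then have "X \<noteq> 1" by auto
      then show ?thesis
        using sums_mult[OF geometric_sums[OF X1], of ?K] by (intro exI[of _ "?K * (1 / (1 - X))"]) simp
    next
      case True
      then show ?thesis by (intro exI[of _ 0]) simp
    qed
    then obtain S where S: "(\<lambda>j. ?K * X ^ j) sums S" "(1 - X) * S = ?K" by blast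
    have "(\<lambda>j. measure M (T (Suc j)) *\<^sub>R u (Suc j)) sums S"
      unfolding scaleR_conv_of_real geo by (rule S(1))
    then have "(\<lambda>j. measure M (T j) *\<^sub>R u j) sums (S + measure M (T 0) *\<^sub>R u 0)"
      by (rule sums_Suc)
    from sums_unique2[OF int_sums[OF int] this]
    have "(\<integral>x. F x \<partial>M) = S + complex_of_real (C * v powi n) * a" by (simp add: T0 u0 mA scaleR_conv_of_real)
    then show ?thesis using S(2) by (simp add: algebra_simps)
  qed
qed

section \<open>Haar measure on the root subgroup\<close>

context nonarch_local_field begin

definition root_ball :: "nat \<Rightarrow> nat \<Rightarrow> 'a \<Rightarrow> int \<Rightarrow> 'a mat set" where
  "root_ball r k c m = root_elt r k ` {x. x - c \<in> p_power val m}"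

lemma haar_space:
  assumes "Suc k < r" "is_haar_measure val r (N_w r (simple_refl k)) \<mu>"
  shows "space \<mu> = range (root_elt r k)"
  using assms by (simp add: is_haar_measure_def N_simple_refl)

lemma root_ball_sets:
  assumes k: "Suc k < r" and haar: "is_haar_measure val r (N_w r (simple_refl k)) \<mu>"
  shows "root_ball r k c m \<in> sets \<mu>"
proof -
  have "root_ball r k c m \<in> open_subsets val r (range (root_elt r k))"
    unfolding open_subsets_def
  proof (intro CollectI conjI ballI)
    show "root_ball r k c m \<subseteq> range (root_elt r k)" by (auto simp: root_ball_def)
    fix g assume "g \<in> root_ball r k c m"
    then obtain x where x: "g = root_elt r k x" "x - c \<in> p_power val m" by (auto simp: root_ball_def)
    show "\<exists>n. \<forall>h\<in>range (root_elt r k). mat_near val r n g h \<longrightarrow> h \<in> root_ball r k c m"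
    proof (intro exI ballI impI)
      fix h assume "h \<in> range (root_elt r k)" and near: "mat_near val r m g h"
      then obtain y where y: "h = root_elt r k y" by blast
      have "h $$ (k, Suc k) - g $$ (k, Suc k) \<in> p_power val m"
        using near k by (simp add: mat_near_def)
      then have "y - x \<in> p_power val m" using k by (simp add: x y)
      from p_power_add[OF this x(2)] show "h \<in> root_ball r k c m" by (simp add: y root_ball_def)
    qed
  qed
  then show ?thesis
    using haar k by (auto simp: is_haar_measure_def N_simple_refl intro: sigma_sets.Basic)
qed

lemma root_ball_translate:
  assumes k: "Suc k < r" and haar: "is_haar_measure val r (N_w r (simple_refl k)) \<mu>"
  shows "emeasure \<mu> (root_ball r k c m) = emeasure \<mu> (root_ball r k 0 m)"
proof -
  have "root_ball r k c m = (\<lambda>x. root_elt r k c * x) ` root_ball r k 0 m"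
  proof -
    have "{x. x - c \<in> p_power val m} = (\<lambda>x. c + x) ` p_power val m"
      by (auto simp: image_iff) (metis add.commute diff_add_cancel)
    then show ?thesis using k by (simp add: root_ball_def image_image root_elt_mult)
  qed
  moreover have "emeasure \<mu> ((\<lambda>x. h * x) ` A) = emeasure \<mu> A" if "h \<in> range (root_elt r k)" "A \<in> sets \<mu>" for h A
    using haar that unfolding is_haar_measure_def N_simple_refl[OF k] by blast
  ultimately show ?thesis using root_ball_sets[OF k haar] by simp
qed

lemma root_ball_unit:
  assumes k: "Suc k < r" and haar: "is_haar_measure val r (N_w r (simple_refl k)) \<mu>"
  shows "emeasure \<mu> (root_ball r k 0 0) = 1"
proof -
  have "root_elt r k x \<in> integral_mats val r \<longleftrightarrow> x \<in> int_ring val" for x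
    using k by (auto simp: integral_mats_def) (metis Suc_lessD index_mat_addrow_mat(1) n_not_Suc_n add.right_neutral)
  then have "range (root_elt r k) \<inter> integral_mats val r = root_ball r k 0 0"
    by (auto simp: root_ball_def)
  then show ?thesis using haar k by (simp add: is_haar_measure_def N_simple_refl)
qed

text \<open>A ball of radius \<open>m\<close> is the disjoint union of balls of radius \<open>m + 1\<close>, one for
  each residue class.\<close>

lemma root_ball_step:
  assumes k: "Suc k < r" and haar: "is_haar_measure val r (N_w r (simple_refl k)) \<mu>"
  shows "emeasure \<mu> (root_ball r k 0 m) = of_nat (card (residue_classes val)) * emeasure \<mu> (root_ball r k 0 (m + 1))"
proof -
  obtain t where t: "t \<noteq> 0" "val t = m" by (rule uniformizer_power)
  define B where "B C = root_elt r k ` ((\<lambda>x. t * x) ` C)" for C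
  have ball: "\<exists>c. B C = root_ball r k c (m + 1)" if "C \<in> residue_classes val" for C
  proof -
    obtain c where c: "c \<in> int_ring val" "C = residue_rel `` {c}"
      using \<open>C \<in> residue_classes val\<close> unfolding residue_classes_def by (rule quotientE)
    have "(\<lambda>x. t * x) ` C = {x. x - t * c \<in> p_power val (m + 1)}"
    proof (intro equalityI subsetI)
      fix y assume "y \<in> (\<lambda>x. t * x) ` C"
      then obtain x where x: "y = t * x" "c - x \<in> p_power val 1" using c by auto
      then have "t * (x - c) \<in> p_power val (m + 1)"
        using t by (simp add: p_power_mult_iff p_power_diff_commute[of c])
      then show "y \<in> {x. x - t * c \<in> p_power val (m + 1)}" using x by (simp add: algebra_simps)
    next
      fix y assume "y \<in> {x. x - t * c \<in> p_power val (m + 1)}"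
      then have "t * (y / t - c) \<in> p_power val (m + 1)" using t by (simp add: algebra_simps)
      then have 1: "y / t - c \<in> p_power val 1" using t by (simp add: p_power_mult_iff)
      then have "(y / t - c) + c \<in> int_ring val"
        using c p_power_mono[of 0 1] by (intro p_power_add) auto
      then have "y / t \<in> C" using 1 c by (simp add: p_power_diff_commute[of c])
      then show "y \<in> (\<lambda>x. t * x) ` C" using t by (intro image_eqI[of _ _ "y / t"]) auto
    qed
    then show ?thesis by (auto simp: B_def root_ball_def)
  qed
  have union: "root_ball r k 0 m = (\<Union>C\<in>residue_classes val. B C)"
  proof -
    have "(\<Union>C\<in>residue_classes val. B C) = root_elt r k ` ((\<lambda>x. t * x) ` \<Union> (residue_classes val))"
      by (auto simp: B_def)
    also have "\<Union> (residue_classes val) = int_ring val"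
      unfolding residue_classes_def by (rule Union_quotient[OF equiv_residue_rel])
    also have "(\<lambda>x. t * x) ` int_ring val = p_power val m"
    proof (intro equalityI subsetI)
      fix y assume "y \<in> p_power val m"
      then have "t * (y / t) \<in> p_power val m" using t by simp
      then have "y / t \<in> int_ring val" using t by (subst (asm) p_power_mult_iff) auto
      then show "y \<in> (\<lambda>x. t * x) ` int_ring val" using t by (intro image_eqI[of _ _ "y / t"]) auto
    qed (use t in \<open>auto simp: p_power_mult_iff\<close>)
    finally show ?thesis by (simp add: root_ball_def)
  qed
  have disj: "disjoint_family_on B (residue_classes val)"
    unfolding disjoint_family_on_def
  proof (intro ballI impI)
    fix C D assume "C \<in> residue_classes val" "D \<in> residue_classes val" "C \<noteq> D"
    then have "C \<inter> D = {}" using quotient_disj[OF equiv_residue_rel] by (auto simp: residue_classes_def)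
    then show "B C \<inter> B D = {}"
      using t root_elt_inj[OF k] by (fastforce simp: B_def)
  qed
  have meas: "B C \<in> sets \<mu>" "emeasure \<mu> (B C) = emeasure \<mu> (root_ball r k 0 (m + 1))" if "C \<in> residue_classes val" for C
    using ball[OF that] root_ball_sets[OF k haar] root_ball_translate[OF k haar] by metis+
  have "emeasure \<mu> (root_ball r k 0 m) = (\<Sum>C\<in>residue_classes val. emeasure \<mu> (B C))"
    unfolding union using meas(1) by (intro sum_emeasure[symmetric] disj finite_residue_field) auto
  also have "\<dots> = (\<Sum>C\<in>residue_classes val. emeasure \<mu> (root_ball r k 0 (m + 1)))"
    by (intro sum.cong refl meas(2))
  finally show ?thesis by simp
qed

lemma root_ball_emeasure:
  assumes k: "Suc k < r" and haar: "is_haar_measure val r (N_w r (simple_refl k)) \<mu>"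
  shows "emeasure \<mu> (root_ball r k c m) = ennreal (v_par val powi m)"
proof -
  define q where "q = real (card (residue_classes val))"
  have q: "q > 0" "v_par val = inverse q" "of_nat (card (residue_classes val)) = ennreal q"
    using card_residue_classes by (auto simp: q_def v_par_def divide_inverse ennreal_of_nat_eq_real_of_nat)
  note step = root_ball_step[OF k haar, unfolded q(3)]
  have "emeasure \<mu> (root_ball r k 0 m) = ennreal (v_par val powi m)"
  proof (induction m rule: int_induct[where k = 0])
    case base
    then show ?case by (simp add: root_ball_unit[OF k haar])
  next
    case (step1 i)
    have "ennreal (inverse q) * (ennreal q * emeasure \<mu> (root_ball r k 0 (i + 1))) = ennreal (inverse q) * ennreal (v_par val powi i)"
      using step1 step[of i] by simp
    moreover have "ennreal (inverse q) * ennreal q = 1"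
      using q(1) by (simp add: ennreal_mult[symmetric])
    ultimately show ?case
      using q by (simp add: mult.assoc[symmetric] ennreal_mult[symmetric] power_int_add_1')
  next
    case (step2 i)
    have "q * v_par val powi i = v_par val powi (i - 1)"
      using q power_int_add_1'[of "v_par val" "i - 1"] by simp
    then show ?case using step[of "i - 1"] step2 q by (simp add: ennreal_mult[symmetric])
  qed
  then show ?thesis using root_ball_translate[OF k haar, of c m] by simp
qed

lemma affine_root_ball:
  assumes "\<alpha> \<noteq> 0"
  shows "root_elt r k ` {x. \<alpha> * x + \<beta> \<in> p_power val m} = root_ball r k (- \<beta> / \<alpha>) (m - val \<alpha>)"
proof -
  have eq: "\<alpha> * x + \<beta> = \<alpha> * (x - (- \<beta> / \<alpha>))" for x using assms by (simp add: field_simps)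
  show ?thesis unfolding eq root_ball_def p_power_mult_iff[OF assms] ..
qed

lemma
  fixes F :: "'a mat \<Rightarrow> complex" and n :: int and \<alpha> \<beta> :: 'a and a c X :: complex
  assumes k: "Suc k < r" and haar: "is_haar_measure val r (N_w r (simple_refl k)) \<mu>"
    and \<alpha>: "\<alpha> \<noteq> 0" and X: "X \<noteq> 0"
    and F: "\<And>x. F (root_elt r k x) = (if \<alpha> * x + \<beta> \<in> p_power val n then a
      else (complex_of_real (v_par val) * X) powi (- val (\<alpha> * x + \<beta>)) * c)"
  shows root_integrable: "norm X < 1 \<Longrightarrow> integrable \<mu> F"
    and root_integral: "integrable \<mu> F \<Longrightarrow> (1 - X) * (\<integral>x. F x \<partial>\<mu>) = complex_of_real (v_par val powi (- val \<alpha>)) *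
      ((1 - X) * a * complex_of_real (v_par val) powi n + c * (1 - complex_of_real (v_par val)) * X powi (1 - n))"
proof -
  let ?v = "v_par val"
  define A where "A m = root_elt r k ` {x. \<alpha> * x + \<beta> \<in> p_power val m}" for m
  have mem: "root_elt r k x \<in> A m \<longleftrightarrow> \<alpha> * x + \<beta> \<in> p_power val m" for x m
    using root_elt_inj[OF k] by (auto simp: A_def)
  have A1: "A m \<in> sets \<mu>" for m
    unfolding A_def affine_root_ball[OF \<alpha>] by (rule root_ball_sets[OF k haar])
  have A2: "A (m + 1) \<subseteq> A m" for m
    using p_power_mono[of m "m + 1"] by (auto simp: A_def)
  have A3: "(\<Union>m. A m) = space \<mu>"
  proof -
    have "\<exists>m. \<alpha> * x + \<beta> \<in> p_power val m" for x by (auto simp: p_power_def)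
    then have "\<exists>m. root_elt r k x \<in> A m" for x by (simp add: mem)
    then show ?thesis unfolding haar_space[OF k haar] by (auto simp: A_def)
  qed
  have A4: "emeasure \<mu> (A m) = ennreal (?v powi (- val \<alpha>) * ?v powi m)" for m
  proof -
    have "m - val \<alpha> = - val \<alpha> + m" by simp
    then show ?thesis
      unfolding A_def affine_root_ball[OF \<alpha>] root_ball_emeasure[OF k haar]
      using v_par_pos power_int_add[of ?v "- val \<alpha>" m] by (simp only:) simp
  qed
  have C: "?v powi (- val \<alpha>) > 0" using v_par_pos by simp
  have F1: "F g = a" if "g \<in> A n" for g using that F by (auto simp: A_def)
  have F2: "F g = c * (complex_of_real ?v * X) powi (- m)" if g: "g \<in> A m" "g \<notin> A (m + 1)" "m < n" for g m
  proof -
    obtain x where x: "g = root_elt r k x" using g by (auto simp: A_def)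
    have "\<alpha> * x + \<beta> \<notin> p_power val n" using g p_power_mono[of "m + 1" n] unfolding x mem by auto
    moreover have "val (\<alpha> * x + \<beta>) = m" using g unfolding x mem by (auto simp: p_power_def)
    ultimately show ?thesis unfolding x F by simp
  qed
  show "norm X < 1 \<Longrightarrow> integrable \<mu> F"
    by (rule shell_integrable[OF A1 A2 A3 A4 C v_par_pos v_par_less_1 X F1 F2])
  show "integrable \<mu> F \<Longrightarrow> (1 - X) * (\<integral>x. F x \<partial>\<mu>) = complex_of_real (?v powi (- val \<alpha>)) *
      ((1 - X) * a * complex_of_real ?v powi n + c * (1 - complex_of_real ?v) * X powi (1 - n))"
    by (rule shell_integral[OF A1 A2 A3 A4 C v_par_pos v_par_less_1 X F1 F2])
qed

end

section \<open>Meromorphic continuation and the intertwining operator\<close>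

lemma spec_torus_upd: "z \<in> spec_torus r \<Longrightarrow> i < r \<Longrightarrow> t \<noteq> 0 \<Longrightarrow> z(i := t) \<in> spec_torus r"
  by (auto simp: spec_torus_def PiE_def Pi_def extensional_def)

lemma holomorphic_on_torus_const: "holomorphic_on_torus r (\<lambda>y. c)"
  by (simp add: holomorphic_on_torus_def)

lemma holomorphic_on_torus_coord: "holomorphic_on_torus r (\<lambda>y. y i)"
  unfolding holomorphic_on_torus_def
proof (intro conjI ballI allI impI)
  show "continuous_on (spec_torus r) (\<lambda>y. y i)"
    by (rule continuous_on_subset[OF continuous_on_product_coordinates subset_UNIV])
  fix z l
  show "(\<lambda>t. (z(l := t)) i) holomorphic_on - {0}"
    by (cases "l = i") (simp_all add: holomorphic_on_ident)
qed

lemma holomorphic_on_torus_add: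
  assumes "holomorphic_on_torus r f" "holomorphic_on_torus r g"
  shows "holomorphic_on_torus r (\<lambda>y. f y + g y)"
  unfolding holomorphic_on_torus_def
proof (intro conjI ballI allI impI)
  show "continuous_on (spec_torus r) (\<lambda>y. f y + g y)"
    using assms by (intro continuous_on_add) (simp_all add: holomorphic_on_torus_def)
  show "(\<lambda>t. f (z(i := t)) + g (z(i := t))) holomorphic_on - {0}" if "z \<in> spec_torus r" "i < r" for z i
    using assms that by (intro holomorphic_on_add) (simp_all add: holomorphic_on_torus_def)
qed

lemma holomorphic_on_torus_diff:
  assumes "holomorphic_on_torus r f" "holomorphic_on_torus r g"
  shows "holomorphic_on_torus r (\<lambda>y. f y - g y)"
  unfolding holomorphic_on_torus_def
proof (intro conjI ballI allI impI)
  show "continuous_on (spec_torus r) (\<lambda>y. f y - g y)"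
    using assms by (intro continuous_on_diff) (simp_all add: holomorphic_on_torus_def)
  show "(\<lambda>t. f (z(i := t)) - g (z(i := t))) holomorphic_on - {0}" if "z \<in> spec_torus r" "i < r" for z i
    using assms that by (intro holomorphic_on_diff) (simp_all add: holomorphic_on_torus_def)
qed

lemma holomorphic_on_torus_mult:
  assumes "holomorphic_on_torus r f" "holomorphic_on_torus r g"
  shows "holomorphic_on_torus r (\<lambda>y. f y * g y)"
  unfolding holomorphic_on_torus_def
proof (intro conjI ballI allI impI)
  show "continuous_on (spec_torus r) (\<lambda>y. f y * g y)"
    using assms by (intro continuous_on_mult) (simp_all add: holomorphic_on_torus_def)
  show "(\<lambda>t. f (z(i := t)) * g (z(i := t))) holomorphic_on - {0}" if "z \<in> spec_torus r" "i < r" for z i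
    using assms that by (intro holomorphic_on_mult) (simp_all add: holomorphic_on_torus_def)
qed

lemma holomorphic_on_torus_power_int:
  assumes "holomorphic_on_torus r f" "\<And>y. y \<in> spec_torus r \<Longrightarrow> f y \<noteq> 0"
  shows "holomorphic_on_torus r (\<lambda>y. f y powi n)"
  unfolding holomorphic_on_torus_def
proof (intro conjI ballI allI impI)
  show "continuous_on (spec_torus r) (\<lambda>y. f y powi n)"
    using assms by (intro continuous_on_power_int) (simp_all add: holomorphic_on_torus_def)
  show "(\<lambda>t. f (z(i := t)) powi n) holomorphic_on - {0}" if "z \<in> spec_torus r" "i < r" for z i
    using assms that by (intro holomorphic_on_power_int) (simp_all add: holomorphic_on_torus_def spec_torus_upd)
qed

lemma holomorphic_on_torus_prod:
  assumes "finite A" "\<And>i. i \<in> A \<Longrightarrow> holomorphic_on_torus r (f i)"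
  shows "holomorphic_on_torus r (\<lambda>y. \<Prod>i\<in>A. f i y)"
  using assms
proof (induction A rule: finite_induct)
  case empty
  then show ?case by (simp add: holomorphic_on_torus_const)
next
  case (insert a A)
  then have "holomorphic_on_torus r (\<lambda>y. f a y * (\<Prod>i\<in>A. f i y))"
    by (intro holomorphic_on_torus_mult) simp_all
  then show ?case using insert.hyps by simp
qed

lemma z_alpha_nonzero: "Suc k < r \<Longrightarrow> y \<in> spec_torus r \<Longrightarrow> z_alpha y k \<noteq> 0"
  using spec_torus_nonzero[of y r k] spec_torus_nonzero[of y r "Suc k"] by (simp add: z_alpha_def)

lemma holomorphic_on_torus_z_alpha:
  assumes "Suc k < r"
  shows "holomorphic_on_torus r (\<lambda>y. z_alpha y k)"
proof -
  have "z_alpha y k = y k * y (Suc k) powi (-1)" for y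
    by (simp add: z_alpha_def divide_inverse power_int_minus)
  then show ?thesis
    using spec_torus_nonzero[of _ r "Suc k"] assms
    by (simp only:) (intro holomorphic_on_torus_mult[of r "\<lambda>y. y k"]
        holomorphic_on_torus_power_int[of r "\<lambda>y. y (Suc k)"] holomorphic_on_torus_coord, simp)
qed

text \<open>Moving only the \<open>k\<close>-th coordinate of \<open>z\<close> already reaches the domain of
  convergence, so the one-variable identity theorem gives uniqueness of the continuation.\<close>

lemma mero_continuation_eq:
  assumes k: "Suc k < r" and z: "z \<in> spec_torus r"
    and \<Omega>: "\<And>y. y \<in> spec_torus r \<Longrightarrow> norm (z_alpha y k) < 1 \<Longrightarrow> y \<in> \<Omega>"
    and PQ: "holomorphic_on_torus r P" "holomorphic_on_torus r Q"
    and eq: "\<And>y. y \<in> \<Omega> \<Longrightarrow> Q y * h y = P y" and Qz: "Q z \<noteq> 0"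
  shows "mero_continuation r \<Omega> h z = P z / Q z"
  unfolding mero_continuation_def
proof (rule the_equality)
  show "\<exists>P' Q'. holomorphic_on_torus r P' \<and> holomorphic_on_torus r Q' \<and>
      (\<forall>y\<in>\<Omega>. Q' y * h y = P' y) \<and> Q' z \<noteq> 0 \<and> P z / Q z = P' z / Q' z"
    using assms by blast
next
  fix c assume "\<exists>P' Q'. holomorphic_on_torus r P' \<and> holomorphic_on_torus r Q' \<and>
      (\<forall>y\<in>\<Omega>. Q' y * h y = P' y) \<and> Q' z \<noteq> 0 \<and> c = P' z / Q' z"
  then obtain P' Q' where PQ': "holomorphic_on_torus r P'" "holomorphic_on_torus r Q'"
    "\<And>y. y \<in> \<Omega> \<Longrightarrow> Q' y * h y = P' y" "Q' z \<noteq> 0" "c = P' z / Q' z" by blast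
  have hol: "(\<lambda>s. f (z(k := s))) holomorphic_on - {0}" if "holomorphic_on_torus r f" for f
    using that z k by (simp add: holomorphic_on_torus_def)
  let ?t = "norm (z (Suc k))"
  have t: "?t > 0" using spec_torus_nonzero[OF z k] by simp
  have "P' (z(k := z k)) * Q (z(k := z k)) = P (z(k := z k)) * Q' (z(k := z k))"
  proof (rule analytic_continuation_open[where s = "ball 0 ?t - {0}" and s' = "- {0}"
        and f = "\<lambda>s. P' (z(k := s)) * Q (z(k := s))" and g = "\<lambda>s. P (z(k := s)) * Q' (z(k := s))"])
    show "ball (0::complex) ?t - {0} \<noteq> {}"
    proof -
      have "complex_of_real (?t / 2) \<in> ball 0 ?t - {0}" using t by (auto simp: norm_mult)
      then show ?thesis by blast
    qed
    show "connected (- {0::complex})" by (rule connected_punctured_universe) simp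
    show "P' (z(k := s)) * Q (z(k := s)) = P (z(k := s)) * Q' (z(k := s))" if s: "s \<in> ball 0 ?t - {0}" for s
    proof -
      let ?y = "z(k := s)"
      have "?y \<in> \<Omega>"
        using s k t z by (intro \<Omega> spec_torus_upd) (auto simp: z_alpha_def norm_divide)
      then have "Q ?y * h ?y = P ?y" "Q' ?y * h ?y = P' ?y" using eq PQ' by auto
      then show ?thesis by (metis mult.assoc mult.commute)
    qed
    show "(\<lambda>s. P' (z(k := s)) * Q (z(k := s))) holomorphic_on - {0}"
      "(\<lambda>s. P (z(k := s)) * Q' (z(k := s))) holomorphic_on - {0}"
      by (intro holomorphic_on_mult hol PQ PQ')+
  qed (use spec_torus_nonzero[OF z, of k] k in auto)
  then show "c = P z / Q z" unfolding PQ'(5) using Qz PQ'(4) by (simp add: frac_eq_eq)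
qed

context nonarch_local_field begin

lemma holomorphic_on_torus_delta_half_tau_refl:
  assumes k: "Suc k < r" and b: "b \<in> borel_B r"
  shows "holomorphic_on_torus r (\<lambda>y. delta_half_tau val r (weyl_act (simple_refl k) y) b)"
proof -
  have "sqrt (v_par val) \<noteq> 0" using v_par_pos by simp
  then show ?thesis
    unfolding delta_half_tau_eq[OF b] half_density_char_def weyl_act_refl
    using spec_torus_nonzero[of _ r] simple_refl_less[OF k]
    by (intro holomorphic_on_torus_prod holomorphic_on_torus_power_int holomorphic_on_torus_mult
        holomorphic_on_torus_const holomorphic_on_torus_coord) auto
qed

lemma intertwining_bruhat:
  fixes f :: "'a mat \<Rightarrow> complex" and \<mu> :: "'a mat measure"
  assumes k: "Suc k < r" and z: "z \<in> spec_torus r" and f: "f \<in> iwahori_fixed val r z"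
    and haar: "is_haar_measure val r (N_w r (simple_refl k)) \<mu>" and X1: "z_alpha z k \<noteq> 1"
    and b: "b \<in> borel_B r" and w: "w \<in> weyl r" and j: "j \<in> iwahori_J val r"
  shows "intertwining val r \<mu> (simple_refl k) z f (b * perm_mat r w * j) =
    delta_half_tau val r (weyl_act (simple_refl k) z) b *
      (f (perm_mat r (simple_refl k \<circ> w)) * complex_of_real (v_par val) powi ascent k w +
       f (perm_mat r w) * (1 - complex_of_real (v_par val)) * z_alpha z k powi (1 - ascent k w) / (1 - z_alpha z k))"
proof -
  let ?s = "simple_refl k" and ?v = "complex_of_real (v_par val)"
  let ?F = "\<lambda>y g n. flat_section val r f y (perm_mat r (winv ?s) * n * g)"
  let ?\<Omega> = "{y \<in> spec_torus r. \<forall>g\<in>GL r. integrable \<mu> (?F y g)}"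
  let ?P = "\<lambda>y b w. delta_half_tau val r (weyl_act ?s y) b *
      ((1 - z_alpha y k) * (f (perm_mat r (?s \<circ> w)) * ?v powi ascent k w) +
       f (perm_mat r w) * (1 - ?v) * z_alpha y k powi (1 - ascent k w))"
  have main: "(norm (z_alpha y k) < 1 \<longrightarrow> integrable \<mu> (?F y (b * perm_mat r w * j))) \<and>
      (integrable \<mu> (?F y (b * perm_mat r w * j)) \<longrightarrow>
        (1 - z_alpha y k) * (\<integral>n. ?F y (b * perm_mat r w * j) n \<partial>\<mu>) = ?P y b w)"
    if y: "y \<in> spec_torus r" and b: "b \<in> borel_B r" and w: "w \<in> weyl r" and j: "j \<in> iwahori_J val r" for y b w j
  proof -
    let ?\<alpha> = "b $$ (Suc k, Suc k) / b $$ (k, k)" and ?\<beta> = "b $$ (k, Suc k) / b $$ (k, k)"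
    let ?D = "delta_half_tau val r (weyl_act ?s y) b * complex_of_real (v_par val powi val ?\<alpha>)"
    have \<alpha>: "?\<alpha> \<noteq> 0" using b k by (simp add: borel_diag)
    have F: "?F y (b * perm_mat r w * j) (root_elt r k x) =
      (if ?\<alpha> * x + ?\<beta> \<in> p_power val (ascent k w) then ?D * f (perm_mat r (?s \<circ> w))
       else (?v * z_alpha y k) powi (- val (?\<alpha> * x + ?\<beta>)) * (?D * f (perm_mat r w)))" for x
      using flat_section_refl_root_elt[OF k y f b w j, of x] by simp
    have inv: "complex_of_real (v_par val powi (- val ?\<alpha>)) * complex_of_real (v_par val powi val ?\<alpha>) = 1"
      using v_par_pos by (simp add: power_int_minus)
    have alg: "A * (x * (D * E * p) * s + D * E * q * u * t) = D * (x * (p * s) + q * u * t)"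
      if "A * E = 1" for A E D p q s t u x :: complex
    proof -
      have "A * (x * (D * E * p) * s + D * E * q * u * t) = (A * E) * (D * (x * (p * s) + q * u * t))"
        by (simp add: algebra_simps)
      then show ?thesis using that by simp
    qed
    show ?thesis
    proof (intro conjI impI)
      assume "norm (z_alpha y k) < 1"
      then show "integrable \<mu> (?F y (b * perm_mat r w * j))"
        by (rule root_integrable[OF k haar \<alpha> z_alpha_nonzero[OF k y] F])
    next
      assume "integrable \<mu> (?F y (b * perm_mat r w * j))"
      from trans[OF root_integral[OF k haar \<alpha> z_alpha_nonzero[OF k y] F this] alg[OF inv]]
      show "(1 - z_alpha y k) * (\<integral>n. ?F y (b * perm_mat r w * j) n \<partial>\<mu>) = ?P y b w" .
    qed
  qed
  have g: "b * perm_mat r w * j \<in> GL r" using b w j by (simp add: GL_mult borel_GL perm_mat_GL J_GL)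
  have "mero_continuation r ?\<Omega> (\<lambda>y. \<integral>n. ?F y (b * perm_mat r w * j) n \<partial>\<mu>) z = ?P z b w / (1 - z_alpha z k)"
  proof (rule mero_continuation_eq[OF k z, where P = "\<lambda>y. ?P y b w" and Q = "\<lambda>y. 1 - z_alpha y k"])
    fix y assume y: "y \<in> spec_torus r" "norm (z_alpha y k) < 1"
    have "integrable \<mu> (?F y g)" if "g \<in> GL r" for g
    proof -
      obtain b' w' j' where "b' \<in> borel_B r" "w' \<in> weyl r" "j' \<in> iwahori_J val r" "g = b' * perm_mat r w' * j'"
        using \<open>g \<in> GL r\<close> by (rule iwahori_bruhat)
      then show ?thesis using main[OF y(1), of b' w' j'] y(2) by simp
    qed
    then show "y \<in> ?\<Omega>" using y by blast
  next
    show "holomorphic_on_torus r (\<lambda>y. ?P y b w)"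
      using k b z_alpha_nonzero[OF k]
      by (intro holomorphic_on_torus_mult holomorphic_on_torus_add holomorphic_on_torus_diff
          holomorphic_on_torus_const holomorphic_on_torus_power_int holomorphic_on_torus_z_alpha
          holomorphic_on_torus_delta_half_tau_refl)
    show "holomorphic_on_torus r (\<lambda>y. 1 - z_alpha y k)"
      using k by (intro holomorphic_on_torus_diff holomorphic_on_torus_const holomorphic_on_torus_z_alpha)
  next
    fix y assume "y \<in> ?\<Omega>"
    then show "(1 - z_alpha y k) * (\<integral>n. ?F y (b * perm_mat r w * j) n \<partial>\<mu>) = ?P y b w"
      using main[of y b w j] b w j g by blast
  qed (use X1 in simp)
  then show ?thesis using g X1 by (simp add: intertwining_def field_simps)
qed

definition norm_intertwining_coeff :: "nat \<Rightarrow> nat \<Rightarrow> complex \<Rightarrow> ('a mat \<Rightarrow> complex) \<Rightarrow> (nat \<Rightarrow> nat) \<Rightarrow> complex" where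
  "norm_intertwining_coeff r k x f w =
    (let v = complex_of_real (v_par val) in
     if winv w k < winv w (Suc k)
     then v * (1 - x) / (1 - v * x) * f (perm_mat r (simple_refl k \<circ> w)) + (1 - v) / (1 - v * x) * f (perm_mat r w)
     else (1 - x) / (1 - v * x) * f (perm_mat r (simple_refl k \<circ> w)) + (1 - v) * x / (1 - v * x) * f (perm_mat r w))"

lemma
  fixes f :: "'a mat \<Rightarrow> complex" and \<mu> :: "'a mat measure"
  assumes k: "Suc k < r" and z: "z \<in> spec_torus r" and f: "f \<in> iwahori_fixed val r z"
    and haar: "is_haar_measure val r (N_w r (simple_refl k)) \<mu>"
    and X: "z_alpha z k \<noteq> 1"
  shows norm_intertwining_perm: "w \<in> weyl r \<Longrightarrow>
      norm_intertwining val r \<mu> k z f (perm_mat r w) = norm_intertwining_coeff r k (z_alpha z k) f w"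
    and norm_intertwining_fixed:
      "norm_intertwining val r \<mu> k z f \<in> iwahori_fixed val r (weyl_act (simple_refl k) z)"
proof -
  let ?s = "simple_refl k" and ?v = "complex_of_real (v_par val)" and ?x = "z_alpha z k"
  have bwj: "norm_intertwining val r \<mu> k z f (b * perm_mat r w * j) =
      delta_half_tau val r (weyl_act ?s z) b * norm_intertwining_coeff r k ?x f w"
    if "b \<in> borel_B r" "w \<in> weyl r" "j \<in> iwahori_J val r" for b w j
  proof -
    have cancel: "(1 - ?x) / u * (D * (p * s + t / (1 - ?x))) = D * ((1 - ?x) * s / u * p + t / u)" for u D p s t
      using X by (cases "u = 0") (simp_all add: field_simps)
    show ?thesis
      unfolding norm_intertwining_def intertwining_bruhat[OF k z f haar X that] cancel
      by (simp add: norm_intertwining_coeff_def Let_def ascent_def mult_ac)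
  qed
  have one: "1\<^sub>m r \<in> borel_B r" by (intro borelI) auto
  show perm: "norm_intertwining val r \<mu> k z f (perm_mat r w) = norm_intertwining_coeff r k ?x f w"
    if "w \<in> weyl r" for w
  proof -
    have "1\<^sub>m r * perm_mat r w * 1\<^sub>m r = (perm_mat r w :: 'a mat)"
      by (simp only: left_mult_one_mat[OF perm_mat_carrier] right_mult_one_mat[OF perm_mat_carrier])
    then show ?thesis
      using bwj[OF one that J_one] delta_half_tau_int[OF one J_GL_int[OF J_one]] by simp
  qed
  show "norm_intertwining val r \<mu> k z f \<in> iwahori_fixed val r (weyl_act ?s z)"
  proof (rule iwahori_fixedI[OF weyl_act_refl_torus[OF k z]])
    show "norm_intertwining val r \<mu> k z f g = 0" if "g \<notin> GL r" for g
      using that by (simp add: norm_intertwining_def intertwining_def)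
  qed (simp add: bwj perm)
qed

end

section \<open>Tensors and R-matrices\<close>

lemma lookup_smul [simp]: "Poly_Mapping.lookup (smul c t) x = c * Poly_Mapping.lookup t x"
  by (simp add: smul_def Poly_Mapping.map.rep_eq when_def)

lemma smul_add: "smul c (s + t) = smul c s + smul c t"
  by (rule poly_mapping_eqI) (simp add: lookup_add algebra_simps)

lemma smul_add_left: "smul (c + d) t = smul c t + smul d t"
  by (rule poly_mapping_eqI) (simp add: lookup_add algebra_simps)

lemma smul_smul [simp]: "smul c (smul d t) = smul (c * d) t"
  by (rule poly_mapping_eqI) simp

lemma smul_zero [simp]: "smul c 0 = 0" "smul 0 t = 0"
  by (rule poly_mapping_eqI, simp)+

lemma smul_one [simp]: "smul 1 t = t"
  by (rule poly_mapping_eqI) simp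

lemma smul_sum: "smul c (\<Sum>i\<in>A. f i) = (\<Sum>i\<in>A. smul c (f i))"
  by (induction A rule: infinite_finite_induct) (simp_all add: smul_add)

definition tensor_linear :: "(tensor \<Rightarrow> tensor) \<Rightarrow> bool" where
  "tensor_linear T \<longleftrightarrow> (\<forall>s t. T (s + t) = T s + T t) \<and> (\<forall>c t. T (smul c t) = smul c (T t))"

lemma tensor_linear_combination:
  assumes "tensor_linear T"
  shows "T (\<Sum>i\<in>A. smul (c i) (t i)) = (\<Sum>i\<in>A. smul (c i) (T (t i)))"
proof -
  have "T 0 = 0" using assms unfolding tensor_linear_def by (metis smul_zero(2))
  then show ?thesis
    using assms by (induction A rule: infinite_finite_induct) (simp_all add: tensor_linear_def)
qed

lemma tensor_linear_add: "tensor_linear S \<Longrightarrow> tensor_linear T \<Longrightarrow> tensor_linear (\<lambda>t. S t + T t)"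
  by (simp add: tensor_linear_def smul_add add_ac)

lemma tensor_linear_smul: "tensor_linear T \<Longrightarrow> tensor_linear (\<lambda>t. smul c (T t))"
  by (simp add: tensor_linear_def smul_add mult.commute)

lemma tensor_linear_sum: "(\<And>i. i \<in> A \<Longrightarrow> tensor_linear (T i)) \<Longrightarrow> tensor_linear (\<lambda>t. \<Sum>i\<in>A. T i t)"
  by (simp add: tensor_linear_def smul_sum sum.distrib)

lemma linear_ext_superset:
  assumes "finite S" "Poly_Mapping.keys t \<subseteq> S"
  shows "linear_ext f t = (\<Sum>bs\<in>S. smul (Poly_Mapping.lookup t bs) (f bs))"
  unfolding linear_ext_def using assms by (intro sum.mono_neutral_left) (auto simp: in_keys_iff)

lemma linear_ext_linear: "tensor_linear (linear_ext f)"
proof -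
  have "linear_ext f (s + t) = linear_ext f s + linear_ext f t" for s t
  proof -
    let ?S = "Poly_Mapping.keys s \<union> Poly_Mapping.keys t"
    have "linear_ext f (s + t) = (\<Sum>bs\<in>?S. smul (Poly_Mapping.lookup (s + t) bs) (f bs))"
      by (intro linear_ext_superset) (auto dest: set_mp[OF Poly_Mapping.keys_add])
    also have "\<dots> = (\<Sum>bs\<in>?S. smul (Poly_Mapping.lookup s bs) (f bs)) + (\<Sum>bs\<in>?S. smul (Poly_Mapping.lookup t bs) (f bs))"
      by (simp add: lookup_add smul_add_left sum.distrib)
    also have "\<dots> = linear_ext f s + linear_ext f t"
      by (subst (1 2) linear_ext_superset[where S = ?S]) auto
    finally show ?thesis .
  qed
  moreover have "linear_ext f (smul c t) = smul c (linear_ext f t)" for c t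
  proof -
    have "linear_ext f (smul c t) = (\<Sum>bs\<in>Poly_Mapping.keys t. smul (Poly_Mapping.lookup (smul c t) bs) (f bs))"
      by (intro linear_ext_superset) (auto simp: in_keys_iff)
    then show ?thesis by (simp add: linear_ext_def smul_sum)
  qed
  ultimately show ?thesis by (simp add: tensor_linear_def)
qed

lemma linear_ext_single: "linear_ext f (Poly_Mapping.single bs 1) = f bs"
  by (simp add: linear_ext_def)

lemma unit_pair_linear: "tensor_linear (unit_pair k i j l m)"
  unfolding unit_pair_def by (rule linear_ext_linear)

lemma R_col_linear: "tensor_linear (R_col r v k x)"
  unfolding R_col_def
  by (intro tensor_linear_add tensor_linear_sum tensor_linear_smul unit_pair_linear)

lemma R_q_linear: "tensor_linear (R_q r q k x)"
  unfolding R_q_def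
  by (intro tensor_linear_add tensor_linear_sum tensor_linear_smul unit_pair_linear)

lemma basis_tensor_cong: "(\<And>i. i < r \<Longrightarrow> p i = p' i) \<Longrightarrow> basis_tensor F r z p = basis_tensor F r z p'"
  unfolding basis_tensor_def by (intro arg_cong2[of _ _ _ _ Poly_Mapping.single] map_cong) auto

lemma unit_pair_basis:
  assumes k: "Suc k < r"
  shows "unit_pair k i j l m (basis_tensor F r z p) =
    (if p k = j \<and> p (Suc k) = m
     then basis_tensor F r (weyl_act (simple_refl k) z) (p(k := i, Suc k := l)) else 0)"
proof -
  let ?bs = "map (\<lambda>m. EvB F (p m) (z m)) [0..<r]"
  have n: "?bs ! k = EvB F (p k) (z k)" "?bs ! Suc k = EvB F (p (Suc k)) (z (Suc k))"
    using k by (simp_all del: upt_Suc)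
  have "?bs[k := EvB F i (z (Suc k)), Suc k := EvB F l (z k)] =
      map (\<lambda>m. EvB F ((p(k := i, Suc k := l)) m) (weyl_act (simple_refl k) z m)) [0..<r]"
  proof (rule nth_equalityI)
    fix a assume "a < length (?bs[k := EvB F i (z (Suc k)), Suc k := EvB F l (z k)])"
    then have "a < r" by simp
    then show "?bs[k := EvB F i (z (Suc k)), Suc k := EvB F l (z k)] ! a =
      map (\<lambda>m. EvB F ((p(k := i, Suc k := l)) m) (weyl_act (simple_refl k) z m)) [0..<r] ! a"
      by (cases "a = k"; cases "a = Suc k") (auto simp: nth_list_update weyl_act_refl simple_refl_simps)
  qed simp
  then show ?thesis
    unfolding unit_pair_def basis_tensor_def linear_ext_single n by simp
qed

lemma double_sum_single:
  fixes T :: "nat \<Rightarrow> nat \<Rightarrow> 'b::comm_monoid_add"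
  assumes "b < r"
  shows "(\<Sum>i<r. \<Sum>j<i. if a = j \<and> b = i then T i j else 0) = (if a < b then T b a else 0)"
proof -
  have "(\<Sum>j<i. if a = j \<and> b = i then T i j else 0) = (if i = b then (if a < b then T b a else 0) else 0)" for i
    by (cases "b = i") auto
  then show ?thesis using assms by simp
qed

lemma unit_pair_double_sum:
  fixes z :: "nat \<Rightarrow> complex" and F :: ev_family
  assumes k: "Suc k < r" and p: "p k < r" "p (Suc k) < r" "p k \<noteq> p (Suc k)"
  defines "t \<equiv> basis_tensor F r z p"
    and "sw \<equiv> basis_tensor F r (weyl_act (simple_refl k) z) (p \<circ> simple_refl k)"
    and "sm \<equiv> basis_tensor F r (weyl_act (simple_refl k) z) p"
  shows "(\<Sum>i<r. \<Sum>j<i. smul c1 (unit_pair k i j j i t)) = (if p k < p (Suc k) then smul c1 sw else 0)"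
    and "(\<Sum>i<r. \<Sum>j<i. smul c1 (unit_pair k j i i j t)) = (if p k < p (Suc k) then 0 else smul c1 sw)"
    and "(\<Sum>i<r. \<Sum>j<i. smul c1 (unit_pair k j j i i t)) = (if p k < p (Suc k) then smul c1 sm else 0)"
    and "(\<Sum>i<r. \<Sum>j<i. smul c1 (unit_pair k i i j j t)) = (if p k < p (Suc k) then 0 else smul c1 sm)"
    and "(\<Sum>i<r. smul c1 (unit_pair k i i i i t)) = 0"
proof -
  let ?B = "\<lambda>i j. basis_tensor F r (weyl_act (simple_refl k) z) (p(k := i, Suc k := j))"
  have sw: "?B (p (Suc k)) (p k) = sw" and sm: "?B (p k) (p (Suc k)) = sm"
    unfolding sw_def sm_def by (auto simp: simple_refl_simps intro!: basis_tensor_cong)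
  note [simp] = sw
  have "(\<Sum>i<r. \<Sum>j<i. smul c1 (unit_pair k i j j i t)) =
      (\<Sum>i<r. \<Sum>j<i. if p k = j \<and> p (Suc k) = i then smul c1 (?B i j) else 0)"
    unfolding t_def by (intro sum.cong refl) (simp add: unit_pair_basis[OF k])
  then show "(\<Sum>i<r. \<Sum>j<i. smul c1 (unit_pair k i j j i t)) = (if p k < p (Suc k) then smul c1 sw else 0)"
    using double_sum_single[OF p(2), of "p k" "\<lambda>i j. smul c1 (?B i j)"] by simp
  have "(\<Sum>i<r. \<Sum>j<i. smul c1 (unit_pair k j i i j t)) =
      (\<Sum>i<r. \<Sum>j<i. if p (Suc k) = j \<and> p k = i then smul c1 (?B j i) else 0)"
    unfolding t_def by (intro sum.cong refl) (simp add: unit_pair_basis[OF k])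
  then show "(\<Sum>i<r. \<Sum>j<i. smul c1 (unit_pair k j i i j t)) = (if p k < p (Suc k) then 0 else smul c1 sw)"
    using double_sum_single[OF p(1), of "p (Suc k)" "\<lambda>i j. smul c1 (?B j i)"] p(3) by auto
  have "(\<Sum>i<r. \<Sum>j<i. smul c1 (unit_pair k j j i i t)) =
      (\<Sum>i<r. \<Sum>j<i. if p k = j \<and> p (Suc k) = i then smul c1 (?B j i) else 0)"
    unfolding t_def by (intro sum.cong refl) (simp add: unit_pair_basis[OF k])
  then show "(\<Sum>i<r. \<Sum>j<i. smul c1 (unit_pair k j j i i t)) = (if p k < p (Suc k) then smul c1 sm else 0)"
    using double_sum_single[OF p(2), of "p k" "\<lambda>i j. smul c1 (?B j i)"] by (simp add: sm_def)
  have "(\<Sum>i<r. \<Sum>j<i. smul c1 (unit_pair k i i j j t)) =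
      (\<Sum>i<r. \<Sum>j<i. if p (Suc k) = j \<and> p k = i then smul c1 (?B i j) else 0)"
    unfolding t_def by (intro sum.cong refl) (simp add: unit_pair_basis[OF k])
  then show "(\<Sum>i<r. \<Sum>j<i. smul c1 (unit_pair k i i j j t)) = (if p k < p (Suc k) then 0 else smul c1 sm)"
    using double_sum_single[OF p(1), of "p (Suc k)" "\<lambda>i j. smul c1 (?B i j)"] p(3) by (auto simp: sm_def)
  show "(\<Sum>i<r. smul c1 (unit_pair k i i i i t)) = 0"
    unfolding t_def using p(3) by (intro sum.neutral) (auto simp: unit_pair_basis[OF k])
qed

definition R_swap :: "complex \<Rightarrow> complex \<Rightarrow> bool \<Rightarrow> complex" where
  "R_swap v x up = (if up then (1 - x) / (1 - v * x) else v * (1 - x) / (1 - v * x))"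

definition R_same :: "complex \<Rightarrow> complex \<Rightarrow> bool \<Rightarrow> complex" where
  "R_same v x up = (if up then (1 - v) / (1 - v * x) else (1 - v) * x / (1 - v * x))"

lemma R_col_basis:
  assumes k: "Suc k < r" and p: "p k < r" "p (Suc k) < r" "p k \<noteq> p (Suc k)"
  shows "R_col r v k x (basis_tensor F r z p) =
    smul (R_swap v x (p k < p (Suc k))) (basis_tensor F r (weyl_act (simple_refl k) z) (p \<circ> simple_refl k)) +
    smul (R_same v x (p k < p (Suc k))) (basis_tensor F r (weyl_act (simple_refl k) z) p)"
  using unit_pair_double_sum(5)[OF assms, of 1 F z]
  by (simp add: R_col_def sum.distrib unit_pair_double_sum(1-4)[OF assms] R_swap_def R_same_def)

lemma R_q_basis:
  assumes k: "Suc k < r" and p: "p k < r" "p (Suc k) < r" "p k \<noteq> p (Suc k)" and q: "q \<noteq> 0"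
  shows "smul (- q) (R_q r q k x (basis_tensor F r z p)) =
    smul (R_swap (q\<^sup>2) x (p k < p (Suc k))) (basis_tensor F r (weyl_act (simple_refl k) z) (p \<circ> simple_refl k)) +
    smul (R_same (q\<^sup>2) x (p k < p (Suc k))) (basis_tensor F r (weyl_act (simple_refl k) z) p)"
proof -
  have "- q * (1 / d) * (- inverse q * (1 - x)) = (1 - x) / d"
    "- q * (1 / d) * (- q * (1 - x)) = q\<^sup>2 * (1 - x) / d"
    "- q * (1 / d) * (q - inverse q) = (1 - q\<^sup>2) / d"
    "- q * (1 / d) * (x * (q - inverse q)) = (1 - q\<^sup>2) * x / d" for d
    using q by (cases "d = 0"; simp add: field_simps power2_eq_square)+
  then show ?thesis
    unfolding R_q_def sum.distrib unit_pair_double_sum[OF assms(1-4)]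
    by (simp only: add_0_left smul_smul smul_add R_swap_def R_same_def if_distrib[of "smul _"] smul_zero mult.assoc split: if_split) simp
qed

definition weyl_sum :: "ev_family \<Rightarrow> nat \<Rightarrow> (nat \<Rightarrow> complex) \<Rightarrow> ((nat \<Rightarrow> nat) \<Rightarrow> complex) \<Rightarrow> tensor" where
  "weyl_sum F r z c = (\<Sum>w\<in>weyl r. smul (c w) (basis_tensor F r z (w_i0 w)))"

lemma winv_winv: "w \<in> weyl r \<Longrightarrow> winv (winv w) = w"
  unfolding weyl_def by (simp add: permutes_inv_inv)

lemma alt_space_weyl_sum: "alt_space F r z = range (weyl_sum F r z)"
proof -
  have eq: "(\<Sum>p\<in>weyl r. smul (c p) (basis_tensor F r z p)) = weyl_sum F r z (\<lambda>w. c (winv w))" for c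
    unfolding weyl_sum_def w_i0_def
    by (rule sum.reindex_bij_witness[of _ winv winv]) (simp_all add: winv_weyl winv_winv)
  have eq': "weyl_sum F r z c = weyl_sum F r z (\<lambda>w. c (winv (winv w)))" for c
    unfolding weyl_sum_def by (intro sum.cong refl) (simp add: winv_winv)
  show ?thesis
  proof (intro equalityI subsetI)
    fix t assume "t \<in> alt_space F r z"
    then show "t \<in> range (weyl_sum F r z)" unfolding alt_space_def eq by blast
  next
    fix t assume "t \<in> range (weyl_sum F r z)"
    then obtain c where "t = weyl_sum F r z c" by blast
    then show "t \<in> alt_space F r z"
      unfolding alt_space_def eq by (auto intro!: exI[of _ "\<lambda>p. c (winv p)"] simp: eq'[symmetric])
  qed
qed

lemma basis_tensor_inj:
  assumes "w \<in> weyl r" "w' \<in> weyl r"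
    and "map (\<lambda>m. EvB F (winv w m) (z m)) [0..<r] = map (\<lambda>m. EvB F (winv w' m) (z m)) [0..<r]"
  shows "w = w'"
proof -
  have "winv w m = winv w' m" for m
  proof (cases "m < r")
    case True
    then show ?thesis using assms(3) by (auto simp: map_eq_conv)
  next
    case False
    then show ?thesis using winv_weyl[OF assms(1)] winv_weyl[OF assms(2)] by (simp add: weyl_def permutes_not_in)
  qed
  then have "winv w = winv w'" by blast
  then show ?thesis using winv_winv[OF assms(1)] winv_winv[OF assms(2)] by metis
qed

lemma lookup_weyl_sum:
  assumes "w \<in> weyl r"
  shows "Poly_Mapping.lookup (weyl_sum F r z c) (map (\<lambda>m. EvB F (winv w m) (z m)) [0..<r]) = c w"
proof -
  have "Poly_Mapping.lookup (weyl_sum F r z c) (map (\<lambda>m. EvB F (winv w m) (z m)) [0..<r]) =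
      (\<Sum>w'\<in>weyl r. if w' = w then c w else 0)"
    unfolding weyl_sum_def lookup_sum basis_tensor_def w_i0_def
    using basis_tensor_inj[OF _ assms] by (intro sum.cong) (auto simp: lookup_single when_def)
  then show ?thesis using assms by (simp add: finite_weyl)
qed

lemma xi_weyl_sum: "xi r z (weyl_sum U_fam r z c) = weyl_sum V_fam r z c"
  unfolding xi_def weyl_sum_def[symmetric]
proof (rule the_equality)
  show "\<exists>d. weyl_sum U_fam r z c = weyl_sum U_fam r z d \<and> weyl_sum V_fam r z c = weyl_sum V_fam r z d"
    by blast
next
  fix t assume "\<exists>d. weyl_sum U_fam r z c = weyl_sum U_fam r z d \<and> t = weyl_sum V_fam r z d"
  then obtain d where d: "weyl_sum U_fam r z c = weyl_sum U_fam r z d" "t = weyl_sum V_fam r z d" by blast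
  have "c w = d w" if "w \<in> weyl r" for w
    using lookup_weyl_sum[OF that, of U_fam z c] lookup_weyl_sum[OF that, of U_fam z d] d(1) by simp
  then show "t = weyl_sum V_fam r z c" unfolding d(2) weyl_sum_def by (intro sum.cong) auto
qed

definition R_coeff :: "nat \<Rightarrow> complex \<Rightarrow> complex \<Rightarrow> ((nat \<Rightarrow> nat) \<Rightarrow> complex) \<Rightarrow> (nat \<Rightarrow> nat) \<Rightarrow> complex" where
  "R_coeff k v x c w =
    R_swap v x (\<not> winv w k < winv w (Suc k)) * c (simple_refl k \<circ> w) + R_same v x (winv w k < winv w (Suc k)) * c w"

lemma linear_weyl_sum:
  assumes k: "Suc k < r" and T: "tensor_linear T"
    and basis: "\<And>p. p k < r \<Longrightarrow> p (Suc k) < r \<Longrightarrow> p k \<noteq> p (Suc k) \<Longrightarrow> T (basis_tensor F r z p) =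
      smul (R_swap v x (p k < p (Suc k))) (basis_tensor F r (weyl_act (simple_refl k) z) (p \<circ> simple_refl k)) +
      smul (R_same v x (p k < p (Suc k))) (basis_tensor F r (weyl_act (simple_refl k) z) p)"
  shows "T (weyl_sum F r z c) = weyl_sum F r (weyl_act (simple_refl k) z) (R_coeff k v x c)"
proof -
  let ?s = "simple_refl k" and ?up = "\<lambda>w. winv w k < winv w (Suc k)"
  let ?B = "\<lambda>w. basis_tensor F r (weyl_act ?s z) (winv w)"
  have s: "?s \<in> weyl r" using k by (rule simple_refl_weyl)
  have "T (weyl_sum F r z c) = (\<Sum>w\<in>weyl r. smul (c w) (T (basis_tensor F r z (winv w))))"
    unfolding weyl_sum_def w_i0_def by (rule tensor_linear_combination[OF T])
  also have "\<dots> = (\<Sum>w\<in>weyl r. smul (c w * R_swap v x (?up w)) (?B (?s \<circ> w)) + smul (c w * R_same v x (?up w)) (?B w))"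
  proof (intro sum.cong refl)
    fix w assume w: "w \<in> weyl r"
    show "smul (c w) (T (basis_tensor F r z (winv w))) =
      smul (c w * R_swap v x (?up w)) (?B (?s \<circ> w)) + smul (c w * R_same v x (?up w)) (?B w)"
      using k w winv_eq_iff[OF w, of k "winv w (Suc k)"] winv_eq_iff[OF w, of "Suc k" "winv w (Suc k)"]
      by (subst basis) (auto simp: weyl_less winv_weyl smul_add winv_refl_comp)
  qed
  also have "\<dots> = (\<Sum>w\<in>weyl r. smul (c w * R_swap v x (?up w)) (?B (?s \<circ> w))) + (\<Sum>w\<in>weyl r. smul (c w * R_same v x (?up w)) (?B w))"
    by (rule sum.distrib)
  also have "(\<Sum>w\<in>weyl r. smul (c w * R_swap v x (?up w)) (?B (?s \<circ> w))) =
      (\<Sum>w\<in>weyl r. smul (c (?s \<circ> w) * R_swap v x (\<not> ?up w)) (?B w))"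
  proof (rule sum.reindex_bij_witness[of _ "\<lambda>w. ?s \<circ> w" "\<lambda>w. ?s \<circ> w"])
    fix w assume w: "w \<in> weyl r"
    show "?s \<circ> (?s \<circ> w) = w" by (rule simple_refl_comp_invol)
    then show "?s \<circ> (?s \<circ> w) = w" .
    show "?s \<circ> w \<in> weyl r" using s w by (rule weyl_comp)
    then show "?s \<circ> w \<in> weyl r" .
    have "\<not> ?up (?s \<circ> w) \<longleftrightarrow> ?up w"
      using k w winv_eq_iff[OF w, of k "winv w (Suc k)"] winv_eq_iff[OF w, of "Suc k" "winv w (Suc k)"]
      by (auto simp: winv_refl_comp simple_refl_simps)
    then show "smul (c (?s \<circ> (?s \<circ> w)) * R_swap v x (\<not> ?up (?s \<circ> w))) (?B (?s \<circ> w)) =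
        smul (c w * R_swap v x (?up w)) (?B (?s \<circ> w))"
      by (simp only: simple_refl_comp_invol)
  qed
  finally show ?thesis
    by (simp add: weyl_sum_def w_i0_def R_coeff_def smul_add_left sum.distrib mult.commute)
qed

context nonarch_local_field begin

lemma theta_weyl_sum:
  fixes f :: "'a mat \<Rightarrow> complex"
  assumes z: "z \<in> spec_torus r" and f: "f \<in> iwahori_fixed val r z"
  shows "theta val r z f = weyl_sum U_fam r z (\<lambda>w. f (perm_mat r w))"
  unfolding theta_def weyl_sum_def[symmetric]
proof (rule the_equality)
  show "\<exists>c. (\<forall>g. f g = (\<Sum>w\<in>weyl r. c w * Phi val r z w g)) \<and>
      weyl_sum U_fam r z (\<lambda>w. f (perm_mat r w)) = weyl_sum U_fam r z c"
    by (intro exI[of _ "\<lambda>w. f (perm_mat r w)"] conjI allI refl) (rule iwahori_fixed_expansion[OF z f])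
next
  fix u assume "\<exists>c. (\<forall>g. f g = (\<Sum>w\<in>weyl r. c w * Phi val r z w g)) \<and> u = weyl_sum U_fam r z c"
  then obtain c where c: "\<And>g. f g = (\<Sum>w\<in>weyl r. c w * Phi val r z w g)" "u = weyl_sum U_fam r z c" by blast
  have one: "1\<^sub>m r \<in> borel_B r" by (intro borelI) auto
  have "f (perm_mat r w) = c w" if w: "w \<in> weyl r" for w
  proof -
    have "1\<^sub>m r * perm_mat r w * 1\<^sub>m r = (perm_mat r w :: 'a mat)"
      by (simp only: left_mult_one_mat[OF perm_mat_carrier] right_mult_one_mat[OF perm_mat_carrier])
    then have "Phi val r z u (perm_mat r w) = (if u = w then 1 else 0)" if "u \<in> weyl r" for u
      using Phi_bruhat[OF z one that w J_one] delta_half_tau_int[OF one J_GL_int[OF J_one]] by simp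
    then have "f (perm_mat r w) = (\<Sum>u\<in>weyl r. if u = w then c w else 0)"
      unfolding c(1) by (intro sum.cong) auto
    then show ?thesis using w by (simp add: finite_weyl)
  qed
  then show "u = weyl_sum U_fam r z (\<lambda>w. f (perm_mat r w))"
    unfolding c(2) weyl_sum_def by (intro sum.cong) auto
qed

lemma norm_intertwining_R_coeff:
  "norm_intertwining_coeff r k x f w =
    R_coeff k (complex_of_real (v_par val)) x (\<lambda>w. f (perm_mat r w)) w"
  by (simp add: norm_intertwining_coeff_def R_coeff_def R_swap_def R_same_def Let_def)

end

theorem theorem10p5:
  fixes val :: "'a::field \<Rightarrow> int" and r k :: nat and q v :: complex
    and z :: "nat \<Rightarrow> complex" and \<mu> :: "'a mat measure"
  assumes "nonarch_local_field val"
    and "v = complex_of_real (v_par val)"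
    and "q \<noteq> 0" and "q\<^sup>2 = v"
    and "Suc k < r"
    and "z \<in> spec_torus r"
    and "\<forall>a<r. \<forall>b<r. a \<noteq> b \<longrightarrow> z a / z b \<notin> {1, v, inverse v}"
    and "is_haar_measure val r (N_w r (simple_refl k)) \<mu>"
  shows "commutative_square
           (iwahori_fixed val r z) (alt_space U_fam r z)
           (iwahori_fixed val r (weyl_act (simple_refl k) z))
           (alt_space U_fam r (weyl_act (simple_refl k) z))
           (theta val r z)
           (norm_intertwining val r \<mu> k z)
           (R_col r v k (z_alpha z k))
           (theta val r (weyl_act (simple_refl k) z))
       \<and> commutative_square
           (alt_space U_fam r z) (alt_space V_fam r z)
           (alt_space U_fam r (weyl_act (simple_refl k) z))
           (alt_space V_fam r (weyl_act (simple_refl k) z))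
           (xi r z)
           (R_col r v k (z_alpha z k))
           (\<lambda>t. smul (- q) (R_q r q k (z_alpha z k) t))
           (xi r (weyl_act (simple_refl k) z))"
proof -
  interpret nonarch_local_field val by fact
  let ?sz = "weyl_act (simple_refl k) z" and ?x = "z_alpha z k"
  note k = \<open>Suc k < r\<close> and z = \<open>z \<in> spec_torus r\<close>
  have sz: "?sz \<in> spec_torus r" using k z by (rule weyl_act_refl_torus)
  have X: "?x \<noteq> 1"
    using assms(7)[rule_format, of k "Suc k"] k by (simp add: z_alpha_def)
  have col: "R_col r v k ?x (weyl_sum F r z c) = weyl_sum F r ?sz (R_coeff k v ?x c)" for F c
    using k by (rule linear_weyl_sum[OF _ R_col_linear]) (rule R_col_basis[OF k])
  have Rq: "smul (- q) (R_q r q k ?x (weyl_sum F r z c)) = weyl_sum F r ?sz (R_coeff k v ?x c)" for F c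
    using k by (rule linear_weyl_sum[OF _ tensor_linear_smul[OF R_q_linear]])
      (use R_q_basis[OF k _ _ _ \<open>q \<noteq> 0\<close>] \<open>q\<^sup>2 = v\<close> in simp)
  note fixed = norm_intertwining_fixed[OF k z _ assms(8) X]
  have theta: "theta val r ?sz (norm_intertwining val r \<mu> k z f) = R_col r v k ?x (theta val r z f)"
    if f: "f \<in> iwahori_fixed val r z" for f
  proof -
    have "theta val r ?sz (norm_intertwining val r \<mu> k z f) =
        weyl_sum U_fam r ?sz (\<lambda>w. norm_intertwining val r \<mu> k z f (perm_mat r w))"
      by (rule theta_weyl_sum[OF sz fixed[OF f]])
    also have "\<dots> = weyl_sum U_fam r ?sz (R_coeff k v ?x (\<lambda>w. f (perm_mat r w)))"
      unfolding weyl_sum_def using norm_intertwining_perm[OF k z f assms(8) X]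
      by (intro sum.cong) (auto simp: norm_intertwining_R_coeff assms(2))
    finally show ?thesis by (simp add: theta_weyl_sum[OF z f] col)
  qed
  show ?thesis
    unfolding commutative_square_def alt_space_weyl_sum
    using theta fixed by (auto simp: theta_weyl_sum[OF z] theta_weyl_sum[OF sz] col Rq xi_weyl_sum)
qed

end
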